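(* For every connected CW complex $X$ and every $n\ge1$, the space $\mathcal B_n(X)$ is $(n-1)$-connected.
   Context: For a topological space $Z$ and $n\ge 1$, $\mathcal B_n(Z)$ is the space of finitely supported probability measures $\mu=\sum\lambda_z z$ on $Z$ ($\lambda_z\ge0$, $\sum\lambda_z=1$) with $|\mathrm{supp}(\mu)|\le n$. It carries the quotient topology from the map $(z_1,\dots,z_n;t_1,\dots,t_n)\mapsto \sum t_iz_i$ (equivalently, the quotient topology from the symmetric join $\mathrm{Symm}^{*n}(Z)=(Z*\cdots*Z)/S_n$). Connected spaces are nonempty. *)

theory Defs
  imports "HOL-Homology.Homology" "HOL-Library.Disjoint_Sets"
begin

definition closed_disc :: "nat \<Rightarrow> (nat \<Rightarrow> real) topology" where
  "closed_disc k = subtopology (Euclidean_space k) {x. (\<Sum>i<k. x i ^ 2) \<le> 1}"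

definition open_disc :: "nat \<Rightarrow> (nat \<Rightarrow> real) topology" where
  "open_disc k = subtopology (Euclidean_space k) {x. (\<Sum>i<k. x i ^ 2) < 1}"

definition boundary_sphere :: "nat \<Rightarrow> (nat \<Rightarrow> real) set" where
  "boundary_sphere k = {x \<in> topspace (Euclidean_space k). (\<Sum>i<k. x i ^ 2) = 1}"

text \<open>A CW structure in the sense of Whitehead: \<open>E\<close> is the set of open cells, \<open>d e\<close> is the
  dimension of the cell \<open>e\<close> and \<open>\<Phi> e\<close> is its characteristic map. The last two conditions are
  closure finiteness and the weak topology; the number of cells and their dimensions are
  unrestricted.\<close>

definition CW_complex ::
  "'a topology \<Rightarrow> 'a set set \<Rightarrow> ('a set \<Rightarrow> nat) \<Rightarrow> ('a set \<Rightarrow> (nat \<Rightarrow> real) \<Rightarrow> 'a) \<Rightarrow> bool" where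
  "CW_complex X E d \<Phi> \<longleftrightarrow>
     Hausdorff_space X \<and>
     partition_on (topspace X) E \<and>
     (\<forall>e\<in>E. continuous_map (closed_disc (d e)) X (\<Phi> e) \<and>
            homeomorphic_map (open_disc (d e)) (subtopology X e) (\<Phi> e)) \<and>
     (\<forall>e\<in>E. \<exists>F\<subseteq>E. finite F \<and> (\<forall>c\<in>F. d c < d e) \<and> \<Phi> e ` boundary_sphere (d e) \<subseteq> \<Union>F) \<and>
     (\<forall>A\<subseteq>topspace X. closedin X A \<longleftrightarrow> (\<forall>e\<in>E. closedin X (A \<inter> X closure_of e)))"

text \<open>A finitely supported probability measure is represented by its weight function.\<close>

definition finite_prob_measures :: "nat \<Rightarrow> 'a set \<Rightarrow> ('a \<Rightarrow> real) set" where
  "finite_prob_measures n Z =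
     {\<mu>. (\<forall>z. 0 \<le> \<mu> z) \<and> finite {z. \<mu> z \<noteq> 0} \<and> {z. \<mu> z \<noteq> 0} \<subseteq> Z \<and>
         card {z. \<mu> z \<noteq> 0} \<le> n \<and> (\<Sum>z | \<mu> z \<noteq> 0. \<mu> z) = 1}"

definition quotient_topology :: "'b topology \<Rightarrow> 'c set \<Rightarrow> ('b \<Rightarrow> 'c) \<Rightarrow> 'c topology" where
  "quotient_topology Y B q =
     topology (\<lambda>U. U \<subseteq> B \<and> openin Y {y \<in> topspace Y. q y \<in> U})"

text \<open>The map taking \<open>(z\<^sub>0, \<dots>, z\<^bsub>n-1\<^esub>; t\<^sub>0, \<dots>, t\<^bsub>n-1\<^esub>)\<close> to the sum of the \<open>t\<^sub>i z\<^sub>i\<close>; points \<open>z\<^sub>i\<close>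
  that coincide have their weights added.\<close>

definition barycenter_map :: "nat \<Rightarrow> (nat \<Rightarrow> 'a) \<times> (nat \<Rightarrow> real) \<Rightarrow> 'a \<Rightarrow> real" where
  "barycenter_map n = (\<lambda>(z, t) x. \<Sum>i | i < n \<and> z i = x. t i)"

definition weighted_tuples ::
  "nat \<Rightarrow> 'a topology \<Rightarrow> ((nat \<Rightarrow> 'a) \<times> (nat \<Rightarrow> real)) topology" where
  "weighted_tuples n Z =
     prod_topology (product_topology (\<lambda>_. Z) {..<n})
       (subtopology (powertop_real UNIV) (standard_simplex (n - 1)))"

text \<open>Intended for \<open>n \<ge> 1\<close>: \<^term>\<open>standard_simplex (n - 1)\<close> has the \<open>n\<close> coordinates \<open>0, \<dots>, n - 1\<close>.\<close>

definition barycenter_space :: "nat \<Rightarrow> 'a topology \<Rightarrow> ('a \<Rightarrow> real) topology" where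
  "barycenter_space n Z =
     quotient_topology (weighted_tuples n Z) (finite_prob_measures n (topspace Z))
       (barycenter_map n)"

definition nsphere_base :: "nat \<Rightarrow> real" where
  "nsphere_base = (\<lambda>i. if i = 0 then 1 else 0)"

definition based_maps :: "nat \<Rightarrow> 'a topology \<Rightarrow> 'a \<Rightarrow> ((nat \<Rightarrow> real) \<Rightarrow> 'a) set" where
  "based_maps k Y y = {f. continuous_map (nsphere k) Y f \<and> f nsphere_base = y}"

text \<open>The underlying set of the \<open>k\<close>-th homotopy group of \<open>Y\<close> at \<open>y\<close> (for \<open>k = 0\<close>, the set of path
  components). Homotopies are required to keep the base point at \<open>y\<close>.\<close>

definition homotopy_set :: "nat \<Rightarrow> 'a topology \<Rightarrow> 'a \<Rightarrow> ((nat \<Rightarrow> real) \<Rightarrow> 'a) set set" where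
  "homotopy_set k Y y =
     based_maps k Y y //
       {(f, g). homotopic_with (\<lambda>h. h nsphere_base = y) (nsphere k) Y f g}"

definition n_connected_space :: "nat \<Rightarrow> 'a topology \<Rightarrow> bool" where
  "n_connected_space m Y \<longleftrightarrow>
     topspace Y \<noteq> {} \<and> (\<forall>k\<le>m. \<forall>y\<in>topspace Y. is_singleton (homotopy_set k Y y))"

lemma openin_quotient_topology:
  "openin (quotient_topology Y B q) U \<longleftrightarrow> U \<subseteq> B \<and> openin Y {y \<in> topspace Y. q y \<in> U}"
proof -
  have "istopology (\<lambda>U. U \<subseteq> B \<and> openin Y {y \<in> topspace Y. q y \<in> U})"
    unfolding istopology_def
  proof (intro conjI allI impI)
    fix S T
    assume "S \<subseteq> B \<and> openin Y {y \<in> topspace Y. q y \<in> S}"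
      and "T \<subseteq> B \<and> openin Y {y \<in> topspace Y. q y \<in> T}"
    moreover have "{y \<in> topspace Y. q y \<in> S \<inter> T} =
        {y \<in> topspace Y. q y \<in> S} \<inter> {y \<in> topspace Y. q y \<in> T}" by auto
    ultimately show "S \<inter> T \<subseteq> B" "openin Y {y \<in> topspace Y. q y \<in> S \<inter> T}" by auto
  next
    fix \<K>
    assume K: "\<forall>K\<in>\<K>. K \<subseteq> B \<and> openin Y {y \<in> topspace Y. q y \<in> K}"
    then show "\<Union>\<K> \<subseteq> B" by auto
    have "{y \<in> topspace Y. q y \<in> \<Union>\<K>} = (\<Union>K\<in>\<K>. {y \<in> topspace Y. q y \<in> K})" by auto
    with K show "openin Y {y \<in> topspace Y. q y \<in> \<Union>\<K>}" by auto
  qed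
  then show ?thesis
    by (simp add: quotient_topology_def topology_inverse')
qed

lemma quotient_map_quotient_topology:
  assumes "q ` topspace Y = B"
  shows "quotient_map Y (quotient_topology Y B q) q"
proof -
  have "{y \<in> topspace Y. q y \<in> B} = topspace Y" using assms by auto
  then have "openin (quotient_topology Y B q) B"
    by (simp add: openin_quotient_topology)
  then have "topspace (quotient_topology Y B q) = B"
    by (metis openin_quotient_topology openin_subset openin_topspace subset_antisym)
  then show ?thesis
    using assms by (auto simp: quotient_map_def openin_quotient_topology)
qed

lemma barycenter_map_image:
  assumes "1 \<le> n"
  shows "barycenter_map n ` topspace (weighted_tuples n Z) = finite_prob_measures n (topspace Z)"
proof (intro subset_antisym subsetI)
  fix \<mu> assume "\<mu> \<in> barycenter_map n ` topspace (weighted_tuples n Z)"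
  then obtain z t where z: "z \<in> {..<n} \<rightarrow>\<^sub>E topspace Z" and t: "t \<in> standard_simplex (n - 1)"
    and \<mu>: "\<mu> = barycenter_map n (z, t)"
    by (auto simp: weighted_tuples_def)
  have t0: "0 \<le> t i" for i using t by (auto simp: standard_simplex_def)
  have "{..n - 1} = {..<n}" using assms by auto
  then have t1: "(\<Sum>i<n. t i) = 1" using t by (simp add: standard_simplex_def)
  have \<mu>x: "\<mu> x = (\<Sum>i | i < n \<and> z i = x. t i)" for x by (simp add: \<mu> barycenter_map_def)
  have supp: "{x. \<mu> x \<noteq> 0} \<subseteq> z ` {..<n}"
  proof
    fix x assume "x \<in> {x. \<mu> x \<noteq> 0}"
    then have "(\<Sum>i | i < n \<and> z i = x. t i) \<noteq> 0" by (simp only: mem_Collect_eq \<mu>x not_False_eq_True)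
    then have "{i. i < n \<and> z i = x} \<noteq> {}" by (rule contrapos_nn) (simp only: sum.empty)
    then show "x \<in> z ` {..<n}" by auto
  qed
  then have fin: "finite {x. \<mu> x \<noteq> 0}" by (rule finite_subset) simp
  have "card {x. \<mu> x \<noteq> 0} \<le> card (z ` {..<n})" using supp by (simp add: card_mono)
  also have "\<dots> \<le> n" by (metis card_image_le card_lessThan finite_lessThan)
  finally have card: "card {x. \<mu> x \<noteq> 0} \<le> n" .
  have "(\<Sum>x | \<mu> x \<noteq> 0. \<mu> x) = (\<Sum>x\<in>z ` {..<n}. \<mu> x)"
    using supp by (intro sum.mono_neutral_left) auto
  also have "\<dots> = (\<Sum>x\<in>z ` {..<n}. \<Sum>i | i \<in> {..<n} \<and> z i = x. t i)" by (simp add: \<mu>x)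
  also have "\<dots> = (\<Sum>i<n. t i)" by (intro sum.group) auto
  finally have "(\<Sum>x | \<mu> x \<noteq> 0. \<mu> x) = 1" using t1 by simp
  moreover have "0 \<le> \<mu> x" for x by (simp add: \<mu>x sum_nonneg t0)
  moreover have "z ` {..<n} \<subseteq> topspace Z" using z by auto
  ultimately show "\<mu> \<in> finite_prob_measures n (topspace Z)"
    using supp fin card by (auto simp: finite_prob_measures_def)
next
  fix \<mu> assume \<mu>: "\<mu> \<in> finite_prob_measures n (topspace Z)"
  define S where "S = {x. \<mu> x \<noteq> 0}"
  define m where "m = card S"
  have fin: "finite S" and SZ: "S \<subseteq> topspace Z" and mn: "m \<le> n" and s1: "(\<Sum>x\<in>S. \<mu> x) = 1"
    and \<mu>0: "\<And>x. 0 \<le> \<mu> x"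
    using \<mu> by (auto simp: finite_prob_measures_def S_def m_def)
  have "S \<noteq> {}" using s1 by auto
  then have m0: "0 < m" using fin by (simp add: m_def card_gt_0_iff)
  obtain h where h: "bij_betw h {..<m} S"
    using fin by (metis atLeast0LessThan ex_bij_betw_nat_finite m_def)
  define z where "z = (\<lambda>i\<in>{..<n}. if i < m then h i else h 0)"
  define t where "t = (\<lambda>i. if i < m then \<mu> (h i) else 0)"
  have hS: "h i \<in> S" if "i < m" for i using h that by (auto simp: bij_betw_def)
  have "z \<in> {..<n} \<rightarrow>\<^sub>E topspace Z"
    using hS m0 SZ by (auto simp: z_def)
  moreover have "t \<in> standard_simplex (n - 1)"
  proof -
    have "(\<Sum>i\<le>n - 1. t i) = (\<Sum>i<m. \<mu> (h i))"
      using mn m0 by (intro sum.mono_neutral_cong_right) (auto simp: t_def)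
    also have "\<dots> = 1" using s1 sum.reindex_bij_betw[OF h, of \<mu>] by simp
    finally have 1: "(\<Sum>i\<le>n - 1. t i) = 1" .
    have "\<mu> x \<le> 1" if "x \<in> S" for x
      using member_le_sum[OF that, of \<mu>] \<mu>0 fin s1 by simp
    then have "0 \<le> t i \<and> t i \<le> 1" for i using hS \<mu>0 by (auto simp: t_def)
    moreover have "t i = 0" if "i > n - 1" for i using that mn by (auto simp: t_def)
    ultimately show ?thesis using 1 by (simp add: standard_simplex_def)
  qed
  ultimately have "(z, t) \<in> topspace (weighted_tuples n Z)" by (simp add: weighted_tuples_def)
  moreover have "barycenter_map n (z, t) x = \<mu> x" for x
  proof -
    have "barycenter_map n (z, t) x = (\<Sum>i | i < n \<and> z i = x. t i)"
      by (simp add: barycenter_map_def)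
    also have "\<dots> = (\<Sum>i | i < m \<and> h i = x. \<mu> (h i))"
      using mn by (intro sum.mono_neutral_cong_right) (auto simp: t_def z_def)
    also have "\<dots> = \<mu> x"
    proof (cases "x \<in> S")
      case True
      then obtain j where j: "j < m" "h j = x" using h by (auto simp: bij_betw_def)
      then have "{i. i < m \<and> h i = x} = {j}"
        using h by (auto simp: bij_betw_def inj_on_def)
      then show ?thesis using j by simp
    next
      case False
      then have "{i. i < m \<and> h i = x} = {}" using hS by blast
      then show ?thesis using False by (simp only: S_def) simp
    qed
    finally show ?thesis .
  qed
  ultimately show "\<mu> \<in> barycenter_map n ` topspace (weighted_tuples n Z)"
    using image_eqI[of \<mu> "barycenter_map n" "(z, t)"] by (simp add: fun_eq_iff)
qed

lemma quotient_map_barycenter_map: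
  assumes "1 \<le> n"
  shows "quotient_map (weighted_tuples n Z) (barycenter_space n Z) (barycenter_map n)"
  unfolding barycenter_space_def
  by (intro quotient_map_quotient_topology barycenter_map_image assms)

end

theory Submission
  imports Defs "HOL-Analysis.Analysis"
begin

text \<open>A map to \<open>B\<^sub>n(X)\<close> from the boundary of an \<open>m\<close>-cube, \<open>m \<le> n\<close>, is deformed to a map of the form
  \<open>x \<mapsto> \<Sum> w\<^sub>c(x) a\<^sub>c\<close>, where \<open>c\<close> ranges over the cells of a fine cubical grid and the cells with
  \<open>w\<^sub>c(x) > 0\<close> form a flag, so that at most \<open>m\<close> points are used. As \<open>X\<close> is path connected, all points
  \<open>a\<^sub>c\<close> can then be moved to a single one without enlarging any support, so the map is null-homotopic.

  The deformation is constructed cell by cell, with carriers of the form ``measures that charge the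
  open set \<open>\<Omega>\<close>''. Such carriers can be filled: for a small neighbourhood \<open>N\<close> in \<open>\<Omega>\<close> of finitely many
  points, a measure charging \<open>N\<close> is contracted by fading out its mass off \<open>N\<close>, contracting \<open>N\<close> in \<open>X\<close> to
  these points, and shifting all mass linearly to one of them; no step needs more than \<open>n\<close> points.
  The only properties of \<open>X\<close> that enter are path connectedness, separation and local contractibility.\<close>

section \<open>Discs\<close>

text \<open>\<open>barycenter_space n X\<close> has a quotient topology and \<open>X\<close> need
  not be locally compact. Maps out of it are therefore checked on weighted tuples, with time added
  through the locally compact interval, and maps into it are lifted to tuples, if necessary on
  finitely many closed pieces. Measures charging a set contract only through measures charging a
  larger set, so each dimension filled in consumes one level of a tower of carriers. The levels must
  be nested also at different nearby parameters, although the support of \<open>f p\<close> does not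
  vary continuously. Asking merely for some mass in a carrier makes this possible: a level may miss
  up to \<open>n\<close> light points, so the tolerated loss grows by the factor \<open>n\<close>,
  and a tolerance of 1/n^L at the outermost of L levels still leaves positive mass in the innermost
  one.\<close>

definition rad :: "nat \<Rightarrow> (nat \<Rightarrow> real) \<Rightarrow> real" where
  "rad k y = sqrt (\<Sum>i<k. (y i)\<^sup>2)"

definition cdisc :: "nat \<Rightarrow> (nat \<Rightarrow> real) set" where
  "cdisc k = {y. (\<forall>i\<ge>k. y i = 0) \<and> rad k y \<le> 1}"

abbreviation unit_interval :: "real topology" ("\<I>") where
  "\<I> \<equiv> top_of_set {0..1}"

lemma rad_nonneg [simp]: "0 \<le> rad k y"
  by (simp add: rad_def sum_nonneg)

lemma rad_scale: "rad k (\<lambda>i. c * y i) = \<bar>c\<bar> * rad k y"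
  by (simp add: rad_def power_mult_distrib sum_distrib_left[symmetric] real_sqrt_mult)

lemma rad_le_1_iff: "rad k y \<le> 1 \<longleftrightarrow> (\<Sum>i<k. (y i)\<^sup>2) \<le> 1"
  by (simp add: rad_def)

lemma rad_eq_1_iff: "rad k y = 1 \<longleftrightarrow> (\<Sum>i<k. (y i)\<^sup>2) = 1"
  by (simp add: rad_def)

lemma rad_less_1_iff: "rad k y < 1 \<longleftrightarrow> (\<Sum>i<k. (y i)\<^sup>2) < 1"
  by (simp add: rad_def)

lemma abs_coord_le_rad: "i < k \<Longrightarrow> \<bar>y i\<bar> \<le> rad k y"
  unfolding rad_def using member_le_sum[of i "{..<k}" "\<lambda>i. (y i)\<^sup>2"] by (intro real_le_rsqrt) simp

lemma closed_disc_eq: "closed_disc k = top_of_set (cdisc k)"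
  by (simp add: closed_disc_def Euclidean_space_def euclidean_product_topology subtopology_subtopology
      cdisc_def rad_le_1_iff Collect_conj_eq)

lemma topspace_closed_disc [simp]: "topspace (closed_disc k) = cdisc k"
  by (simp add: closed_disc_eq)

lemma topspace_open_disc: "topspace (open_disc k) = {y \<in> cdisc k. rad k y < 1}"
  by (auto simp: open_disc_def topspace_Euclidean_space cdisc_def rad_less_1_iff rad_le_1_iff)

lemma boundary_sphere_eq: "boundary_sphere k = {y \<in> cdisc k. rad k y = 1}"
  by (auto simp: boundary_sphere_def topspace_Euclidean_space cdisc_def rad_eq_1_iff rad_le_1_iff)

lemma boundary_sphere_subset: "boundary_sphere k \<subseteq> cdisc k"
  by (auto simp: boundary_sphere_eq)

lemma open_disc_conv: "topspace (open_disc k) = cdisc k - boundary_sphere k"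
  by (auto simp: topspace_open_disc boundary_sphere_eq cdisc_def)

lemma continuous_on_coord [continuous_intros]:
  "continuous_on S (\<lambda>x. (x :: 'i \<Rightarrow> real) i)"
  "continuous_on S' (\<lambda>q. (snd q :: 'i \<Rightarrow> real) i)"
  by (rule continuous_on_product_then_coordinatewise, intro continuous_intros)+

lemma continuous_on_rad [continuous_intros]:
  "continuous_on S (\<lambda>x. rad k x)"
  "continuous_on S' (\<lambda>q. rad k (snd q))"
  unfolding rad_def by (intro continuous_intros)+

lemma closed_cdisc: "closed (cdisc k)"
proof -
  have "cdisc k = (\<Inter>i\<in>{k..}. {y. y i = 0}) \<inter> {y. rad k y \<le> 1}"
    by (auto simp: cdisc_def)
  moreover have "closed {y :: nat \<Rightarrow> real. y i = 0}" for i
    by (intro closed_Collect_eq continuous_intros)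
  moreover have "closed {y :: nat \<Rightarrow> real. rad k y \<le> 1}"
    by (intro closed_Collect_le continuous_intros)
  ultimately show ?thesis by (metis (no_types, lifting) closed_INT closed_Int)
qed

text \<open>Tychonoff: all infinitely many coordinates are confined to compact intervals. Discs get
  their compactness from here as closed subsets, grid cells as boxes with degenerate sides.\<close>

lemma compact_box: "compact {y :: nat \<Rightarrow> real. \<forall>i. a i \<le> y i \<and> y i \<le> b i}"
proof -
  have "compactin (product_topology (\<lambda>_. euclideanreal) UNIV) (PiE UNIV (\<lambda>i. {a i..b i}))"
    by (simp add: compactin_PiE)
  moreover have "PiE UNIV (\<lambda>i. {a i..b i}) = {y. \<forall>i. a i \<le> y i \<and> y i \<le> b i}"
    by (auto simp: PiE_iff)
  ultimately show ?thesis by (simp add: euclidean_product_topology)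
qed

lemma compact_cdisc: "compact (cdisc k)"
proof -
  have "cdisc k \<subseteq> {y. \<forall>i. - 1 \<le> y i \<and> y i \<le> 1}"
  proof clarsimp
    fix y i assume "y \<in> cdisc k"
    then show "- 1 \<le> y i \<and> y i \<le> 1"
      using abs_coord_le_rad[of i k y] by (cases "i < k") (auto simp: cdisc_def)
  qed
  then have "cdisc k = cdisc k \<inter> {y. \<forall>i. - 1 \<le> y i \<and> y i \<le> 1}" by blast
  moreover have "compact (cdisc k \<inter> {y. \<forall>i. - 1 \<le> y i \<and> y i \<le> 1})"
    using compact_box[of "\<lambda>_. - 1" "\<lambda>_. 1"] closed_cdisc closed_Int_compact by blast
  ultimately show ?thesis by simp
qed

lemma compact_boundary_sphere: "compact (boundary_sphere k)"
proof -
  have "boundary_sphere k = cdisc k \<inter> {y. rad k y = 1}"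
    by (auto simp: boundary_sphere_eq)
  moreover have "closed {y :: nat \<Rightarrow> real. rad k y = 1}"
    by (intro closed_Collect_eq continuous_intros)
  ultimately show ?thesis by (simp add: compact_cdisc compact_Int_closed)
qed

lemma convex_cdisc:
  assumes "x \<in> cdisc k" "y \<in> cdisc k" "0 \<le> s" "s \<le> 1"
  shows "(\<lambda>i. x i + s * (y i - x i)) \<in> cdisc k"
proof -
  have "L2_set (\<lambda>i. (1 - s) * x i + s * y i) {..<k}
      \<le> L2_set (\<lambda>i. (1 - s) * x i) {..<k} + L2_set (\<lambda>i. s * y i) {..<k}"
    by (rule L2_set_triangle_ineq)
  moreover have "L2_set z {..<k} = rad k z" for z
    by (simp add: L2_set_def rad_def)
  ultimately have "rad k (\<lambda>i. (1 - s) * x i + s * y i) \<le> (1 - s) * rad k x + s * rad k y"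
    using assms by (simp add: rad_scale)
  also have "\<dots> \<le> (1 - s) * 1 + s * 1"
    using assms by (intro add_mono mult_left_mono) (auto simp: cdisc_def)
  finally have "rad k (\<lambda>i. (1 - s) * x i + s * y i) \<le> 1" by simp
  moreover have "(\<lambda>i. (1 - s) * x i + s * y i) = (\<lambda>i. x i + s * (y i - x i))"
    by (auto simp: algebra_simps)
  ultimately show ?thesis
    using assms by (auto simp: cdisc_def)
qed

lemma path_connected_closed_disc: "path_connectedin (closed_disc k) (cdisc k)"
proof -
  have "path_component (cdisc k) x y" if "x \<in> cdisc k" "y \<in> cdisc k" for x y
    unfolding path_component_def path_def path_image_def pathstart_def pathfinish_def
    using convex_cdisc[OF that]
    by (intro exI[of _ "\<lambda>s i. x i + s * (y i - x i)"])
       (auto intro!: continuous_intros continuous_on_coordinatewise_then_product)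
  then have "path_connected (cdisc k)"
    by (simp add: path_connected_component)
  then show ?thesis
    by (simp add: closed_disc_eq path_connectedin_subtopology)
qed

text \<open>The collar of width \<open>\<epsilon>\<close> is pushed outwards with time; a point that reaches the boundary
  follows the given homotopy there from then on, at double speed but never ahead of time.\<close>

lemma disc_extend:
  assumes \<Phi>: "continuous_map (closed_disc k) X \<Phi>"
    and b: "continuous_map (top_of_set (boundary_sphere k)) euclideanreal b"
    and b01: "\<And>u. u \<in> boundary_sphere k \<Longrightarrow> 0 \<le> b u \<and> b u \<le> 1"
    and g: "continuous_map (prod_topology \<I> (top_of_set (boundary_sphere k))) X (\<lambda>(t, u). g t u)"
    and g0: "\<And>u. u \<in> boundary_sphere k \<Longrightarrow> g 0 u = \<Phi> u"
    and W: "openin X W"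
    and gW: "\<And>u. u \<in> boundary_sphere k \<Longrightarrow> 1/2 \<le> b u \<Longrightarrow> g 1 u = z \<and> (\<forall>t\<in>{0..1}. g t u \<in> W)"
  shows "\<exists>p h. continuous_map (closed_disc k) euclideanreal p \<and>
      continuous_map (prod_topology \<I> (closed_disc k)) X (\<lambda>(t, y). h t y) \<and>
      (\<forall>u\<in>boundary_sphere k. p u = b u \<and> (\<forall>t\<in>{0..1}. h t u = g t u)) \<and>
      (\<forall>y\<in>cdisc k. 0 \<le> p y \<and> p y \<le> 1 \<and> h 0 y = \<Phi> y \<and>
         (1/2 \<le> p y \<longrightarrow> h 1 y = z \<and> (\<forall>t\<in>{0..1}. h t y \<in> W)))"
proof -
  let ?S = "boundary_sphere k"
  define K where "K = {u \<in> ?S. 1/2 \<le> b u}"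
  define T where "T = {p \<in> {0..1} \<times> ?S. \<Phi> (\<lambda>i. (1 - fst p) * snd p i) \<in> W}"
  have bc: "continuous_on ?S b" using b by simp
  have Kcl: "closedin (top_of_set ?S) K"
    unfolding K_def using continuous_on_closed_Collect_le[OF continuous_on_const bc, of "1/2"]
      compact_boundary_sphere[of k, THEN compact_imp_closed] by (auto intro: closed_subset)
  have Kc: "compactin (top_of_set ?S) K"
    using closedin_compact_space[OF _ Kcl] compact_boundary_sphere
    by (simp add: compact_space_subtopology)
  have scale_in: "(\<lambda>i. c * y i) \<in> cdisc k" if "y \<in> cdisc k" "0 \<le> c" "c * rad k y \<le> 1" for c y
    using that by (auto simp: cdisc_def rad_scale)
  have "continuous_map (prod_topology \<I> (top_of_set ?S)) (closed_disc k) (\<lambda>p i. (1 - fst p) * snd p i)"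
    unfolding closed_disc_eq
    by (auto intro!: continuous_intros continuous_on_coordinatewise_then_product scale_in
        simp: boundary_sphere_eq)
  then have "continuous_map (prod_topology \<I> (top_of_set ?S)) X (\<lambda>p. \<Phi> (\<lambda>i. (1 - fst p) * snd p i))"
    using continuous_map_compose[OF _ \<Phi>] by (simp add: o_def)
  from openin_continuous_map_preimage[OF this W]
  have Top: "openin (prod_topology \<I> (top_of_set ?S)) T"
    by (simp add: T_def)
  have "{0} \<times> K \<subseteq> T"
  proof clarify
    fix u assume "u \<in> K"
    then have u: "u \<in> ?S" "1/2 \<le> b u" by (auto simp: K_def)
    then have "g 0 u \<in> W" using gW[OF u] by auto
    then show "(0, u) \<in> T" using g0[OF u(1)] u(1) by (simp add: T_def)
  qed
  \<comment> \<open>\<open>K\<close> is compact, so one collar width serves all boundary points with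
    bump at least 1/2.\<close>
  from tube_lemma_right[OF Top Kc _ this] obtain U V where
    UV: "openin \<I> U" "0 \<in> U" "K \<subseteq> V" "U \<times> V \<subseteq> T" by auto
  obtain e where e: "e > 0" "\<And>s. s \<in> {0..1} \<Longrightarrow> dist s 0 < e \<Longrightarrow> s \<in> U"
    using UV(1,2) unfolding openin_euclidean_subtopology_iff by blast
  \<comment> \<open>The bound 1/4 keeps the collar of depth 2\<epsilon> at radius at least 1/2, so
    normalisation stays away from the origin; the bound e/2 puts all depths up to \<epsilon> into
    the tube.\<close>
  define \<epsilon> where "\<epsilon> = min (e/2) (1/4)"
  have \<epsilon>: "0 < \<epsilon>" "\<epsilon> \<le> 1/4" using e by (auto simp: \<epsilon>_def)
  have col: "\<Phi> (\<lambda>i. (1 - s) * u i) \<in> W" if "0 \<le> s" "s \<le> \<epsilon>" "u \<in> ?S" "1/2 \<le> b u" for s u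
  proof -
    have "s \<in> U" using that e \<epsilon> by (intro e(2)) (auto simp: \<epsilon>_def)
    moreover have "u \<in> V" using that UV by (auto simp: K_def)
    ultimately show ?thesis using UV by (auto simp: T_def)
  qed
  have Scl: "closed ?S" by (simp add: compact_boundary_sphere compact_imp_closed)
  have nrm: "(\<lambda>i. y i / rad k y) \<in> ?S" if "y \<in> cdisc k" "rad k y > 0" for y
  proof -
    have "rad k (\<lambda>i. inverse (rad k y) * y i) = 1" using that by (simp add: rad_scale)
    then show ?thesis using that by (simp add: boundary_sphere_eq cdisc_def field_simps)
  qed
  \<comment> \<open>\<open>c\<close> is a cut-off, 1 up to depth \<epsilon> and 0 from depth
    2\<epsilon> on. \<open>a\<close> is the pushed radius, which may exceed 1, and \<open>sc\<close>
    the factor that realises it; the maximum with 1/2 avoids dividing by 0 and changes nothing,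
    because \<open>c\<close> vanishes there.\<close>
  define c where "c = (\<lambda>y. max 0 (min 1 ((rad k y - (1 - 2*\<epsilon>)) / \<epsilon>)))"
  define a where "a = (\<lambda>(t, y). rad k y + 2 * \<epsilon> * t * c y)"
  define sc where "sc = (\<lambda>(t, y). 1 + 2 * \<epsilon> * t * c y / max (rad k y) (1/2))"
  define h where "h = (\<lambda>t y. if a (t, y) \<le> 1 then \<Phi> (\<lambda>i. sc (t, y) * y i)
      else g (min t ((a (t, y) - 1) / \<epsilon>)) (\<lambda>i. y i / rad k y))"
  \<comment> \<open>Subtracting the depth over 2\<epsilon> makes the bump die out by depth
    2\<epsilon>. A value of at least 1/2 forces depth at most \<epsilon> and a value of at least 1/2
    at the boundary point of the same ray.\<close>
  define p where "p = (\<lambda>y. if rad k y \<le> 1/2 then 0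
      else max 0 (b (\<lambda>i. y i / rad k y) - (1 - rad k y) / (2 * \<epsilon>)))"
  have c01: "0 \<le> c y" "c y \<le> 1" for y by (auto simp: c_def)
  have c0: "c y = 0" if "rad k y \<le> 1/2" for y
  proof -
    have "rad k y - (1 - 2*\<epsilon>) \<le> 0" using that \<epsilon> by auto
    then show ?thesis using \<epsilon> by (simp add: c_def divide_nonpos_pos)
  qed
  have ra: "rad k y \<le> a (t, y)" if "0 \<le> t" for t y
    using c01[of y] \<epsilon> that by (simp add: a_def)
  have sca: "sc (t, y) * rad k y = a (t, y)" for t y
  proof (cases "rad k y \<le> 1/2")
    case True then show ?thesis by (simp add: sc_def a_def c0)
  next
    case False then show ?thesis by (simp add: sc_def a_def field_simps max_def)
  qed
  have sc0: "0 \<le> sc (t, y)" if "0 \<le> t" for t y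
    using c01[of y] \<epsilon> that by (simp add: sc_def)
  have agt: "rad k y > 1/2" if "1 \<le> a (t, y)" for t y
    using that c0[of y] by (force simp: a_def)
  have cont_c: "continuous_on A (\<lambda>q. c (snd q))" for A :: "(real \<times> (nat \<Rightarrow> real)) set"
    unfolding c_def using \<epsilon> by (intro continuous_intros) auto
  have cont_a: "continuous_on A a" for A
    unfolding a_def case_prod_beta by (intro continuous_intros cont_c)
  have cont_sc: "continuous_on A sc" for A
    unfolding sc_def case_prod_beta by (intro continuous_intros cont_c) (auto simp: max_def)
  have ptop: "prod_topology \<I> (closed_disc k) = top_of_set ({0..1} \<times> cdisc k)"
    by (simp add: closed_disc_eq)
  have hc: "continuous_map (prod_topology \<I> (closed_disc k)) X
     (\<lambda>q. if a q \<le> 1 then \<Phi> (\<lambda>i. sc q * snd q i)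
          else g (min (fst q) ((a q - 1) / \<epsilon>)) (\<lambda>i. snd q i / rad k (snd q)))"
    unfolding ptop
  proof (rule continuous_map_cases_le)
    let ?T = "top_of_set ({0..1} \<times> cdisc k)"
    let ?A = "{x \<in> topspace ?T. a x \<le> 1}" and ?B = "{x \<in> topspace ?T. 1 \<le> a x}"
    have "continuous_map (subtopology ?T ?A)
       (closed_disc k) (\<lambda>q i. sc q * snd q i)"
      unfolding closed_disc_eq subtopology_subtopology continuous_map_subtopology_eu
    proof (intro conjI Pi_I)
      show "continuous_on (({0..1} \<times> cdisc k) \<inter> ?A) (\<lambda>q i. sc q * snd q i)"
        by (intro continuous_intros continuous_on_coordinatewise_then_product cont_sc)
      show "(\<lambda>i. sc q * snd q i) \<in> cdisc k" 
        if "q \<in> ({0..1} \<times> cdisc k) \<inter> ?A" for q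
        using that sc0 sca by (cases q) (auto intro!: scale_in)
    qed
    from continuous_map_compose[OF this \<Phi>]
    show "continuous_map (subtopology ?T ?A)
       X (\<lambda>q. \<Phi> (\<lambda>i. sc q * snd q i))" by (simp add: o_def)
    have "continuous_map (subtopology ?T ?B)
       (prod_topology \<I> (top_of_set ?S)) (\<lambda>q. (min (fst q) ((a q - 1) / \<epsilon>), (\<lambda>i. snd q i / rad k (snd q))))"
      unfolding subtopology_subtopology prod_topology_subtopology_eu continuous_map_subtopology_eu
    proof (intro conjI Pi_I)
      show "continuous_on ({0..1} \<times> cdisc k \<inter> ?B)
         (\<lambda>q. (min (fst q) ((a q - 1) / \<epsilon>), \<lambda>i. snd q i / rad k (snd q)))"
        using \<epsilon> agt by (intro continuous_intros continuous_on_coordinatewise_then_product cont_a) force+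
      show "(min (fst q) ((a q - 1) / \<epsilon>), \<lambda>i. snd q i / rad k (snd q)) \<in> {0..1} \<times> ?S"
        if "q \<in> {0..1} \<times> cdisc k \<inter> ?B" for q
        using that agt[of "fst q" "snd q"] \<epsilon> by (cases q) (auto intro!: nrm)
    qed
    from continuous_map_compose[OF this g]
    show "continuous_map (subtopology ?T ?B)
       X (\<lambda>q. g (min (fst q) ((a q - 1) / \<epsilon>)) (\<lambda>i. snd q i / rad k (snd q)))" by (simp add: o_def)
    show "continuous_map (top_of_set ({0..1} \<times> cdisc k)) euclideanreal a" by (simp add: cont_a)
    show "continuous_map (top_of_set ({0..1} \<times> cdisc k)) euclideanreal (\<lambda>x. 1)" by simp
    fix q assume q: "q \<in> topspace (top_of_set ({0..1} \<times> cdisc k))" and aq: "a q = 1"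
    obtain t y where ty: "q = (t, y)" by (cases q)
    have r: "rad k y > 1/2" using agt[of t y] aq ty by simp
    have "sc q = 1 / rad k y" using sca[of t y] aq ty r by (simp add: field_simps)
    moreover have "min t 0 = 0" using q ty by auto
    ultimately show "\<Phi> (\<lambda>i. sc q * snd q i) = g (min (fst q) ((a q - 1) / \<epsilon>)) (\<lambda>i. snd q i / rad k (snd q))"
      using aq ty g0[OF nrm, of y] q r by simp
  qed
  have pc: "continuous_map (closed_disc k) euclideanreal p"
    unfolding p_def closed_disc_eq
  proof (rule continuous_map_cases_le)
    have "continuous_on (cdisc k \<inter> {x \<in> topspace (top_of_set (cdisc k)). 1 / 2 \<le> rad k x})
         (\<lambda>y. b (\<lambda>i. y i / rad k y))"
      using nrm by (intro continuous_on_compose2[OF bc] continuous_intros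
          continuous_on_coordinatewise_then_product) force+
    then show "continuous_map (subtopology (top_of_set (cdisc k)) {x \<in> topspace (top_of_set (cdisc k)). 1 / 2 \<le> rad k x})
     euclideanreal (\<lambda>y. max 0 (b (\<lambda>i. y i / rad k y) - (1 - rad k y) / (2 * \<epsilon>)))"
      using \<epsilon> by (auto simp: subtopology_subtopology intro!: continuous_intros)
    fix y assume y: "y \<in> topspace (top_of_set (cdisc k))" "rad k y = 1/2"
    have "b (\<lambda>i. y i / rad k y) \<le> 1" using b01 nrm y by simp
    moreover have "1 \<le> (1 - rad k y) / (2 * \<epsilon>)" using \<epsilon> y(2) by (simp add: field_simps)
    ultimately have "b (\<lambda>i. y i / rad k y) - (1 - rad k y) / (2 * \<epsilon>) \<le> 0" by linarith
    then show "0 = max 0 (b (\<lambda>i. y i / rad k y) - (1 - rad k y) / (2 * \<epsilon>))" by simp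
  qed (auto intro!: continuous_intros)
  have bd: "p u = b u \<and> (\<forall>t\<in>{0..1}. h t u = g t u)" if u: "u \<in> ?S" for u
  proof -
    have r: "rad k u = 1" using u by (simp add: boundary_sphere_eq)
    have c1: "c u = 1" using \<epsilon> r by (simp add: c_def)
    have "h t u = g t u" if t: "t \<in> {0..1}" for t
    proof (cases "t = 0")
      case True
      then show ?thesis by (simp add: h_def a_def sc_def r g0 u)
    next
      case False
      then have "0 < \<epsilon> * t" using t \<epsilon> by simp
      then have "\<not> a (t, u) \<le> 1" "(a (t, u) - 1) / \<epsilon> = 2 * t" using \<epsilon> by (auto simp: a_def r c1)
      then show ?thesis using t by (simp add: h_def r min_def)
    qed
    then show ?thesis using b01 u by (simp add: p_def r)
  qed
  have int: "0 \<le> p y \<and> p y \<le> 1 \<and> h 0 y = \<Phi> y \<and>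
         (1/2 \<le> p y \<longrightarrow> h 1 y = z \<and> (\<forall>t\<in>{0..1}. h t y \<in> W))" if y: "y \<in> cdisc k" for y
  proof (intro conjI impI)
    show "0 \<le> p y" by (simp add: p_def)
    show "p y \<le> 1"
    proof (cases "rad k y \<le> 1/2")
      case False
      then have "b (\<lambda>i. y i / rad k y) \<le> 1" using b01 nrm y by simp
      moreover have "0 \<le> (1 - rad k y) / (2 * \<epsilon>)" using \<epsilon> y by (auto simp: cdisc_def)
      ultimately show ?thesis by (auto simp: p_def)
    qed (simp add: p_def)
    show "h 0 y = \<Phi> y" using y by (simp add: h_def a_def sc_def cdisc_def)
    assume py: "1/2 \<le> p y"
    define u where "u = (\<lambda>i. y i / rad k y)"
    have r: "rad k y > 1/2" using py by (auto simp: p_def split: if_splits)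
    have r1: "rad k y \<le> 1" using y by (simp add: cdisc_def)
    have bu: "1/2 \<le> b u - (1 - rad k y) / (2 * \<epsilon>)" using py r by (auto simp: p_def u_def max_def split: if_splits)
    have uS: "u \<in> ?S" unfolding u_def using nrm r y by simp
    have "(1 - rad k y) / (2 * \<epsilon>) \<ge> 0" using r1 \<epsilon> by simp
    with bu have bu2: "1/2 \<le> b u" by linarith
    have "(1 - rad k y) / (2 * \<epsilon>) \<le> 1/2" using bu b01[OF uS] by linarith
    then have r2: "rad k y \<ge> 1 - \<epsilon>" using \<epsilon> by (simp add: field_simps)
    then have c1: "c y = 1" using \<epsilon> by (simp add: c_def field_simps)
    have hty: "h t y \<in> W" if t: "t \<in> {0..1}" for t
    proof (cases "a (t, y) \<le> 1")
      case True
      have "sc (t, y) * y i = (1 - (1 - a (t, y))) * u i" for i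
        using sca[of t y] r by (simp add: u_def field_simps)
      moreover have "1 - a (t, y) \<le> \<epsilon>" using ra[of t y] t r2 by simp
      ultimately show ?thesis using col[of "1 - a (t, y)" u] True uS bu2 by (simp add: h_def)
    next
      case False
      then have "0 \<le> (a (t, y) - 1) / \<epsilon>" using \<epsilon> by simp
      then have "min t ((a (t, y) - 1) / \<epsilon>) \<in> {0..1}" using t by (auto simp: min_def)
      then show ?thesis using gW[OF uS bu2] False by (simp add: h_def u_def[symmetric])
    qed
    then show "\<forall>t\<in>{0..1}. h t y \<in> W" by blast
    \<comment> \<open>This is why the push has length 2\<epsilon>: from depth at most \<epsilon> the
      point ends at least \<epsilon> beyond the boundary, so the boundary homotopy has run to time
      1.\<close>
    have "a (1, y) - 1 \<ge> \<epsilon>" using r2 by (simp add: a_def c1)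
    then have "\<not> a (1, y) \<le> 1" "min 1 ((a (1, y) - 1) / \<epsilon>) = 1" using \<epsilon> by (auto simp: field_simps)
    then show "h 1 y = z" using gW[OF uS bu2] by (simp add: h_def u_def[symmetric])
  qed
  have hc': "continuous_map (prod_topology \<I> (closed_disc k)) X (\<lambda>(t, y). h t y)"
    by (rule continuous_map_eq[OF hc]) (auto simp: h_def)
  show ?thesis
    using pc hc' bd int by blast
qed

text \<open>Starting data for the cell that contains the point to contract to: slide along segments
  to \<open>y0\<close>, at a speed governed by a Urysohn function that vanishes on the boundary.
  Twice that function, capped at 1, gives full speed wherever the function is at least 1/2.\<close>

lemma disc_bump:
  assumes \<Phi>: "continuous_map (closed_disc k) X \<Phi>"
    and y0: "y0 \<in> topspace (open_disc k)" and W: "openin X W" "\<Phi> y0 \<in> W"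
  shows "\<exists>p h. continuous_map (closed_disc k) euclideanreal p \<and>
      continuous_map (prod_topology \<I> (closed_disc k)) X (\<lambda>(t, y). h t y) \<and> p y0 = 1 \<and>
      (\<forall>u\<in>boundary_sphere k. p u = 0 \<and> (\<forall>t\<in>{0..1}. h t u = \<Phi> u)) \<and>
      (\<forall>y\<in>cdisc k. 0 \<le> p y \<and> p y \<le> 1 \<and> h 0 y = \<Phi> y \<and>
         (1/2 \<le> p y \<longrightarrow> h 1 y = \<Phi> y0 \<and> (\<forall>t\<in>{0..1}. h t y \<in> W)))"
proof -
  let ?D = "closed_disc k"
  have y0D: "y0 \<in> cdisc k" "y0 \<notin> boundary_sphere k"
    using y0 by (auto simp: open_disc_conv)
  have ptop: "prod_topology \<I> (closed_disc k) = top_of_set ({0..1} \<times> cdisc k)"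
    by (simp add: closed_disc_eq)
  have seg: "continuous_map (prod_topology \<I> ?D) X (\<lambda>q. \<Phi> (\<lambda>i. snd q i + f q * (y0 i - snd q i)))"
    if "continuous_on ({0..1} \<times> cdisc k) f" "\<And>q. q \<in> {0..1} \<times> cdisc k \<Longrightarrow> 0 \<le> f q \<and> f q \<le> 1" for f
  proof -
    have "continuous_map (prod_topology \<I> ?D) ?D (\<lambda>q i. snd q i + f q * (y0 i - snd q i))"
      using that y0D unfolding ptop unfolding closed_disc_eq
      by (auto intro!: continuous_intros continuous_on_coordinatewise_then_product convex_cdisc)
    from continuous_map_compose[OF this \<Phi>] show ?thesis by (simp add: o_def)
  qed
  define T where "T = {q \<in> {0..1} \<times> cdisc k. \<Phi> (\<lambda>i. snd q i + fst q * (y0 i - snd q i)) \<in> W}"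
  have "continuous_map (prod_topology \<I> ?D) X (\<lambda>q. \<Phi> (\<lambda>i. snd q i + fst q * (y0 i - snd q i)))"
    by (rule seg) (auto intro!: continuous_intros)
  from openin_continuous_map_preimage[OF this W(1)]
  have Top: "openin (prod_topology \<I> ?D) T" by (simp add: T_def)
  have "{0..1} \<times> {y0} \<subseteq> T" using W y0D by (auto simp: T_def)
  moreover have "compactin \<I> {0..1}" "compactin ?D {y0}"
    using y0D by (auto simp: compactin_subtopology)
  \<comment> \<open>The time interval is compact, so Wallace's theorem gives a neighbourhood
    \<open>V\<close> of \<open>y0\<close> whose entire segments to \<open>y0\<close> are sent into
    \<open>W\<close>.\<close>
  ultimately obtain U V where
    UV: "openin ?D V" "{0..1} \<subseteq> U" "y0 \<in> V" "U \<times> V \<subseteq> T"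
    using Wallace_theorem_prod_topology[OF _ _ Top] by (metis insert_subset)
  have normal: "normal_space ?D"
    by (simp add: closed_disc_eq compact_Hausdorff_or_regular_imp_normal_space compact_cdisc
        compact_space_subtopology Hausdorff_space_subtopology)
  have cl1: "closedin ?D ((cdisc k - V) \<union> boundary_sphere k)"
  proof (rule closedin_Un)
    show "closedin ?D (cdisc k - V)" using UV(1) by (metis closedin_diff closedin_topspace topspace_closed_disc)
    show "closedin ?D (boundary_sphere k)"
      by (simp add: closed_disc_eq boundary_sphere_subset closed_subset compact_boundary_sphere compact_imp_closed)
  qed
  have cl2: "closedin ?D {y0}"
    using y0D by (simp add: closed_disc_eq closed_subset)
  have "disjnt ((cdisc k - V) \<union> boundary_sphere k) {y0}"
    using UV(3) y0D by (auto simp: disjnt_def)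
  from Urysohn_lemma[OF normal cl1 cl2 this, of 0 1] obtain \<beta> where
    \<beta>: "continuous_map ?D (top_of_set {0..1::real}) \<beta>" "\<beta> ` ((cdisc k - V) \<union> boundary_sphere k) \<subseteq> {0}"
      "\<beta> ` {y0} \<subseteq> {1}" by auto
  have \<beta>c: "continuous_on (cdisc k) \<beta>" and \<beta>01: "\<And>y. y \<in> cdisc k \<Longrightarrow> 0 \<le> \<beta> y \<and> \<beta> y \<le> 1"
    using \<beta>(1) by (auto simp: closed_disc_eq)
  define h where "h = (\<lambda>t y. \<Phi> (\<lambda>i. y i + (min 1 (2 * \<beta> y) * t) * (y0 i - y i)))"
  have hc: "continuous_map (prod_topology \<I> ?D) X (\<lambda>(t, y). h t y)"
    unfolding h_def case_prod_beta
    using \<beta>01 by (intro seg continuous_intros continuous_on_compose2[OF \<beta>c])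
      (auto simp: mult_le_one)
  have \<beta>V: "y \<in> V" if "1/2 \<le> \<beta> y" "y \<in> cdisc k" for y
    using \<beta>(2) that by force
  have "h t y \<in> W" if "1/2 \<le> \<beta> y" "y \<in> cdisc k" "t \<in> {0..1}" for t y
  proof -
    have "(t, y) \<in> T" using UV(2,4) \<beta>V[OF that(1,2)] that(3) by blast
    then show ?thesis using that(1) by (simp add: h_def T_def)
  qed
  moreover have "h 1 y = \<Phi> y0" if "1/2 \<le> \<beta> y" "y \<in> cdisc k" for y
    using that by (simp add: h_def)
  moreover have "continuous_map ?D euclideanreal \<beta>"
    using \<beta>(1) by (simp add: continuous_map_in_subtopology)
  moreover have "\<forall>u\<in>boundary_sphere k. \<beta> u = 0" using \<beta>(2) by auto
  moreover then have "\<forall>u\<in>boundary_sphere k. \<forall>t\<in>{0..1}. h t u = \<Phi> u" by (simp add: h_def)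
  moreover have "h 0 y = \<Phi> y" for y by (simp add: h_def)
  ultimately show ?thesis
    using hc \<beta>01 \<beta>(3) by (intro exI[of _ \<beta>] exI[of _ h]) auto
qed

section \<open>CW complexes\<close>

locale CW =
  fixes X :: "'a topology" and E d \<Phi>
  assumes CW: "CW_complex X E d \<Phi>"
begin

lemma Haus: "Hausdorff_space X"
  and part: "partition_on (topspace X) E"
  and char_cont: "e \<in> E \<Longrightarrow> continuous_map (closed_disc (d e)) X (\<Phi> e)"
  and char_homeo: "e \<in> E \<Longrightarrow> homeomorphic_map (open_disc (d e)) (subtopology X e) (\<Phi> e)"
  and closure_finite: "e \<in> E \<Longrightarrow> \<exists>F\<subseteq>E. finite F \<and> (\<forall>c\<in>F. d c < d e) \<and> \<Phi> e ` boundary_sphere (d e) \<subseteq> \<Union>F"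
  and weak: "A \<subseteq> topspace X \<Longrightarrow> closedin X A \<longleftrightarrow> (\<forall>e\<in>E. closedin X (A \<inter> X closure_of e))"
  using CW by (auto simp: CW_complex_def)

lemma cell_sub: "e \<in> E \<Longrightarrow> e \<subseteq> topspace X"
  using part by (auto simp: partition_on_def)

lemma char_open: "e \<in> E \<Longrightarrow> \<Phi> e ` (cdisc (d e) - boundary_sphere (d e)) = e"
  using homeomorphic_imp_surjective_map[OF char_homeo, of e] cell_sub[of e]
  by (simp add: open_disc_conv Int_absorb1)

lemma char_inj: "e \<in> E \<Longrightarrow> inj_on (\<Phi> e) (cdisc (d e) - boundary_sphere (d e))"
  using homeomorphic_imp_injective_map[OF char_homeo, of e] by (simp add: open_disc_conv)

lemma char_closed_map: "e \<in> E \<Longrightarrow> closed_map (closed_disc (d e)) X (\<Phi> e)"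
  by (intro continuous_imp_closed_map_gen char_cont Hausdorff_imp_kc_space Haus)
     (simp add: closed_disc_eq compact_space_subtopology compact_cdisc)

lemma char_sub: "e \<in> E \<Longrightarrow> \<Phi> e ` cdisc (d e) \<subseteq> topspace X"
  using continuous_map_image_subset_topspace[OF char_cont, of e] by simp

lemma char_image_closed: "e \<in> E \<Longrightarrow> closedin X (\<Phi> e ` cdisc (d e))"
  using char_closed_map[of e] by (metis closed_map_def closedin_topspace topspace_closed_disc)

text \<open>Characteristic maps are closed, and the closure of a cell lies in the image of its disc.
  Hence the weak topology, given through closures of cells, can be tested on the discs, which makes
  \<open>X\<close> a quotient of their disjoint sum.\<close>

lemma closedin_iff_char:
  assumes A: "A \<subseteq> topspace X"
  shows "closedin X A \<longleftrightarrow> (\<forall>e\<in>E. closedin (closed_disc (d e)) {y \<in> cdisc (d e). \<Phi> e y \<in> A})"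
proof
  assume "closedin X A"
  then show "\<forall>e\<in>E. closedin (closed_disc (d e)) {y \<in> cdisc (d e). \<Phi> e y \<in> A}"
    using closedin_continuous_map_preimage[OF char_cont] by fastforce
next
  assume R: "\<forall>e\<in>E. closedin (closed_disc (d e)) {y \<in> cdisc (d e). \<Phi> e y \<in> A}"
  show "closedin X A"
    unfolding weak[OF A]
  proof
    fix e assume e: "e \<in> E"
    have "closedin X (\<Phi> e ` {y \<in> cdisc (d e). \<Phi> e y \<in> A})"
      using R e char_closed_map[OF e] by (auto simp: closed_map_def)
    moreover have "\<Phi> e ` {y \<in> cdisc (d e). \<Phi> e y \<in> A} = A \<inter> \<Phi> e ` cdisc (d e)" by auto
    moreover have "X closure_of e \<subseteq> \<Phi> e ` cdisc (d e)"
      using char_open[OF e] by (intro closure_of_minimal char_image_closed e) auto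
    ultimately have "A \<inter> X closure_of e = \<Phi> e ` {y \<in> cdisc (d e). \<Phi> e y \<in> A} \<inter> X closure_of e"
      by auto
    then show "closedin X (A \<inter> X closure_of e)"
      using \<open>closedin X (\<Phi> e ` {y \<in> cdisc (d e). \<Phi> e y \<in> A})\<close> by (simp add: closedin_Int)
  qed
qed

text \<open>Discs are path connected, so a union of path components contains all or nothing of each
  closed cell. Such a set and its complement are therefore closed, and connectedness leaves a single
  component.\<close>

lemma path_connected:
  assumes "connected_space X"
  shows "path_connected_space X"
proof -
  have clo: "closedin X A" if A: "A \<subseteq> topspace X" and
    pc: "\<And>x y. path_component_of X x y \<Longrightarrow> x \<in> A \<Longrightarrow> y \<in> A" for A
    unfolding closedin_iff_char[OF A]
  proof
    fix e assume e: "e \<in> E"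
    have "path_connectedin X (\<Phi> e ` cdisc (d e))"
      using path_connectedin_continuous_map_image[OF char_cont[OF e] path_connected_closed_disc] .
    then have "path_component_of X (\<Phi> e y) (\<Phi> e y')" if "y \<in> cdisc (d e)" "y' \<in> cdisc (d e)" for y y'
      using that unfolding path_connectedin path_component_of_def by blast
    then have "{y \<in> cdisc (d e). \<Phi> e y \<in> A} = {} \<or> {y \<in> cdisc (d e). \<Phi> e y \<in> A} = cdisc (d e)"
      using pc by blast
    then show "closedin (closed_disc (d e)) {y \<in> cdisc (d e). \<Phi> e y \<in> A}"
      using closedin_topspace[of "closed_disc (d e)"]
      by (elim disjE) (simp_all only: closedin_empty topspace_closed_disc)
  qed
  have "path_component_of X x y" if "x \<in> topspace X" "y \<in> topspace X" for x y
  proof -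
    define A where "A = {w \<in> topspace X. path_component_of X x w}"
    have "closedin X A"
    proof (rule clo)
      show "w' \<in> A" if "path_component_of X w w'" "w \<in> A" for w w'
        using that path_component_of_trans[of X x w w'] path_component_in_topspace[of X w w']
        by (simp add: A_def)
    qed (simp add: A_def)
    moreover have "closedin X (topspace X - A)"
    proof (rule clo)
      show "w' \<in> topspace X - A" if "path_component_of X w w'" "w \<in> topspace X - A" for w w'
        using that path_component_of_trans[of X x w' w] path_component_in_topspace[of X w w']
          path_component_of_sym[of X w w'] unfolding A_def by blast
    qed simp
    then have "openin X A"
      by (metis A_def Collect_subset openin_closedin)
    moreover have "x \<in> A" using that by (simp add: A_def path_component_of_refl)
    ultimately have "A = topspace X"
      using assms by (auto simp: connected_space_clopen_in)
    then show ?thesis using that by (auto simp: A_def)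
  qed
  then show ?thesis by (simp add: path_connected_space_iff_path_component)
qed

lemma cell_of:
  assumes "x \<in> topspace X"
  shows "\<exists>!e. e \<in> E \<and> x \<in> e"
proof -
  have "topspace X = \<Union>E" using part by (simp add: partition_on_def)
  then obtain e where "e \<in> E" "x \<in> e" using assms by auto
  moreover have "e' = e" if "e' \<in> E" "x \<in> e'" for e'
    using partition_onD2[OF part] that \<open>e \<in> E\<close> \<open>x \<in> e\<close> by (meson disjointD disjoint_iff)
  ultimately show ?thesis by blast
qed

lemma cover: "topspace X = (\<Union>e\<in>E. \<Phi> e ` cdisc (d e))"
proof
  show "topspace X \<subseteq> (\<Union>e\<in>E. \<Phi> e ` cdisc (d e))"
  proof
    fix x assume "x \<in> topspace X"
    then obtain e where "e \<in> E" "x \<in> e" using cell_of by blast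
    then show "x \<in> (\<Union>e\<in>E. \<Phi> e ` cdisc (d e))" using char_open[of e] by blast
  qed
qed (use char_sub in blast)

lemma char_quotient:
  "quotient_map (sum_topology (\<lambda>e. closed_disc (d e)) E) X (\<lambda>(e, y). \<Phi> e y)"
  unfolding quotient_map_closedin
proof (intro conjI allI impI)
  show "(\<lambda>(e, y). \<Phi> e y) ` topspace (sum_topology (\<lambda>e. closed_disc (d e)) E) = topspace X"
    unfolding cover by auto
  fix A assume "A \<subseteq> topspace X"
  then show "closedin (sum_topology (\<lambda>e. closed_disc (d e)) E)
     {x \<in> topspace (sum_topology (\<lambda>e. closed_disc (d e)) E). (case x of (e, y) \<Rightarrow> \<Phi> e y) \<in> A} = closedin X A"
    by (auto simp: closedin_sum_topology closedin_iff_char)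
qed

end

section \<open>Homotopies on a CW complex, tested on its cells\<close>

lemma continuous_map_prod_sum_topology:
  assumes "\<And>i. i \<in> I \<Longrightarrow> continuous_map (prod_topology Z (T i)) Y (\<lambda>(s, x). f (s, (i, x)))"
  shows "continuous_map (prod_topology Z (sum_topology T I)) Y f"
proof (rule pasting_lemma)
  let ?U = "\<lambda>i. topspace Z \<times> ({i} \<times> topspace (T i))"
  show "openin (prod_topology Z (sum_topology T I)) (?U i)" if "i \<in> I" for i
  proof -
    have "openin (T j) {x. j = i \<and> x \<in> topspace (T i)}" for j
      by (cases "j = i") auto
    then show ?thesis using that by (auto simp: openin_prod_Times_iff openin_sum_topology)
  qed
  show "continuous_map (subtopology (prod_topology Z (sum_topology T I)) (?U i)) Y f" if i: "i \<in> I" for i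
  proof -
    have "continuous_map (subtopology (sum_topology T I) ({i} \<times> topspace (T i))) (T i) snd"
      unfolding continuous_map_def
    proof (intro conjI allI impI)
      fix U assume U: "openin (T i) U"
      have "openin (sum_topology T I) ({i} \<times> U)"
      proof -
        have "openin (T j) {x. j = i \<and> x \<in> U}" for j
          using U by (cases "j = i") auto
        then show ?thesis using i openin_subset[OF U] by (auto simp: openin_sum_topology)
      qed
      moreover have "{x \<in> topspace (subtopology (sum_topology T I) ({i} \<times> topspace (T i))). snd x \<in> U}
         = ({i} \<times> U) \<inter> ({i} \<times> topspace (T i))"
        using openin_subset[OF U] i by auto
      ultimately show "openin (subtopology (sum_topology T I) ({i} \<times> topspace (T i)))
          {x \<in> topspace (subtopology (sum_topology T I) ({i} \<times> topspace (T i))). snd x \<in> U}"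
        unfolding openin_subtopology by blast
    qed auto
    then have "continuous_map (subtopology (prod_topology Z (sum_topology T I)) (?U i)) (prod_topology Z (T i))
       (\<lambda>p. (fst p, snd (snd p)))"
      unfolding subtopology_Times subtopology_topspace
      by (intro continuous_map_pairedI continuous_map_fst continuous_map_compose[OF continuous_map_snd, unfolded o_def])
    from continuous_map_compose[OF this assms[OF i]]
    have "continuous_map (subtopology (prod_topology Z (sum_topology T I)) (?U i)) Y (\<lambda>p. f (fst p, (i, snd (snd p))))"
      by (simp add: o_def)
    then show ?thesis by (rule continuous_map_eq) auto
  qed
  show "\<exists>j. j \<in> I \<and> x \<in> ?U j \<and> f x = f x" if "x \<in> topspace (prod_topology Z (sum_topology T I))" for x
    using that by auto
qed auto

context CW
begin

text \<open>The interval is locally compact Hausdorff, so its product with the quotient map from the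
  sum of the discs is again a quotient map. Joint continuity in time and space is thus a matter of
  single cells.\<close>

lemma continuous_homotopy:
  assumes "\<And>e. e \<in> E \<Longrightarrow> continuous_map (prod_topology \<I> (closed_disc (d e))) Y (\<lambda>(t, y). g t (\<Phi> e y))"
  shows "continuous_map (prod_topology \<I> X) Y (\<lambda>(t, x). g t x)"
proof -
  have "quotient_map (prod_topology \<I> (sum_topology (\<lambda>e. closed_disc (d e)) E)) (prod_topology \<I> X)
     (\<lambda>(t, q). (t, (\<lambda>(e, y). \<Phi> e y) q))"
    by (rule quotient_map_prod_right[OF _ _ char_quotient])
       (auto simp: Hausdorff_space_subtopology compact_imp_locally_compact_space compact_space_subtopology)
  moreover have "continuous_map (prod_topology \<I> (sum_topology (\<lambda>e. closed_disc (d e)) E)) Y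
     ((\<lambda>(t, x). g t x) \<circ> (\<lambda>(t, q). (t, (\<lambda>(e, y). \<Phi> e y) q)))"
    using assms by (intro continuous_map_prod_sum_topology) (simp add: case_prod_unfold)
  ultimately show ?thesis by (rule continuous_compose_quotient_map)
qed

text \<open>By closure finiteness the boundary of a cell is mapped into finitely many closed cells
  of lower dimension, and finitely many closed pieces can be pasted. An induction on dimension
  thereby gets continuous boundary data from the cells already treated.\<close>

lemma continuous_homotopy_boundary:
  assumes e: "e \<in> E"
    and g: "\<And>c. c \<in> E \<Longrightarrow> d c < d e \<Longrightarrow>
      continuous_map (prod_topology \<I> (closed_disc (d c))) Y (\<lambda>(t, y). g t (\<Phi> c y))"
  shows "continuous_map (prod_topology \<I> (top_of_set (boundary_sphere (d e)))) Y (\<lambda>(t, u). g t (\<Phi> e u))"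
proof -
  obtain F where F: "F \<subseteq> E" "finite F" "\<And>c. c \<in> F \<Longrightarrow> d c < d e" "\<Phi> e ` boundary_sphere (d e) \<subseteq> \<Union>F"
    using closure_finite[OF e] by blast
  let ?C = "\<lambda>c. \<Phi> c ` cdisc (d c)"
  define S where "S = (\<Union>c\<in>F. ?C c)"
  have "continuous_map (prod_topology \<I> (subtopology X S)) Y (\<lambda>(t, x). g t x)"
  proof (rule pasting_lemma_closed[OF F(2)])
    fix c assume c: "c \<in> F"
    then have cE: "c \<in> E" using F by auto
    show "closedin (prod_topology \<I> (subtopology X S)) ({0..1} \<times> ?C c)"
      using char_image_closed[OF cE] c
      by (auto simp: closedin_prod_Times_iff S_def intro!: closedin_subset_topspace)
    have "quotient_map (closed_disc (d c)) (subtopology X (?C c)) (\<Phi> c)"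
    proof (rule continuous_closed_imp_quotient_map)
      show "continuous_map (closed_disc (d c)) (subtopology X (?C c)) (\<Phi> c)"
        using char_cont[OF cE] by (simp add: continuous_map_in_subtopology)
      show "closed_map (closed_disc (d c)) (subtopology X (?C c)) (\<Phi> c)"
        using char_closed_map[OF cE] by (intro closed_map_into_subtopology) auto
    qed (use char_sub[OF cE] in auto)
    then have "quotient_map (prod_topology \<I> (closed_disc (d c))) (prod_topology \<I> (subtopology X (?C c)))
       (\<lambda>(t, y). (t, \<Phi> c y))"
      by (intro quotient_map_prod_right)
       (auto simp: Hausdorff_space_subtopology compact_imp_locally_compact_space compact_space_subtopology)
    then have "continuous_map (prod_topology \<I> (subtopology X (?C c))) Y (\<lambda>(t, x). g t x)"
      by (rule continuous_compose_quotient_map) (use g[OF cE F(3)[OF c]] in \<open>simp add: o_def case_prod_unfold\<close>)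
    moreover have "subtopology (prod_topology \<I> (subtopology X S)) ({0..1} \<times> ?C c) = prod_topology \<I> (subtopology X (?C c))"
    proof -
      have "S \<inter> ?C c = ?C c" using c by (auto simp: S_def)
      then show ?thesis by (simp add: subtopology_Times subtopology_subtopology)
    qed
    ultimately show "continuous_map (subtopology (prod_topology \<I> (subtopology X S)) ({0..1} \<times> ?C c)) Y (\<lambda>(t, x). g t x)"
      by simp
  qed (auto simp: S_def)
  moreover have "continuous_map (prod_topology \<I> (top_of_set (boundary_sphere (d e)))) (prod_topology \<I> (subtopology X S))
     (\<lambda>(t, u). (t, \<Phi> e u))"
  proof -
    have "c \<subseteq> ?C c" if "c \<in> F" for c
      using char_open[of c] that F(1) by (metis Diff_subset image_mono subsetD)
    then have "\<Union>F \<subseteq> S" unfolding S_def by fast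
    then have "\<Phi> e ` boundary_sphere (d e) \<subseteq> S" using F(4) by (rule subset_trans[rotated])
    moreover have "continuous_map (top_of_set (boundary_sphere (d e))) X (\<Phi> e)"
      using continuous_map_from_subtopology[OF char_cont[OF e], of "boundary_sphere (d e)"]
      by (simp add: closed_disc_eq subtopology_subtopology boundary_sphere_subset Int_absorb1)
    ultimately have "continuous_map (top_of_set (boundary_sphere (d e))) (subtopology X S) (\<Phi> e)"
      by (simp add: continuous_map_in_subtopology image_subset_iff_funcset)
    from continuous_map_compose[OF continuous_map_snd[of \<I>] this]
    show ?thesis
      by (auto simp: case_prod_unfold continuous_map_paired o_def continuous_on_fst)
  qed
  ultimately have "continuous_map (prod_topology \<I> (top_of_set (boundary_sphere (d e)))) Y
     ((\<lambda>(t, x). g t x) \<circ> (\<lambda>(t, u). (t, \<Phi> e u)))"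
    by (rule continuous_map_compose[rotated])
  then show ?thesis by (simp add: o_def case_prod_unfold)
qed

end

text \<open>The homotopy \<open>h\<close> is defined on all of \<open>X\<close>, so that it acts on measures; it need only contract
  within \<open>W\<close> where \<open>\<phi>\<close> is positive.\<close>

definition locally_contractible_at :: "'a topology \<Rightarrow> 'a \<Rightarrow> bool" where
  "locally_contractible_at X z \<longleftrightarrow> (\<forall>W. openin X W \<and> z \<in> W \<longrightarrow>
     (\<exists>\<phi> h. continuous_map X euclideanreal \<phi> \<and> continuous_map (prod_topology \<I> X) X (\<lambda>(t, x). h t x) \<and>
       \<phi> z = 1 \<and> (\<forall>x\<in>topspace X. 0 \<le> \<phi> x \<and> \<phi> x \<le> 1 \<and> h 0 x = x \<and>
         (0 < \<phi> x \<longrightarrow> h 1 x = z \<and> (\<forall>t\<in>{0..1}. h t x \<in> W)))))"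

section \<open>Local contractibility of CW complexes\<close>

context CW
begin

definition cell :: "'a \<Rightarrow> 'a set" where
  "cell x = (THE e. e \<in> E \<and> x \<in> e)"

lemma cell_eq: "e \<in> E \<Longrightarrow> x \<in> e \<Longrightarrow> cell x = e"
  unfolding cell_def using cell_of[of x] cell_sub[of e] by (intro the1_equality) auto

lemma char_cell:
  assumes "e \<in> E" "y \<in> cdisc (d e)"
  shows "y \<in> boundary_sphere (d e) \<Longrightarrow> cell (\<Phi> e y) \<in> E \<and> d (cell (\<Phi> e y)) < d e \<and> \<Phi> e y \<in> cell (\<Phi> e y)"
    and "y \<notin> boundary_sphere (d e) \<Longrightarrow> cell (\<Phi> e y) = e \<and> \<Phi> e y \<in> e"
proof -
  assume "y \<in> boundary_sphere (d e)"
  then obtain c where "c \<in> E" "d c < d e" "\<Phi> e y \<in> c"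
    using closure_finite[OF assms(1)] by blast
  then show "cell (\<Phi> e y) \<in> E \<and> d (cell (\<Phi> e y)) < d e \<and> \<Phi> e y \<in> cell (\<Phi> e y)"
    using cell_eq by auto
next
  assume "y \<notin> boundary_sphere (d e)"
  then have "\<Phi> e y \<in> e" using char_open[OF assms(1)] assms(2) by auto
  then show "cell (\<Phi> e y) = e \<and> \<Phi> e y \<in> e" using cell_eq assms(1) by auto
qed

text \<open>The pair of a bump function and a homotopy is chosen cell by cell; \<open>f\<close> collects the choices.
  The threshold \<open>1/2\<close> leaves room for the bump to decrease on the collar of a cell.\<close>

definition bump :: "('a set \<Rightarrow> ('a \<Rightarrow> real) \<times> (real \<Rightarrow> 'a \<Rightarrow> 'a)) \<Rightarrow> 'a \<Rightarrow> real" where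
  "bump f x = fst (f (cell x)) x"

definition flow :: "('a set \<Rightarrow> ('a \<Rightarrow> real) \<times> (real \<Rightarrow> 'a \<Rightarrow> 'a)) \<Rightarrow> real \<Rightarrow> 'a \<Rightarrow> 'a" where
  "flow f t x = snd (f (cell x)) t x"

text \<open>Continuity is demanded on the closed disc and so involves the values chosen on lower
  cells. The last clause makes the data trivial on all other cells up to the dimension of the cell
  of \<open>z\<close>; these are the boundary values that \<open>disc_bump\<close> provides.\<close>

definition good_cell where
  "good_cell z W e0 f e \<longleftrightarrow>
     continuous_map (closed_disc (d e)) euclideanreal (\<lambda>y. bump f (\<Phi> e y)) \<and>
     continuous_map (prod_topology \<I> (closed_disc (d e))) X (\<lambda>(t, y). flow f t (\<Phi> e y)) \<and>
     (\<forall>x\<in>e. 0 \<le> bump f x \<and> bump f x \<le> 1 \<and> flow f 0 x = x \<and>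
        (1/2 \<le> bump f x \<longrightarrow> flow f 1 x = z \<and> (\<forall>t\<in>{0..1}. flow f t x \<in> W))) \<and>
     (z \<in> e \<longrightarrow> bump f z = 1) \<and>
     (d e \<le> d e0 \<and> z \<notin> e \<longrightarrow> (\<forall>x\<in>e. bump f x = 0 \<and> (\<forall>t\<in>{0..1}. flow f t x = x)))"

text \<open>A closed cell meets only its own open cell and cells of smaller dimension, so choices
  made elsewhere do not matter. A recursion on dimension requires this locality.\<close>

lemma good_cell_cong:
  assumes e: "e \<in> E" and fg: "\<And>c. d c < d e \<or> c = e \<Longrightarrow> f c = g c"
    and "good_cell z W e0 f e"
  shows "good_cell z W e0 g e"
proof -
  have 1: "bump f x = bump g x \<and> flow f t x = flow g t x" if "x \<in> e" for x t
    using cell_eq[OF e that] fg[of e] by (simp add: bump_def flow_def)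
  have 2: "bump f (\<Phi> e y) = bump g (\<Phi> e y) \<and> flow f t (\<Phi> e y) = flow g t (\<Phi> e y)" if y: "y \<in> cdisc (d e)" for y t
  proof -
    have "f (cell (\<Phi> e y)) = g (cell (\<Phi> e y))"
      using char_cell[OF e y] by (intro fg) blast
    then show ?thesis by (simp add: bump_def flow_def)
  qed
  have "continuous_map (closed_disc (d e)) euclideanreal (\<lambda>y. bump g (\<Phi> e y))"
    by (rule continuous_map_eq[of _ _ "\<lambda>y. bump f (\<Phi> e y)"]) (use assms(3) in \<open>auto simp: good_cell_def 2\<close>)
  moreover have "continuous_map (prod_topology \<I> (closed_disc (d e))) X (\<lambda>(t, y). flow g t (\<Phi> e y))"
    by (rule continuous_map_eq[of _ _ "\<lambda>(t, y). flow f t (\<Phi> e y)"]) (use assms(3) in \<open>auto simp: good_cell_def 2\<close>)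
  ultimately show ?thesis
    using assms(3) by (simp add: good_cell_def 1)
qed

text \<open>Data on the disc are carried to the open cell by inverting the characteristic map there.
  Boundary points belong to other cells, whose entries the update at \<open>e\<close> leaves alone,
  and \<open>bd\<close> makes both descriptions agree on them.\<close>

lemma good_cell_glue:
  assumes e: "e \<in> E"
    and p: "continuous_map (closed_disc (d e)) euclideanreal p"
    and k: "continuous_map (prod_topology \<I> (closed_disc (d e))) X (\<lambda>(t, y). k t y)"
    and bd: "\<And>u. u \<in> boundary_sphere (d e) \<Longrightarrow> p u = bump f (\<Phi> e u) \<and> (\<forall>t\<in>{0..1}. k t u = flow f t (\<Phi> e u))"
    and int: "\<And>y. y \<in> cdisc (d e) - boundary_sphere (d e) \<Longrightarrow> 0 \<le> p y \<and> p y \<le> 1 \<and> k 0 y = \<Phi> e y \<and>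
        (1/2 \<le> p y \<longrightarrow> k 1 y = z \<and> (\<forall>t\<in>{0..1}. k t y \<in> W)) \<and> (\<Phi> e y = z \<longrightarrow> p y = 1) \<and>
        (d e \<le> d e0 \<and> z \<notin> e \<longrightarrow> p y = 0 \<and> (\<forall>t\<in>{0..1}. k t y = \<Phi> e y))"
  shows "\<exists>r. good_cell z W e0 (f(e := r)) e"
proof -
  let ?O = "cdisc (d e) - boundary_sphere (d e)"
  define v where "v = inv_into ?O (\<Phi> e)"
  define r where "r = ((\<lambda>x. p (v x)), (\<lambda>t x. k t (v x)))"
  let ?f = "f(e := r)"
  have v: "v (\<Phi> e y) = y" if "y \<in> ?O" for y
    unfolding v_def using char_inj[OF e] that by (rule inv_into_f_f)
  have int_eq: "bump ?f (\<Phi> e y) = p y \<and> flow ?f t (\<Phi> e y) = k t y" if y: "y \<in> ?O" for t y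
    using char_cell(2)[OF e, of y] y v[OF y] by (auto simp: bump_def flow_def r_def)
  have eq: "bump ?f (\<Phi> e y) = p y \<and> (\<forall>t\<in>{0..1}. flow ?f t (\<Phi> e y) = k t y)" if y: "y \<in> cdisc (d e)" for y
  proof (cases "y \<in> boundary_sphere (d e)")
    case True
    then have "cell (\<Phi> e y) \<noteq> e" using char_cell(1)[OF e y] by auto
    then show ?thesis using bd[OF True] by (simp add: bump_def flow_def)
  next
    case False
    then show ?thesis using int_eq y by simp
  qed
  have "continuous_map (closed_disc (d e)) euclideanreal (\<lambda>y. bump ?f (\<Phi> e y))"
    by (rule continuous_map_eq[OF p]) (use eq in auto)
  moreover have "continuous_map (prod_topology \<I> (closed_disc (d e))) X (\<lambda>(t, y). flow ?f t (\<Phi> e y))"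
    by (rule continuous_map_eq[OF k]) (use eq in auto)
  moreover have "0 \<le> bump ?f x \<and> bump ?f x \<le> 1 \<and> flow ?f 0 x = x \<and>
      (1/2 \<le> bump ?f x \<longrightarrow> flow ?f 1 x = z \<and> (\<forall>t\<in>{0..1}. flow ?f t x \<in> W)) \<and>
      (x = z \<longrightarrow> bump ?f x = 1) \<and>
      (d e \<le> d e0 \<and> z \<notin> e \<longrightarrow> bump ?f x = 0 \<and> (\<forall>t\<in>{0..1}. flow ?f t x = x))" if x: "x \<in> e" for x
  proof -
    obtain y where y: "y \<in> ?O" "x = \<Phi> e y" using char_open[OF e] x by (metis imageE)
    show ?thesis
      unfolding y(2) conjunct1[OF int_eq[OF y(1)]] conjunct2[OF int_eq[OF y(1)]]
      by (rule int[OF y(1)])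
  qed
  ultimately have "good_cell z W e0 ?f e"
    unfolding good_cell_def by simp
  then show ?thesis ..
qed

text \<open>Three kinds of cells: on the cell of \<open>z\<close> the bump is created, the other
  cells up to its dimension stay fixed, and higher cells inherit bump and flow from their boundary
  by \<open>disc_extend\<close>.\<close>

lemma good_cell_extend:
  assumes e: "e \<in> E" and e0: "e0 \<in> E" "z \<in> e0" and W: "openin X W" "z \<in> W"
    and f: "\<And>c. c \<in> E \<Longrightarrow> d c < d e \<Longrightarrow> good_cell z W e0 f c"
  shows "\<exists>r. good_cell z W e0 (f(e := r)) e"
proof -
  let ?D = "closed_disc (d e)" and ?S = "boundary_sphere (d e)"
  have low: "good_cell z W e0 f (cell (\<Phi> e u)) \<and> \<Phi> e u \<in> cell (\<Phi> e u) \<and>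
      cell (\<Phi> e u) \<in> E \<and> d (cell (\<Phi> e u)) < d e" if "u \<in> ?S" for u
    using char_cell(1)[OF e _ that] boundary_sphere_subset[of "d e"] that f by auto
  have ze: "z \<in> c \<longleftrightarrow> c = e0" if "c \<in> E" for c
    using cell_eq[OF that, of z] cell_eq[OF e0] e0 by auto
  show ?thesis
  proof (cases "d e \<le> d e0")
    case True
    have low_triv: "bump f (\<Phi> e u) = 0 \<and> (\<forall>t\<in>{0..1}. flow f t (\<Phi> e u) = \<Phi> e u)" if u: "u \<in> ?S" for u
    proof -
      have "z \<notin> cell (\<Phi> e u)" using low[OF u] ze True by fastforce
      then show ?thesis using low[OF u] True unfolding good_cell_def by auto
    qed
    show ?thesis
    proof (cases "e = e0")
      case True
      obtain y0 where y0: "y0 \<in> cdisc (d e) - ?S" "\<Phi> e y0 = z"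
        using char_open[OF e] e0 True by (metis imageE)
      have "y0 \<in> topspace (open_disc (d e))" using y0 by (simp add: open_disc_conv)
      from disc_bump[OF char_cont[OF e] this W(1)] y0 W(2) obtain p k where
        pk: "continuous_map ?D euclideanreal p" "continuous_map (prod_topology \<I> ?D) X (\<lambda>(t, y). k t y)"
        "p y0 = 1" "\<forall>u\<in>?S. p u = 0 \<and> (\<forall>t\<in>{0..1}. k t u = \<Phi> e u)"
        "\<forall>y\<in>cdisc (d e). 0 \<le> p y \<and> p y \<le> 1 \<and> k 0 y = \<Phi> e y \<and>
         (1/2 \<le> p y \<longrightarrow> k 1 y = z \<and> (\<forall>t\<in>{0..1}. k t y \<in> W))"
        by auto
      have "p y = 1" if "y \<in> cdisc (d e) - ?S" "\<Phi> e y = z" for y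
        using char_inj[OF e] y0 that pk(3) by (metis inj_onD)
      then show ?thesis
        using pk low_triv True e0 by (intro good_cell_glue[OF e pk(1,2)]) auto
    next
      case False
      have zne: "z \<notin> e" using ze e False by blast
      have "\<Phi> e y \<noteq> z" if "y \<in> cdisc (d e) - ?S" for y
        using char_open[OF e] zne that by blast
      moreover have "continuous_map (prod_topology \<I> ?D) X (\<lambda>(t, y). \<Phi> e y)"
        using continuous_map_compose[OF continuous_map_snd char_cont[OF e]]
        by (simp add: o_def case_prod_unfold)
      ultimately show ?thesis
        using low_triv by (intro good_cell_glue[OF e, of "\<lambda>y. 0" "\<lambda>t. \<Phi> e"]) auto
    qed
  next
    case False
    have zne: "z \<notin> e" using ze e False by auto
    have nz: "\<Phi> e y \<noteq> z" if "y \<in> cdisc (d e) - ?S" for y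
      using char_open[OF e] zne that by blast
    \<comment> \<open>The bump is regarded as a homotopy that is constant in time, so that the
      boundary lemma yields its continuity as well; evaluation at time 0 recovers it.\<close>
    have b: "continuous_map (prod_topology \<I> (top_of_set ?S)) euclideanreal (\<lambda>(t, u). bump f (\<Phi> e u))"
    proof (rule continuous_homotopy_boundary[OF e, of _ "\<lambda>t. bump f"])
      fix c assume "c \<in> E" "d c < d e"
      then have "continuous_map (closed_disc (d c)) euclideanreal (\<lambda>y. bump f (\<Phi> c y))"
        using f by (auto simp: good_cell_def)
      from continuous_map_compose[OF continuous_map_snd this]
      show "continuous_map (prod_topology \<I> (closed_disc (d c))) euclideanreal (\<lambda>(t, y). bump f (\<Phi> c y))"
        by (simp add: o_def case_prod_unfold)
    qed
    have "continuous_map (top_of_set ?S) (prod_topology \<I> (top_of_set ?S)) (\<lambda>u. (0, u))"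
      by (auto intro!: continuous_intros)
    from continuous_map_compose[OF this b]
    have b': "continuous_map (top_of_set ?S) euclideanreal (\<lambda>u. bump f (\<Phi> e u))"
      by (simp add: o_def)
    have g: "continuous_map (prod_topology \<I> (top_of_set ?S)) X (\<lambda>(t, u). flow f t (\<Phi> e u))"
      by (rule continuous_homotopy_boundary[OF e]) (use f in \<open>auto simp: good_cell_def\<close>)
    have "\<exists>p h. continuous_map ?D euclideanreal p \<and>
      continuous_map (prod_topology \<I> ?D) X (\<lambda>(t, y). h t y) \<and>
      (\<forall>u\<in>?S. p u = bump f (\<Phi> e u) \<and> (\<forall>t\<in>{0..1}. h t u = flow f t (\<Phi> e u))) \<and>
      (\<forall>y\<in>cdisc (d e). 0 \<le> p y \<and> p y \<le> 1 \<and> h 0 y = \<Phi> e y \<and>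
         (1/2 \<le> p y \<longrightarrow> h 1 y = z \<and> (\<forall>t\<in>{0..1}. h t y \<in> W)))"
    proof (rule disc_extend[OF char_cont[OF e] b' _ g _ W(1)])
      fix u assume u: "u \<in> ?S"
      show "0 \<le> bump f (\<Phi> e u) \<and> bump f (\<Phi> e u) \<le> 1"
        and "flow f 0 (\<Phi> e u) = \<Phi> e u"
        using low[OF u] unfolding good_cell_def by auto
      show "flow f 1 (\<Phi> e u) = z \<and> (\<forall>t\<in>{0..1}. flow f t (\<Phi> e u) \<in> W)" if "1/2 \<le> bump f (\<Phi> e u)"
        using low[OF u] that unfolding good_cell_def by auto
    qed
    then obtain p k where pk: "continuous_map ?D euclideanreal p"
      "continuous_map (prod_topology \<I> ?D) X (\<lambda>(t, y). k t y)"
      "\<forall>u\<in>?S. p u = bump f (\<Phi> e u) \<and> (\<forall>t\<in>{0..1}. k t u = flow f t (\<Phi> e u))"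
      "\<forall>y\<in>cdisc (d e). 0 \<le> p y \<and> p y \<le> 1 \<and> k 0 y = \<Phi> e y \<and>
         (1/2 \<le> p y \<longrightarrow> k 1 y = z \<and> (\<forall>t\<in>{0..1}. k t y \<in> W))" by blast
    then show ?thesis
      using False nz by (intro good_cell_glue[OF e pk(1,2)]) auto
  qed
qed

lemma locally_contractible:
  assumes "z \<in> topspace X"
  shows "locally_contractible_at X z"
  unfolding locally_contractible_at_def
proof (intro allI impI)
  fix W assume W: "openin X W \<and> z \<in> W"
  obtain e0 where e0: "e0 \<in> E" "z \<in> e0" using cell_of[OF assms] by blast
  \<comment> \<open>The choice at a cell depends on the choices at cells of lower dimension;
    dependent choice along the well-founded order given by \<open>d\<close> makes all of them
    coherently.\<close>
  have "\<exists>f. \<forall>e. e \<in> E \<longrightarrow> good_cell z W e0 (f(e := f e)) e"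
  proof (rule dependent_wf_choice[OF wf_measure[of d], of "\<lambda>f e r. e \<in> E \<longrightarrow> good_cell z W e0 (f(e := r)) e"])
    fix f g :: "'a set \<Rightarrow> ('a \<Rightarrow> real) \<times> (real \<Rightarrow> 'a \<Rightarrow> 'a)" and e r
    assume fg: "\<And>c. (c, e) \<in> Wellfounded.measure d \<Longrightarrow> f c = g c"
    show "(e \<in> E \<longrightarrow> good_cell z W e0 (f(e := r)) e) = (e \<in> E \<longrightarrow> good_cell z W e0 (g(e := r)) e)"
    proof -
      have eq: "(f(e := r)) c = (g(e := r)) c" if "d c < d e \<or> c = e" for c
        using fg[of c] that by auto
      have "good_cell z W e0 (g(e := r)) e" if "e \<in> E" "good_cell z W e0 (f(e := r)) e"
        by (rule good_cell_cong[OF that(1) eq that(2)])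
      moreover have "good_cell z W e0 (f(e := r)) e" if "e \<in> E" "good_cell z W e0 (g(e := r)) e"
        by (rule good_cell_cong[OF that(1) eq[symmetric] that(2)])
      ultimately show ?thesis by blast
    qed
  next
    fix e and f :: "'a set \<Rightarrow> ('a \<Rightarrow> real) \<times> (real \<Rightarrow> 'a \<Rightarrow> 'a)"
    assume "\<And>c. (c, e) \<in> Wellfounded.measure d \<Longrightarrow> c \<in> E \<longrightarrow> good_cell z W e0 (f(c := f c)) c"
    then show "\<exists>r. e \<in> E \<longrightarrow> good_cell z W e0 (f(e := r)) e"
      using good_cell_extend[OF _ e0, of e W f] W by auto
  qed
  then obtain f where f: "\<And>e. e \<in> E \<Longrightarrow> good_cell z W e0 f e" by auto
  have pt: "0 \<le> bump f x \<and> bump f x \<le> 1 \<and> flow f 0 x = x \<and>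
        (1/2 \<le> bump f x \<longrightarrow> flow f 1 x = z \<and> (\<forall>t\<in>{0..1}. flow f t x \<in> W))" if x: "x \<in> topspace X" for x
  proof -
    obtain e where e: "e \<in> E" "x \<in> e" using cell_of[OF x] by blast
    have "\<forall>x\<in>e. 0 \<le> bump f x \<and> bump f x \<le> 1 \<and> flow f 0 x = x \<and>
        (1/2 \<le> bump f x \<longrightarrow> flow f 1 x = z \<and> (\<forall>t\<in>{0..1}. flow f t x \<in> W))"
      using f[OF e(1)] unfolding good_cell_def by (elim conjE)
    then show ?thesis using e(2) by (rule bspec)
  qed
  have hc: "continuous_map (prod_topology \<I> X) X (\<lambda>(t, x). flow f t x)"
    by (rule continuous_homotopy) (use f in \<open>auto simp: good_cell_def\<close>)
  have "continuous_map (sum_topology (\<lambda>e. closed_disc (d e)) E) euclideanreal (bump f \<circ> (\<lambda>(e, y). \<Phi> e y))"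
    unfolding continuous_map_def
  proof (intro conjI allI impI)
    fix U :: "real set" assume U: "openin euclidean U"
    have "openin (closed_disc (d e)) {y \<in> topspace (closed_disc (d e)). bump f (\<Phi> e y) \<in> U}" if "e \<in> E" for e
    proof -
      have "continuous_map (closed_disc (d e)) euclideanreal (\<lambda>y. bump f (\<Phi> e y))"
        using f[OF that] unfolding good_cell_def by (elim conjE)
      then show ?thesis using U by (rule openin_continuous_map_preimage)
    qed
    then show "openin (sum_topology (\<lambda>e. closed_disc (d e)) E)
      {x \<in> topspace (sum_topology (\<lambda>e. closed_disc (d e)) E). (bump f \<circ> (\<lambda>(e, y). \<Phi> e y)) x \<in> U}"
      by (auto simp: openin_sum_topology)
  qed auto
  then have bc: "continuous_map X euclideanreal (bump f)"
    by (rule continuous_compose_quotient_map[OF char_quotient])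
  have bz: "bump f z = 1" using f[OF e0(1)] e0(2) by (simp add: good_cell_def)
  show "\<exists>\<phi> h. continuous_map X euclideanreal \<phi> \<and> continuous_map (prod_topology \<I> X) X (\<lambda>(t, x). h t x) \<and>
       \<phi> z = 1 \<and> (\<forall>x\<in>topspace X. 0 \<le> \<phi> x \<and> \<phi> x \<le> 1 \<and> h 0 x = x \<and>
         (0 < \<phi> x \<longrightarrow> h 1 x = z \<and> (\<forall>t\<in>{0..1}. h t x \<in> W)))"
  proof (intro exI conjI ballI impI)
    \<comment> \<open>Rescaling turns the threshold 1/2 of the bump into positivity and keeps the
      value 1 at \<open>z\<close>.\<close>
    show "continuous_map X euclideanreal (\<lambda>x. max 0 (2 * bump f x - 1))"
      by (intro continuous_intros bc)
    show "continuous_map (prod_topology \<I> X) X (\<lambda>(t, x). flow f t x)" by (rule hc)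
  qed (use pt bz in auto)
qed

end

section \<open>Continuity in spaces of measures\<close>

definition intg :: "('a \<Rightarrow> real) \<Rightarrow> ('a \<Rightarrow> real) \<Rightarrow> real" where
  "intg \<phi> \<mu> = (\<Sum>x | \<mu> x \<noteq> 0. \<mu> x * \<phi> x)"

text \<open>The normalised push-forward under \<open>g\<close> of the measure with density \<open>\<psi>\<close> against \<open>\<mu>\<close>.\<close>

definition push :: "('a \<Rightarrow> real) \<Rightarrow> ('a \<Rightarrow> 'a) \<Rightarrow> ('a \<Rightarrow> real) \<Rightarrow> 'a \<Rightarrow> real" where
  "push \<psi> g \<mu> x = intg (\<lambda>y. if g y = x then \<psi> y else 0) \<mu> / intg \<psi> \<mu>"

definition dirac :: "'a \<Rightarrow> 'a \<Rightarrow> real" where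
  "dirac a x = (if x = a then 1 else 0)"

text \<open>Grouping indices by their point shows that the integral does not see how a measure is
  split into a tuple. Integrals of continuous functions thus become finite sums of continuous terms
  on \<open>weighted_tuples n X\<close>.\<close>

lemma intg_barycenter_map:
  "intg \<phi> (barycenter_map n (z, t)) = (\<Sum>i<n. t i * \<phi> (z i))"
proof -
  let ?\<mu> = "barycenter_map n (z, t)"
  have mu: "?\<mu> x = (\<Sum>i | i < n \<and> z i = x. t i)" for x by (simp add: barycenter_map_def)
  have "?\<mu> x = 0" if "x \<notin> z ` {..<n}" for x
    unfolding mu using that by (intro sum.neutral) auto
  then have "{x. ?\<mu> x \<noteq> 0} \<subseteq> z ` {..<n}" by blast
  then have "intg \<phi> ?\<mu> = (\<Sum>x\<in>z ` {..<n}. ?\<mu> x * \<phi> x)"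
    unfolding intg_def by (intro sum.mono_neutral_left) auto
  also have "\<dots> = (\<Sum>x\<in>z ` {..<n}. \<Sum>i | i \<in> {..<n} \<and> z i = x. t i * \<phi> (z i))"
    by (simp add: mu sum_distrib_right)
  also have "\<dots> = (\<Sum>i<n. t i * \<phi> (z i))" by (intro sum.group) auto
  finally show ?thesis .
qed

locale barycenters =
  fixes n :: nat and X :: "'a topology"
  assumes n1: "1 \<le> n"
begin

abbreviation Y where "Y \<equiv> barycenter_space n X"

lemma topspace_Y: "topspace Y = finite_prob_measures n (topspace X)"
  using quotient_imp_surjective_map[OF quotient_map_barycenter_map[OF n1]] barycenter_map_image[OF n1]
  by metis

lemma Y_D:
  assumes "\<mu> \<in> topspace Y"
  shows "0 \<le> \<mu> x" "finite {x. \<mu> x \<noteq> 0}" "\<mu> x \<noteq> 0 \<Longrightarrow> x \<in> topspace X"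
    "card {x. \<mu> x \<noteq> 0} \<le> n" "(\<Sum>x | \<mu> x \<noteq> 0. \<mu> x) = 1"
  using assms by (auto simp: topspace_Y finite_prob_measures_def)

lemma Y_nonzero: "\<mu> \<in> topspace Y \<Longrightarrow> \<exists>x\<in>topspace X. \<mu> x \<noteq> 0"
  using Y_D[of \<mu>] by (metis (mono_tags, lifting) sum.neutral mem_Collect_eq zero_neq_one)

lemma continuous_map_weight: "continuous_map (weighted_tuples n X) euclideanreal (\<lambda>p. snd p i)"
proof -
  have "continuous_map (weighted_tuples n X) (powertop_real UNIV) snd"
    unfolding weighted_tuples_def
    by (metis continuous_map_snd continuous_map_into_fulltopology)
  from continuous_map_compose[OF this continuous_map_product_projection[of i]]
  show ?thesis by (simp add: o_def)
qed

lemma continuous_map_point: "i < n \<Longrightarrow> continuous_map (weighted_tuples n X) X (\<lambda>p. fst p i)"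
  unfolding weighted_tuples_def
  using continuous_map_compose[OF continuous_map_fst continuous_map_product_projection[of i "{..<n}" "\<lambda>_. X"]]
  by (simp add: o_def)

lemma continuous_map_barycenter:
  assumes z: "\<And>i. i < n \<Longrightarrow> continuous_map S X (\<lambda>s. z s i)"
    and w: "\<And>i. i < n \<Longrightarrow> continuous_map S euclideanreal (\<lambda>s. w s i)"
    and pos: "\<And>s i. s \<in> topspace S \<Longrightarrow> i < n \<Longrightarrow> 0 \<le> w s i"
    and one: "\<And>s. s \<in> topspace S \<Longrightarrow> (\<Sum>i<n. w s i) = 1"
  shows "continuous_map S Y (\<lambda>s x. \<Sum>i | i < n \<and> z s i = x. w s i)"
proof -
  define l where "l = (\<lambda>s. (\<lambda>i\<in>{..<n}. z s i, \<lambda>i. if i < n then w s i else 0))"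
  have "continuous_map S (product_topology (\<lambda>_. X) {..<n}) (\<lambda>s. \<lambda>i\<in>{..<n}. z s i)"
    using z by (auto simp: continuous_map_componentwise)
  moreover have "continuous_map S (subtopology (powertop_real UNIV) (standard_simplex (n - 1))) (\<lambda>s i. if i < n then w s i else 0)"
    unfolding continuous_map_in_subtopology
  proof (intro conjI Pi_I)
    have "continuous_map S euclideanreal (\<lambda>s. if i < n then w s i else 0)" for i
      using w by (cases "i < n") auto
    then show "continuous_map S (powertop_real UNIV) (\<lambda>s i. if i < n then w s i else 0)"
      by (simp add: continuous_map_componentwise_UNIV)
    fix s assume s: "s \<in> topspace S"
    have eq: "{..n - 1} = {..<n}" using n1 by auto
    have "w s i \<le> 1" if "i < n" for i
      using member_le_sum[of i "{..<n}" "w s"] that pos[OF s] one[OF s] by auto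
    then show "(\<lambda>i. if i < n then w s i else 0) \<in> standard_simplex (n - 1)"
      using pos[OF s] one[OF s] n1 by (auto simp: standard_simplex_def eq[simplified])
  qed
  ultimately have "continuous_map S (weighted_tuples n X) l"
    unfolding l_def weighted_tuples_def by (simp add: continuous_map_paired)
  from continuous_map_compose[OF this quotient_imp_continuous_map[OF quotient_map_barycenter_map[OF n1]]]
  have "continuous_map S Y (barycenter_map n \<circ> l)" .
  moreover have "barycenter_map n (l s) = (\<lambda>x. \<Sum>i | i < n \<and> z s i = x. w s i)" for s
    unfolding l_def barycenter_map_def by (rule ext) (auto intro!: sum.cong)
  ultimately show ?thesis by (simp add: o_def)
qed

lemma continuous_map_intg:
  assumes "continuous_map X euclideanreal \<phi>"
  shows "continuous_map Y euclideanreal (intg \<phi>)"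
proof (rule continuous_compose_quotient_map[OF quotient_map_barycenter_map[OF n1]])
  have "continuous_map (weighted_tuples n X) euclideanreal (\<lambda>p. \<Sum>i<n. snd p i * \<phi> (fst p i))"
    using continuous_map_compose[OF continuous_map_point assms]
    by (intro continuous_intros continuous_map_weight) (auto simp: o_def)
  then show "continuous_map (weighted_tuples n X) euclideanreal (intg \<phi> \<circ> barycenter_map n)"
    by (rule continuous_map_eq) (auto simp: intg_barycenter_map split_beta)
qed

text \<open>On tuples, pushing forward only moves the points and rescales the weights, so
  \<open>n\<close> points remain enough. Openness of \<open>V\<close> keeps the restricted
  barycenter map a quotient map, and the locally compact interval allows time to be added.\<close>

lemma continuous_map_push:
  assumes V: "openin Y V"
    and \<psi>: "continuous_map (prod_topology \<I> X) euclideanreal (\<lambda>(s, x). \<psi> s x)"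
    and g: "continuous_map (prod_topology \<I> X) X (\<lambda>(s, x). g s x)"
    and pos: "\<And>s x. s \<in> {0..1} \<Longrightarrow> x \<in> topspace X \<Longrightarrow> 0 \<le> \<psi> s x"
    and I: "\<And>s \<mu>. s \<in> {0..1} \<Longrightarrow> \<mu> \<in> V \<Longrightarrow> 0 < intg (\<psi> s) \<mu>"
  shows "continuous_map (prod_topology \<I> (subtopology Y V)) Y (\<lambda>(s, \<mu>). push (\<psi> s) (g s) \<mu>)"
proof -
  let ?T = "weighted_tuples n X"
  define V' where "V' = {p \<in> topspace ?T. barycenter_map n p \<in> V}"
  let ?S = "prod_topology \<I> (subtopology ?T V')"
  have "quotient_map (subtopology ?T V') (subtopology Y V) (barycenter_map n)"
    using quotient_map_restriction[OF quotient_map_barycenter_map[OF n1], where V = V and U = V'] V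
    by (auto simp: V'_def)
  then have q: "quotient_map ?S (prod_topology \<I> (subtopology Y V)) (\<lambda>(s, p). (s, barycenter_map n p))"
    by (intro quotient_map_prod_right)
       (auto simp: Hausdorff_space_subtopology compact_imp_locally_compact_space compact_space_subtopology)
  have pt: "continuous_map ?S X (\<lambda>q. fst (snd q) i)" if "i < n" for i
    using continuous_map_compose[OF continuous_map_snd continuous_map_from_subtopology[OF continuous_map_point[OF that]]]
    by (simp add: o_def)
  have wt: "continuous_map ?S euclideanreal (\<lambda>q. snd (snd q) i)" for i
    using continuous_map_compose[OF continuous_map_snd continuous_map_from_subtopology[OF continuous_map_weight]]
    by (simp add: o_def)
  have pair: "continuous_map ?S (prod_topology \<I> X) (\<lambda>q. (fst q, fst (snd q) i))" if "i < n" for i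
    by (simp add: continuous_map_paired pt that continuous_map_fst)
  have \<psi>i: "continuous_map ?S euclideanreal (\<lambda>q. \<psi> (fst q) (fst (snd q) i))" if "i < n" for i
    using continuous_map_compose[OF pair[OF that] \<psi>] by (simp add: o_def)
  have gi: "continuous_map ?S X (\<lambda>q. g (fst q) (fst (snd q) i))" if "i < n" for i
    using continuous_map_compose[OF pair[OF that] g] by (simp add: o_def)
  define D where "D = (\<lambda>q. \<Sum>i<n. snd (snd q) i * \<psi> (fst q) (fst (snd q) i))"
  have DI: "D (s, p) = intg (\<psi> s) (barycenter_map n p)" for s p
    by (cases p) (simp add: D_def intg_barycenter_map)
  have Dc: "continuous_map ?S euclideanreal D"
    unfolding D_def by (intro continuous_intros wt \<psi>i) auto
  have Dpos: "0 < D q" if "q \<in> topspace ?S" for q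
    using that I by (cases q) (auto simp: DI V'_def)
  have snn: "0 \<le> snd p i" if "p \<in> topspace ?T" for p i
    using that by (auto simp: weighted_tuples_def standard_simplex_def)
  have "continuous_map ?S Y (\<lambda>q x. \<Sum>i | i < n \<and> g (fst q) (fst (snd q) i) = x.
      snd (snd q) i * \<psi> (fst q) (fst (snd q) i) / D q)"
  proof (rule continuous_map_barycenter)
    fix i assume i: "i < n"
    show "continuous_map ?S X (\<lambda>q. g (fst q) (fst (snd q) i))" by (rule gi[OF i])
    show "continuous_map ?S euclideanreal (\<lambda>q. snd (snd q) i * \<psi> (fst q) (fst (snd q) i) / D q)"
      using Dpos by (intro continuous_intros wt \<psi>i[OF i] Dc) fastforce
    fix q assume q: "q \<in> topspace ?S"
    have "fst (snd q) i \<in> topspace X"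
      using pt[OF i] q by (meson continuous_map_image_subset_topspace image_subset_iff)
    then show "0 \<le> snd (snd q) i * \<psi> (fst q) (fst (snd q) i) / D q"
      using q Dpos[OF q] pos[of "fst q" "fst (snd q) i"] snn[of "snd q" i]
      by (auto simp: V'_def)
  next
    fix q assume q: "q \<in> topspace ?S"
    show "(\<Sum>i<n. snd (snd q) i * \<psi> (fst q) (fst (snd q) i) / D q) = 1"
      using Dpos[OF q] by (simp add: sum_divide_distrib[symmetric] D_def)
  qed
  moreover have "(\<Sum>i | i < n \<and> g s (fst p i) = x. snd p i * \<psi> s (fst p i) / D (s, p))
      = push (\<psi> s) (g s) (barycenter_map n p) x" for s p x
  proof -
    obtain z t where p: "p = (z, t)" by (cases p)
    have "(\<Sum>i | i < n \<and> g s (z i) = x. t i * \<psi> s (z i) / D (s, p))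
      = (\<Sum>i<n. (if g s (z i) = x then t i * \<psi> s (z i) else 0)) / D (s, p)"
      by (simp add: sum_divide_distrib[symmetric] sum.inter_filter[symmetric])
    also have "(\<Sum>i<n. (if g s (z i) = x then t i * \<psi> s (z i) else 0))
      = intg (\<lambda>y. if g s y = x then \<psi> s y else 0) (barycenter_map n p)"
      unfolding p intg_barycenter_map by (intro sum.cong) auto
    finally show ?thesis by (simp add: push_def DI p)
  qed
  ultimately have "continuous_map ?S Y ((\<lambda>(s, \<mu>). push (\<psi> s) (g s) \<mu>) \<circ> (\<lambda>(s, p). (s, barycenter_map n p)))"
    by (auto simp: o_def case_prod_unfold elim!: continuous_map_eq)
  then show ?thesis by (rule continuous_compose_quotient_map[OF q])
qed

text \<open>Finitely many moving labelled points give a continuous family of measures, even though the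
  set of active labels jumps: on the closed set where only the labels in \<open>A\<close> are active the family
  lifts to \<^term>\<open>weighted_tuples n X\<close>.\<close>

lemma continuous_map_labelled:
  assumes C: "finite C"
    and p: "\<And>c. c \<in> C \<Longrightarrow> continuous_map S X (p c)"
    and w: "\<And>c. c \<in> C \<Longrightarrow> continuous_map S euclideanreal (w c)"
    and pos: "\<And>c s. c \<in> C \<Longrightarrow> s \<in> topspace S \<Longrightarrow> 0 \<le> w c s"
    and one: "\<And>s. s \<in> topspace S \<Longrightarrow> (\<Sum>c\<in>C. w c s) = 1"
    and few: "\<And>s. s \<in> topspace S \<Longrightarrow> card {c \<in> C. w c s \<noteq> 0} \<le> n"
  shows "continuous_map S Y (\<lambda>s x. \<Sum>c | c \<in> C \<and> p c s = x. w c s)"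
proof (rule pasting_lemma_closed)
  \<comment> \<open>Only nonempty label sets: some label of \<open>A\<close> has to fill the slots
    beyond \<open>card A\<close>.\<close>
  let ?\<A> = "{A. A \<subseteq> C \<and> card A \<le> n \<and> A \<noteq> {}}"
  let ?T = "\<lambda>A. {s \<in> topspace S. \<forall>c\<in>C - A. w c s = 0}"
  show "finite ?\<A>" using C by (rule rev_finite_subset[OF finite_Pow_iff[THEN iffD2]]) auto
  show "closedin S (?T A)" if "A \<in> ?\<A>" for A
  proof -
    have "?T A = topspace S \<inter> (\<Inter>c\<in>C - A. {s \<in> topspace S. w c s \<in> {0}})" by auto
    moreover have "closedin S {s \<in> topspace S. w c s \<in> {0}}" if "c \<in> C - A" for c
      using that by (intro closedin_continuous_map_preimage[OF w]) auto
    ultimately show ?thesis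
      by (cases "C - A = {}") (simp_all only: INT_empty Int_UNIV_right closedin_topspace,
          auto intro!: closedin_Int closedin_INT)
  qed
  show "\<exists>A. A \<in> ?\<A> \<and> s \<in> ?T A \<and> (\<lambda>x. \<Sum>c | c \<in> C \<and> p c s = x. w c s) = (\<lambda>x. \<Sum>c | c \<in> C \<and> p c s = x. w c s)"
    if s: "s \<in> topspace S" for s
  proof -
    have "{c \<in> C. w c s \<noteq> 0} \<noteq> {}"
      using one[OF s] by (metis (mono_tags, lifting) empty_iff mem_Collect_eq sum.neutral zero_neq_one)
    then show ?thesis using few[OF s] s by (intro exI[of _ "{c \<in> C. w c s \<noteq> 0}"]) auto
  qed
  show "continuous_map (subtopology S (?T A)) Y (\<lambda>s x. \<Sum>c | c \<in> C \<and> p c s = x. w c s)" if A: "A \<in> ?\<A>" for A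
  proof -
    have fA: "finite A" using A C finite_subset by blast
    define m where "m = card A"
    obtain h where h: "bij_betw h {..<m} A"
      using fA by (metis atLeast0LessThan ex_bij_betw_nat_finite m_def)
    have m: "0 < m" "m \<le> n" using A fA by (auto simp: m_def card_gt_0_iff)
    have hA: "h i \<in> A" if "i < m" for i using h that by (auto simp: bij_betw_def)
    \<comment> \<open>Slots from \<open>m\<close> on repeat the point labelled \<open>h 0\<close>
      with weight zero, which gives tuples of length exactly \<open>n\<close>.\<close>
    define j where "j = (\<lambda>i. if i < m then h i else h 0)"
    have jC: "j i \<in> C" for i using hA m A by (auto simp: j_def)
    define v where "v = (\<lambda>s i. if i < m then w (h i) s else 0)"
    have vs: "(\<Sum>i | i < n \<and> p (j i) s = x. v s i) = (\<Sum>c | c \<in> C \<and> p c s = x. w c s)"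
      if s: "s \<in> ?T A" for s x
    proof -
      have "(\<Sum>i | i < n \<and> p (j i) s = x. v s i) = (\<Sum>i | i < m \<and> p (h i) s = x. w (h i) s)"
        using m by (intro sum.mono_neutral_cong_right) (auto simp: v_def j_def)
      also have "\<dots> = (\<Sum>c | c \<in> A \<and> p c s = x. w c s)"
      proof (rule sum.reindex_bij_betw[of h])
        show "bij_betw h {i. i < m \<and> p (h i) s = x} {c. c \<in> A \<and> p c s = x}"
          using h by (auto simp: bij_betw_def inj_on_def)
      qed
      also have "\<dots> = (\<Sum>c | c \<in> C \<and> p c s = x. w c s)"
        using A s C by (intro sum.mono_neutral_left) auto
      finally show ?thesis .
    qed
    have vone: "(\<Sum>i<n. v s i) = 1" if s: "s \<in> ?T A" for s
    proof -
      have "(\<Sum>i<n. v s i) = (\<Sum>i<m. w (h i) s)"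
        using m by (intro sum.mono_neutral_cong_right) (auto simp: v_def)
      also have "\<dots> = (\<Sum>c\<in>A. w c s)" by (rule sum.reindex_bij_betw[OF h])
      also have "\<dots> = (\<Sum>c\<in>C. w c s)" using A s C by (intro sum.mono_neutral_left) auto
      finally show ?thesis using one s by simp
    qed
    have "continuous_map (subtopology S (?T A)) Y (\<lambda>s x. \<Sum>i | i < n \<and> p (j i) s = x. v s i)"
    proof (rule continuous_map_barycenter)
      fix i assume "i < n"
      show "continuous_map (subtopology S (?T A)) X (\<lambda>s. p (j i) s)"
        using p[OF jC[of i]] by (simp add: continuous_map_from_subtopology)
      have "continuous_map S euclideanreal (\<lambda>s. v s i)"
      proof (cases "i < m")
        case True
        then have "h i \<in> C" using hA A by blast
        then show ?thesis using w[of "h i"] True by (simp add: v_def)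
      qed (simp add: v_def)
      then show "continuous_map (subtopology S (?T A)) euclideanreal (\<lambda>s. v s i)"
        by (rule continuous_map_from_subtopology)
      show "0 \<le> v s i" if "s \<in> topspace (subtopology S (?T A))" for s
        using that pos[of "h i" s] hA[of i] A by (auto simp: v_def)
    qed (use vone in auto)
    then show ?thesis by (rule continuous_map_eq) (use vs in auto)
  qed
qed auto

end

section \<open>Local contractions of spaces of measures\<close>

text \<open>Time is slowed down by the factor \<open>min 1 (2 * \<phi> x)\<close>. A point outside
  \<open>W\<close> has \<phi> zero, as its track would otherwise start in \<open>W\<close>, and so
  it does not move. Full speed now needs \<phi> at least 1/2, hence the rescaled bump.\<close>

lemma locally_contractible_at_fixing:
  assumes "locally_contractible_at X z" "openin X W" "z \<in> W"
  shows "\<exists>\<phi> h. continuous_map X euclideanreal \<phi> \<and> continuous_map (prod_topology \<I> X) X (\<lambda>(t, x). h t x) \<and>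
       \<phi> z = 1 \<and> (\<forall>x\<in>topspace X. 0 \<le> \<phi> x \<and> \<phi> x \<le> 1 \<and> h 0 x = x \<and>
         (x \<notin> W \<longrightarrow> (\<forall>t\<in>{0..1}. h t x = x)) \<and>
         (0 < \<phi> x \<longrightarrow> h 1 x = z \<and> (\<forall>t\<in>{0..1}. h t x \<in> W)))"
proof -
  obtain \<phi> h where c: "continuous_map X euclideanreal \<phi>" "continuous_map (prod_topology \<I> X) X (\<lambda>(t, x). h t x)"
    and z: "\<phi> z = 1" and p: "\<And>x. x \<in> topspace X \<Longrightarrow> 0 \<le> \<phi> x \<and> \<phi> x \<le> 1 \<and> h 0 x = x \<and>
         (0 < \<phi> x \<longrightarrow> h 1 x = z \<and> (\<forall>t\<in>{0..1}. h t x \<in> W))"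
    using assms unfolding locally_contractible_at_def by metis
  define \<psi> where "\<psi> = (\<lambda>x. min 1 (2 * \<phi> x))"
  have \<psi>01: "0 \<le> \<psi> x \<and> \<psi> x \<le> 1" if "x \<in> topspace X" for x using p[OF that] by (auto simp: \<psi>_def)
  have sc: "t * \<psi> x \<in> {0..1}" if "x \<in> topspace X" "t \<in> {0..1}" for t x
    using \<psi>01[OF that(1)] that(2) by (auto intro: mult_le_one)
  have "continuous_map (prod_topology \<I> X) (prod_topology \<I> X) (\<lambda>q. (fst q * \<psi> (snd q), snd q))"
    unfolding continuous_map_paired
  proof
    have "continuous_map (prod_topology \<I> X) euclideanreal (\<lambda>q. \<psi> (snd q))"
      unfolding \<psi>_def using continuous_map_compose[OF continuous_map_snd c(1)]
      by (intro continuous_intros) (auto simp: o_def)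
    moreover have "continuous_map (prod_topology \<I> X) euclideanreal fst"
      by (metis continuous_map_fst continuous_map_into_fulltopology)
    ultimately show "continuous_map (prod_topology \<I> X) \<I> (\<lambda>q. fst q * \<psi> (snd q))"
      unfolding continuous_map_in_subtopology using sc by (auto intro: continuous_map_real_mult)
  qed (rule continuous_map_snd)
  from continuous_map_compose[OF this c(2)]
  have hc: "continuous_map (prod_topology \<I> X) X (\<lambda>(t, x). h (t * \<psi> x) x)"
    by (simp add: o_def case_prod_unfold)
  show ?thesis
  proof (intro exI conjI ballI impI)
    show "continuous_map X euclideanreal (\<lambda>x. max 0 (2 * \<phi> x - 1))"
      by (intro continuous_intros c)
    show "continuous_map (prod_topology \<I> X) X (\<lambda>(t, x). h (t * \<psi> x) x)" by (rule hc)
    fix x assume x: "x \<in> topspace X"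
    show "h (t * \<psi> x) x = x" if "x \<notin> W" "t \<in> {0..1}" for t
    proof -
      have "\<not> 0 < \<phi> x" using p[OF x] that(1) by force
      then have "\<psi> x = 0" using p[OF x] by (simp add: \<psi>_def)
      then show ?thesis using p[OF x] by simp
    qed
    assume "0 < max 0 (2 * \<phi> x - 1)"
    then have "1/2 < \<phi> x" by auto
    then have "\<psi> x = 1" "0 < \<phi> x" by (auto simp: \<psi>_def)
    then show "h (1 * \<psi> x) x = z" using p[OF x] by simp
    show "h (t * \<psi> x) x \<in> W" if "t \<in> {0..1}" for t
      using p[OF x] that \<open>\<psi> x = 1\<close> \<open>0 < \<phi> x\<close> by auto
  qed (use p z in auto)
qed

text \<open>Disjoint neighbourhoods separate the new point from the old ones, and each homotopy is
  stationary off its own neighbourhood. So \<open>g t (h t x)\<close> follows only one of the two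
  wherever a bump is positive. That points off \<Omega> stay fixed is part of the claim in order to
  carry this induction.\<close>

lemma locally_contractible_finite:
  assumes "finite Z" "openin X \<Omega>" "Z \<subseteq> \<Omega>" "Hausdorff_space X"
    and "\<And>z. z \<in> Z \<Longrightarrow> locally_contractible_at X z"
  shows "\<exists>\<phi> h. continuous_map (prod_topology \<I> X) X (\<lambda>(t, x). h t x) \<and>
     (\<forall>x\<in>topspace X. h 0 x = x \<and> (x \<notin> \<Omega> \<longrightarrow> (\<forall>t\<in>{0..1}. h t x = x))) \<and>
     (\<forall>z\<in>Z. continuous_map X euclideanreal (\<phi> z) \<and> \<phi> z z = 1 \<and>
        (\<forall>x\<in>topspace X. 0 \<le> \<phi> z x \<and> \<phi> z x \<le> 1 \<and>
           (0 < \<phi> z x \<longrightarrow> h 1 x = z \<and> (\<forall>t\<in>{0..1}. h t x \<in> \<Omega>))))"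
  using assms
proof (induction Z arbitrary: \<Omega>)
  case empty
  show ?case by (intro exI[of _ "\<lambda>z x. 0"] exI[of _ "\<lambda>t x. x"]) (auto simp: case_prod_unfold continuous_map_snd)
next
  case (insert z Z)
  have "compactin X {z}" "compactin X Z" "disjnt {z} Z"
    using insert openin_subset[OF insert.prems(1)] by (auto intro!: finite_imp_compactin)
  then obtain U V where UV: "openin X U" "openin X V" "{z} \<subseteq> U" "Z \<subseteq> V" "disjnt U V"
    using insert.prems(3) unfolding Hausdorff_space_compact_sets by metis
  define W where "W = U \<inter> \<Omega>"
  define O' where "O' = V \<inter> \<Omega>"
  have W: "openin X W" "z \<in> W" and O: "openin X O'" "Z \<subseteq> O'" and WO: "W \<inter> O' = {}"
    using UV insert.prems by (auto simp: W_def O'_def disjnt_def)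
  obtain \<phi> h where h: "continuous_map (prod_topology \<I> X) X (\<lambda>(t, x). h t x)"
    and hx: "\<And>x. x \<in> topspace X \<Longrightarrow> h 0 x = x \<and> (x \<notin> O' \<longrightarrow> (\<forall>t\<in>{0..1}. h t x = x))"
    and \<phi>: "\<And>w. w \<in> Z \<Longrightarrow> continuous_map X euclideanreal (\<phi> w) \<and> \<phi> w w = 1 \<and>
        (\<forall>x\<in>topspace X. 0 \<le> \<phi> w x \<and> \<phi> w x \<le> 1 \<and>
           (0 < \<phi> w x \<longrightarrow> h 1 x = w \<and> (\<forall>t\<in>{0..1}. h t x \<in> O')))"
    using insert.IH[OF O insert.prems(3)] insert.prems(4) by (metis insertI2)
  obtain \<eta> g where g: "continuous_map X euclideanreal \<eta>" "continuous_map (prod_topology \<I> X) X (\<lambda>(t, x). g t x)"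
    and \<eta>z: "\<eta> z = 1" and gx: "\<And>x. x \<in> topspace X \<Longrightarrow> 0 \<le> \<eta> x \<and> \<eta> x \<le> 1 \<and> g 0 x = x \<and>
         (x \<notin> W \<longrightarrow> (\<forall>t\<in>{0..1}. g t x = x)) \<and>
         (0 < \<eta> x \<longrightarrow> g 1 x = z \<and> (\<forall>t\<in>{0..1}. g t x \<in> W))"
    using locally_contractible_at_fixing[OF insert.prems(4)[of z] W] by auto
  have "continuous_map (prod_topology \<I> X) (prod_topology \<I> X) (\<lambda>q. (fst q, (\<lambda>(t, x). h t x) q))"
    by (simp only: continuous_map_paired h continuous_map_fst simp_thms)
  from continuous_map_compose[OF this g(2)]
  have gh: "continuous_map (prod_topology \<I> X) X (\<lambda>(t, x). g t (h t x))"
    by (simp add: o_def case_prod_unfold)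
  have hX: "h t x \<in> topspace X" if "x \<in> topspace X" "t \<in> {0..1}" for t x
    using continuous_map_image_subset_topspace[OF h] that by (simp add: image_subset_iff)
  have OX: "O' \<subseteq> topspace X" "W \<subseteq> topspace X" using O W openin_subset by auto
  have out: "g t (h t x) = x" if "x \<in> topspace X" "x \<notin> \<Omega>" "t \<in> {0..1}" for t x
  proof -
    have "x \<notin> O'" "x \<notin> W" using that(2) by (auto simp: W_def O'_def)
    then show ?thesis using hx[OF that(1)] gx[OF that(1)] that(3) by simp
  qed
  have old: "g 1 (h 1 x) = w \<and> (\<forall>t\<in>{0..1}. g t (h t x) \<in> \<Omega>)"
    if "w \<in> Z" "x \<in> topspace X" "0 < \<phi> w x" for w x
  proof -
    have 1: "h 1 x = w" "\<And>t. t \<in> {0..1} \<Longrightarrow> h t x \<in> O'" using \<phi>[OF that(1)] that by auto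
    have "g t (h t x) = h t x" if t: "t \<in> {0..1}" for t
      using gx[of "h t x"] 1(2)[OF t] WO OX t by blast
    moreover have "O' \<subseteq> \<Omega>" by (simp add: O'_def)
    ultimately show ?thesis using 1 by auto
  qed
  have new: "g 1 (h 1 x) = z \<and> (\<forall>t\<in>{0..1}. g t (h t x) \<in> \<Omega>)"
    if "x \<in> topspace X" "0 < \<eta> x" for x
  proof -
    have 1: "g 1 x = z" "\<And>t. t \<in> {0..1} \<Longrightarrow> g t x \<in> W" using gx[OF that(1)] that(2) by auto
    have "g 0 x \<in> W" using 1(2) by auto
    then have "x \<in> W" using gx[OF that(1)] by simp
    then have "x \<notin> O'" using WO by blast
    then have "h t x = x" if "t \<in> {0..1}" for t using hx that \<open>x \<in> topspace X\<close> by blast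
    moreover have "W \<subseteq> \<Omega>" by (simp add: W_def)
    ultimately show ?thesis using 1 by auto
  qed
  have "\<forall>w\<in>insert z Z. continuous_map X euclideanreal ((\<phi>(z := \<eta>)) w) \<and> (\<phi>(z := \<eta>)) w w = 1 \<and>
        (\<forall>x\<in>topspace X. 0 \<le> (\<phi>(z := \<eta>)) w x \<and> (\<phi>(z := \<eta>)) w x \<le> 1 \<and>
           (0 < (\<phi>(z := \<eta>)) w x \<longrightarrow> g 1 (h 1 x) = w \<and> (\<forall>t\<in>{0..1}. g t (h t x) \<in> \<Omega>)))"
    using insert.hyps(2) g(1) \<eta>z gx new \<phi> old by auto
  moreover have "\<forall>x\<in>topspace X. g 0 (h 0 x) = x \<and> (x \<notin> \<Omega> \<longrightarrow> (\<forall>t\<in>{0..1}. g t (h t x) = x))"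
    using hx gx out by auto
  ultimately show ?case
    using gh by (intro exI[of _ "\<phi>(z := \<eta>)"] exI[of _ "\<lambda>t x. g t (h t x)"]) blast
qed

section \<open>Contractible carriers in the space of measures\<close>

context barycenters
begin

definition meets :: "'a set \<Rightarrow> ('a \<Rightarrow> real) set" where
  "meets A = {\<mu> \<in> topspace Y. \<exists>x\<in>A. \<mu> x \<noteq> 0}"

definition support_set :: "('a \<Rightarrow> real) \<Rightarrow> 'a set" where
  "support_set \<phi> = {x \<in> topspace X. 0 < \<phi> x}"

text \<open>Filling costs room: the measures that charge the positivity set of \<phi> shrink to one
  measure through measures charging the larger \<Omega>. A function is kept instead of an open set
  because its integral detects charging continuously.\<close>

definition contracts :: "('a \<Rightarrow> real) \<Rightarrow> 'a set \<Rightarrow> bool" where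
  "contracts \<phi> \<Omega> \<longleftrightarrow>
     continuous_map X euclideanreal \<phi> \<and> (\<forall>x\<in>topspace X. 0 \<le> \<phi> x \<and> \<phi> x \<le> 1) \<and> support_set \<phi> \<subseteq> \<Omega> \<and>
     (\<exists>a. homotopic_with (\<lambda>f. f ` meets (support_set \<phi>) \<subseteq> meets \<Omega>)
        (subtopology Y (meets (support_set \<phi>))) Y (\<lambda>\<mu>. \<mu>) (\<lambda>_. a))"

lemma meets_mono: "A \<subseteq> B \<Longrightarrow> meets A \<subseteq> meets B"
  by (auto simp: meets_def)

lemma meets_sub: "meets A \<subseteq> topspace Y"
  by (auto simp: meets_def)

text \<open>All summands are nonnegative, so the integral is positive as soon as one charged point
  has positive \<phi>. For continuous \<phi> this makes charging an open condition.\<close>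

lemma meets_intg:
  assumes "\<And>x. x \<in> topspace X \<Longrightarrow> 0 \<le> \<phi> x"
  shows "meets (support_set \<phi>) = {\<mu> \<in> topspace Y. 0 < intg \<phi> \<mu>}"
proof -
  have "(\<exists>x\<in>support_set \<phi>. \<mu> x \<noteq> 0) \<longleftrightarrow> 0 < intg \<phi> \<mu>" if \<mu>: "\<mu> \<in> topspace Y" for \<mu>
  proof
    assume "\<exists>x\<in>support_set \<phi>. \<mu> x \<noteq> 0"
    then obtain x where x: "x \<in> topspace X" "0 < \<phi> x" "\<mu> x \<noteq> 0" by (auto simp: support_set_def)
    then have "0 < \<mu> x * \<phi> x" using Y_D(1)[OF \<mu>, of x] by simp
    then show "0 < intg \<phi> \<mu>"
      unfolding intg_def using x Y_D(1-3)[OF \<mu>] assms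
      by (intro sum_pos2[of _ x]) auto
  next
    assume "0 < intg \<phi> \<mu>"
    then obtain x where "\<mu> x \<noteq> 0" "0 < \<mu> x * \<phi> x"
      unfolding intg_def by (metis (mono_tags, lifting) mem_Collect_eq not_less sum_nonpos)
    then show "\<exists>x\<in>support_set \<phi>. \<mu> x \<noteq> 0"
      using Y_D(1,3)[OF \<mu>, of x] by (auto simp: support_set_def zero_less_mult_iff)
  qed
  then show ?thesis by (auto simp: meets_def)
qed

lemma intg_cong: "\<mu> \<in> topspace Y \<Longrightarrow> (\<And>x. x \<in> topspace X \<Longrightarrow> \<phi> x = \<psi> x) \<Longrightarrow> intg \<phi> \<mu> = intg \<psi> \<mu>"
  unfolding intg_def using Y_D(3) by (intro sum.cong) auto

lemma intg_point: "\<mu> \<in> topspace Y \<Longrightarrow> intg (\<lambda>y. if y = x then \<psi> y else 0) \<mu> = \<mu> x * \<psi> x"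
proof -
  assume \<mu>: "\<mu> \<in> topspace Y"
  have "intg (\<lambda>y. if y = x then \<psi> y else 0) \<mu> = (\<Sum>y | \<mu> y \<noteq> 0. if y = x then \<mu> y * \<psi> y else 0)"
    unfolding intg_def by (intro sum.cong) auto
  also have "\<dots> = (if \<mu> x \<noteq> 0 then \<mu> x * \<psi> x else 0)"
    using Y_D(2)[OF \<mu>] by (simp add: sum.delta')
  finally show ?thesis by simp
qed

text \<open>Weights are nonnegative, so nothing that arrives at \<open>g y\<close> can cancel the
  mass coming from \<open>y\<close>.\<close>

lemma push_meets:
  assumes "\<mu> \<in> topspace Y" "push \<psi> g \<mu> \<in> topspace Y" and pos: "\<And>x. x \<in> topspace X \<Longrightarrow> 0 \<le> \<psi> x"
    and y: "\<mu> y \<noteq> 0" "0 < \<psi> y" "g y \<in> \<Omega>"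
  shows "push \<psi> g \<mu> \<in> meets \<Omega>"
proof -
  have ps: "0 < intg \<eta> \<mu>" if "\<And>x. x \<in> topspace X \<Longrightarrow> 0 \<le> \<eta> x" "0 < \<eta> y" for \<eta>
    using meets_intg[of \<eta>] assms(1) y that Y_D(3)[OF assms(1) y(1)]
    by (auto simp: meets_def support_set_def)
  have "0 < push \<psi> g \<mu> (g y)"
    unfolding push_def by (intro divide_pos_pos ps) (use pos y in auto)
  then show ?thesis using assms(2) y by (auto simp: meets_def intro!: bexI[of _ "g y"])
qed

text \<open>\<open>H1\<close>, \<open>H2\<close> and \<open>H3\<close> all run through measures
  charging \<Omega>. The bound on \<open>card Z\<close> serves the last one: after the contraction
  the measure lives on \<open>Z\<close>, and the whole simplex of measures on \<open>Z\<close> is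
  available for a linear shift.\<close>

lemma ex_contracts:
  assumes Z: "finite Z" "Z \<noteq> {}" "card Z \<le> n" and \<Omega>: "openin X \<Omega>" "Z \<subseteq> \<Omega>" and "Hausdorff_space X"
    and "\<And>z. z \<in> Z \<Longrightarrow> locally_contractible_at X z"
  shows "\<exists>\<phi>. contracts \<phi> \<Omega> \<and> (\<forall>z\<in>Z. \<phi> z = 1)"
proof -
  obtain \<phi>s h where h: "continuous_map (prod_topology \<I> X) X (\<lambda>(t, x). h t x)"
    and hx: "\<And>x. x \<in> topspace X \<Longrightarrow> h 0 x = x"
    and \<phi>s: "\<And>z. z \<in> Z \<Longrightarrow> continuous_map X euclideanreal (\<phi>s z) \<and> \<phi>s z z = 1 \<and>
        (\<forall>x\<in>topspace X. 0 \<le> \<phi>s z x \<and> \<phi>s z x \<le> 1 \<and>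
           (0 < \<phi>s z x \<longrightarrow> h 1 x = z \<and> (\<forall>t\<in>{0..1}. h t x \<in> \<Omega>)))"
    using locally_contractible_finite[OF Z(1) \<Omega> assms(6,7)] by blast
  have \<phi>s01: "0 \<le> \<phi>s z x \<and> \<phi>s z x \<le> 1" if "z \<in> Z" "x \<in> topspace X" for z x
    using \<phi>s[OF that(1)] that(2) by blast
  have \<phi>straj: "h t x \<in> \<Omega>" if "z \<in> Z" "x \<in> topspace X" "0 < \<phi>s z x" "t \<in> {0..1}" for z x t
    using \<phi>s[OF that(1)] that(2-4) by blast
  define \<phi> where "\<phi> = (\<lambda>x. \<Sum>z\<in>Z. \<phi>s z x)"
  \<comment> \<open>\<open>h 1 x\<close> names the point to which \<open>x\<close> contracts, so at
    most one bump is nonzero at \<open>x\<close>. Hence the sum of the bumps stays at most 1, and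
    the mass sent to \<open>z\<close> is the integral of \<open>\<phi>s z\<close>, up to
    normalisation.\<close>
  have only: "\<phi>s z x = (if h 1 x = z then \<phi> x else 0)" if x: "x \<in> topspace X" and z: "z \<in> Z" for x z
  proof (cases "h 1 x = z")
    case True
    have "\<phi>s w x = 0" if "w \<in> Z - {z}" for w
      using \<phi>s[of w] x True that by (metis DiffE insertI1 order_less_le)
    then have "\<phi> x = \<phi>s z x"
      unfolding \<phi>_def using z Z(1) by (simp add: sum.remove)
    then show ?thesis using True by simp
  next
    case False
    then show ?thesis using \<phi>s[OF z] x by (metis order_less_le)
  qed
  have \<phi>c: "continuous_map X euclideanreal \<phi>"
    unfolding \<phi>_def using \<phi>s Z(1) by (intro continuous_intros) auto
  have \<phi>0: "0 \<le> \<phi> x" if "x \<in> topspace X" for x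
    unfolding \<phi>_def using \<phi>s01 that by (intro sum_nonneg) auto
  have pz: "h 1 x \<in> Z \<and> 0 < \<phi>s (h 1 x) x" if px: "x \<in> topspace X" "0 < \<phi> x" for x
  proof -
    have "(\<Sum>z\<in>Z. \<phi>s z x) \<noteq> 0" using px(2) by (simp add: \<phi>_def)
    then obtain z where z: "z \<in> Z" "\<phi>s z x \<noteq> 0" by (meson sum.neutral)
    then show ?thesis using only[OF px(1) z(1)] px(2) by (auto split: if_splits)
  qed
  have \<phi>1: "\<phi> x \<le> 1" if "x \<in> topspace X" for x
  proof (cases "0 < \<phi> x")
    case True
    have "\<phi>s (h 1 x) x \<le> 1" using \<phi>s01 pz[OF that True] that by blast
    then show ?thesis using only[OF that] pz[OF that True] by simp
  qed simp
  have traj: "h t x \<in> \<Omega>" if "x \<in> topspace X" "0 < \<phi> x" "t \<in> {0..1}" for t x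
    using pz[OF that(1,2)] \<phi>straj[of "h 1 x" x t] that by blast
  have \<phi>\<Omega>: "x \<in> \<Omega>" if "x \<in> topspace X" "0 < \<phi> x" for x
    using traj[OF that, of 0] hx[OF that(1)] by simp
  have \<phi>z: "\<phi> z = 1" if "z \<in> Z" for z
  proof -
    have zX: "z \<in> topspace X" using \<Omega> that openin_subset by blast
    have "\<phi>s z z = 1" using \<phi>s[OF that] by simp
    then show ?thesis using only[OF zX that] by (auto split: if_splits)
  qed
  let ?V = "meets (support_set \<phi>)"
  have Veq: "?V = {\<mu> \<in> topspace Y. 0 < intg \<phi> \<mu>}" by (rule meets_intg[OF \<phi>0])
  have "?V = {\<mu> \<in> topspace Y. intg \<phi> \<mu> \<in> {0<..}}" using Veq by auto
  then have Vop: "openin Y ?V"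
    using openin_continuous_map_preimage[OF continuous_map_intg[OF \<phi>c], of "{0<..}"] by simp
  have VD: "\<exists>y\<in>topspace X. \<mu> y \<noteq> 0 \<and> 0 < \<phi> y" if "\<mu> \<in> ?V" for \<mu>
    using that by (auto simp: meets_def support_set_def)
  have VY: "\<mu> \<in> topspace Y" if "\<mu> \<in> ?V" for \<mu> using that by (auto simp: meets_def)
  let ?P = "\<lambda>f. f ` ?V \<subseteq> meets \<Omega>"
  have topV: "topspace (subtopology Y ?V) = ?V" using meets_sub by auto
  have Pcong: "?P f \<longleftrightarrow> ?P g" if "\<And>x. x \<in> topspace (subtopology Y ?V) \<Longrightarrow> f x = g x" for f g
    using that unfolding topV by (simp add: image_subset_iff)
  have hom: "homotopic_with ?P (subtopology Y ?V) Y f g"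
    if "continuous_map (prod_topology \<I> (subtopology Y ?V)) Y (\<lambda>(s, \<mu>). k s \<mu>)"
      "\<And>\<mu>. \<mu> \<in> ?V \<Longrightarrow> k 0 \<mu> = f \<mu> \<and> k 1 \<mu> = g \<mu>"
      "\<And>s \<mu>. \<mu> \<in> ?V \<Longrightarrow> s \<in> {0..1} \<Longrightarrow> k s \<mu> \<in> topspace Y \<Longrightarrow> k s \<mu> \<in> meets \<Omega>" for f g k
  proof -
    have "k s \<mu> \<in> topspace Y" if "\<mu> \<in> ?V" "s \<in> {0..1}" for s \<mu>
      using continuous_map_image_subset_topspace[OF \<open>continuous_map _ _ (\<lambda>(s, \<mu>). k s \<mu>)\<close>] that VY
      by (simp add: image_subset_iff)
    then have im: "\<forall>t\<in>{0..1}. ?P (\<lambda>x. k t x)" using that(3) by blast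
    show ?thesis
    proof (rule iffD2[OF homotopic_with])
      show "?P u \<longleftrightarrow> ?P v" if "\<And>x. x \<in> topspace (subtopology Y ?V) \<Longrightarrow> u x = v x" for u v
        by (rule Pcong[OF that])
      show "\<exists>H. continuous_map (prod_topology \<I> (subtopology Y ?V)) Y H \<and>
          (\<forall>x\<in>topspace (subtopology Y ?V). H (0, x) = f x) \<and>
          (\<forall>x\<in>topspace (subtopology Y ?V). H (1, x) = g x) \<and> (\<forall>t\<in>{0..1}. ?P (\<lambda>x. H (t, x)))"
        unfolding topV using that(1,2) im by (intro exI[of _ "\<lambda>(s, \<mu>). k s \<mu>"]) simp
    qed
  qed
  have cs: "continuous_map (prod_topology \<I> X) euclideanreal (\<lambda>q. \<phi> (snd q))"
    using continuous_map_compose[OF continuous_map_snd \<phi>c] by (simp add: o_def)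
  have cf: "continuous_map (prod_topology \<I> W) euclideanreal fst" for W :: "'w topology"
    by (metis continuous_map_fst continuous_map_into_fulltopology)
  \<comment> \<open>The density moves linearly from 1 to \<phi>: mass where \<phi> vanishes fades
    out, while a charged point with positive \<phi> keeps positive density throughout.\<close>
  have H1: "homotopic_with ?P (subtopology Y ?V) Y (\<lambda>\<mu>. \<mu>) (\<lambda>\<mu>. push \<phi> (\<lambda>x. x) \<mu>)"
  proof (rule hom[of "\<lambda>s. push (\<lambda>x. (1 - s) + s * \<phi> x) (\<lambda>x. x)"])
    have pp: "0 < (1 - s) + s * \<phi> x" if "x \<in> topspace X" "0 < \<phi> x" "s \<in> {0..1}" for s x
      using that by (cases "s = 0") (auto intro: add_nonneg_pos)
    have pn: "0 \<le> (1 - s) + s * \<phi> x" if "x \<in> topspace X" "s \<in> {0..1}" for s x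
      using that \<phi>0 by auto
    show "continuous_map (prod_topology \<I> (subtopology Y ?V)) Y
       (\<lambda>(s, \<mu>). push (\<lambda>x. (1 - s) + s * \<phi> x) (\<lambda>x. x) \<mu>)"
    proof (rule continuous_map_push[OF Vop, of "\<lambda>s x. (1 - s) + s * \<phi> x" "\<lambda>s x. x"])
      show "continuous_map (prod_topology \<I> X) euclideanreal (\<lambda>(s, x). 1 - s + s * \<phi> x)"
        unfolding case_prod_unfold by (intro continuous_intros cs cf)
      show "continuous_map (prod_topology \<I> X) X (\<lambda>(s, x). x)"
        by (simp add: case_prod_unfold continuous_map_snd)
      show "0 < intg (\<lambda>x. (1 - s) + s * \<phi> x) \<mu>" if s: "s \<in> {0..1}" and \<mu>: "\<mu> \<in> ?V" for s \<mu>
      proof -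
        obtain y where "y \<in> topspace X" "\<mu> y \<noteq> 0" "0 < \<phi> y" using VD \<mu> by blast
        then have "\<mu> \<in> meets (support_set (\<lambda>x. (1 - s) + s * \<phi> x))"
          using VY[OF \<mu>] pp[OF _ _ s] unfolding meets_def support_set_def by blast
        then show ?thesis using meets_intg[of "\<lambda>x. (1 - s) + s * \<phi> x"] pn[OF _ s] by auto
      qed
    qed (use pn in auto)
    fix s \<mu> assume \<mu>: "\<mu> \<in> ?V" and s: "s \<in> {0..1}" and k: "push (\<lambda>x. (1 - s) + s * \<phi> x) (\<lambda>x. x) \<mu> \<in> topspace Y"
    obtain y where "y \<in> topspace X" "\<mu> y \<noteq> 0" "0 < \<phi> y" using VD \<mu> by blast
    then show "push (\<lambda>x. (1 - s) + s * \<phi> x) (\<lambda>x. x) \<mu> \<in> meets \<Omega>"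
      using pp pn s \<phi>\<Omega> by (intro push_meets[OF VY[OF \<mu>] k, of y]) auto
  next
    fix \<mu> assume \<mu>: "\<mu> \<in> ?V"
    have "intg (\<lambda>x. 1) \<mu> = 1" using Y_D(5)[OF VY[OF \<mu>]] by (simp add: intg_def)
    then have "push (\<lambda>x. 1) (\<lambda>x. x) \<mu> = \<mu>"
      using intg_point[OF VY[OF \<mu>], of _ "\<lambda>_. 1"] by (auto simp: push_def)
    then show "push (\<lambda>x. (1 - 0) + 0 * \<phi> x) (\<lambda>x. x) \<mu> = \<mu> \<and>
        push (\<lambda>x. (1 - 1) + 1 * \<phi> x) (\<lambda>x. x) \<mu> = push \<phi> (\<lambda>x. x) \<mu>" by simp
  qed
  have H2: "homotopic_with ?P (subtopology Y ?V) Y (\<lambda>\<mu>. push \<phi> (\<lambda>x. x) \<mu>) (\<lambda>\<mu>. push \<phi> (h 1) \<mu>)"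
  proof (rule hom[of "\<lambda>s. push \<phi> (h s)"])
    show "continuous_map (prod_topology \<I> (subtopology Y ?V)) Y (\<lambda>(s, \<mu>). push \<phi> (h s) \<mu>)"
      by (rule continuous_map_push[OF Vop, of "\<lambda>s. \<phi>" h])
        (use cs h \<phi>0 in \<open>auto simp: case_prod_unfold Veq\<close>)
    fix \<mu> assume \<mu>: "\<mu> \<in> ?V"
    have "push \<phi> (h 0) \<mu> x = push \<phi> (\<lambda>x. x) \<mu> x" for x
      unfolding push_def using hx by (subst intg_cong[OF VY[OF \<mu>]]) auto
    then show "push \<phi> (h 0) \<mu> = push \<phi> (\<lambda>x. x) \<mu> \<and> push \<phi> (h 1) \<mu> = push \<phi> (h 1) \<mu>" by auto
    fix s assume s: "s \<in> {0..1::real}" and k: "push \<phi> (h s) \<mu> \<in> topspace Y"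
    obtain y where "y \<in> topspace X" "\<mu> y \<noteq> 0" "0 < \<phi> y" using VD \<mu> by blast
    then show "push \<phi> (h s) \<mu> \<in> meets \<Omega>"
      using \<phi>0 s traj by (intro push_meets[OF VY[OF \<mu>] k, of y]) auto
  qed
  obtain a where a: "a \<in> Z" using Z by blast
  \<comment> \<open>At time 0 these are the weights of the push-forward under \<open>h 1\<close>, at
    time 1 those of the Dirac measure at \<open>a\<close>; the labels are the points of
    \<open>Z\<close> themselves.\<close>
  define w where "w = (\<lambda>z (s, \<mu>). (1 - s) * (intg (\<phi>s z) \<mu> / intg \<phi> \<mu>) + s * (if z = a then 1 else 0))"
  define k where "k = (\<lambda>s \<mu> x. \<Sum>z | z \<in> Z \<and> z = x. w z (s, \<mu>))"
  have kx: "k s \<mu> x = (if x \<in> Z then w x (s, \<mu>) else 0)" for s \<mu> x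
  proof -
    have "{z. z \<in> Z \<and> z = x} = (if x \<in> Z then {x} else {})" by auto
    then show ?thesis by (simp add: k_def)
  qed
  have H3: "homotopic_with ?P (subtopology Y ?V) Y (\<lambda>\<mu>. push \<phi> (h 1) \<mu>) (\<lambda>\<mu>. dirac a)"
  proof (rule hom[of k])
    let ?S = "prod_topology \<I> (subtopology Y ?V)"
    have ic: "continuous_map ?S euclideanreal (\<lambda>q. intg \<eta> (snd q))" if "continuous_map X euclideanreal \<eta>" for \<eta>
      using continuous_map_compose[OF continuous_map_snd continuous_map_from_subtopology[OF continuous_map_intg[OF that]]]
      by (simp add: o_def)
    have nn: "0 \<le> intg (\<phi>s z) \<mu>" if "\<mu> \<in> ?V" "z \<in> Z" for \<mu> z
      unfolding intg_def using Y_D(1,3)[OF VY[OF that(1)]] \<phi>s01[OF that(2)] by (intro sum_nonneg) auto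
    have "continuous_map ?S Y (\<lambda>q x. \<Sum>z | z \<in> Z \<and> z = x. w z q)"
    proof (rule continuous_map_labelled[OF Z(1), of _ "\<lambda>z q. z"])
      fix z assume z: "z \<in> Z"
      then show "continuous_map ?S X (\<lambda>q. z)" using \<Omega> openin_subset by auto
      show "continuous_map ?S euclideanreal (w z)"
        unfolding w_def case_prod_unfold using \<phi>s[OF z] Veq
        by (intro continuous_intros ic cf \<phi>c) auto
      show "0 \<le> w z q" if "q \<in> topspace ?S" for q
        using nn[OF _ z] that Veq by (cases q) (auto simp: w_def)
    next
      fix q assume "q \<in> topspace ?S"
      then obtain s \<mu> where q: "q = (s, \<mu>)" "\<mu> \<in> ?V" by auto
      have "(\<Sum>z\<in>Z. intg (\<phi>s z) \<mu>) = intg \<phi> \<mu>"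
        unfolding intg_def \<phi>_def by (simp add: sum_distrib_left sum.swap[of _ Z])
      moreover have "0 < intg \<phi> \<mu>" using q Veq by auto
      ultimately have "(\<Sum>z\<in>Z. intg (\<phi>s z) \<mu> / intg \<phi> \<mu>) = 1"
        by (simp add: sum_divide_distrib[symmetric])
      moreover have "(\<Sum>z\<in>Z. if z = a then 1 else 0) = (1 :: real)" using a Z(1) by simp
      ultimately show "(\<Sum>z\<in>Z. w z q) = 1"
        unfolding q w_def prod.case sum.distrib sum_distrib_left[symmetric] by simp
      have "card {z \<in> Z. w z q \<noteq> 0} \<le> card Z" using Z(1) by (intro card_mono) auto
      then show "card {z \<in> Z. w z q \<noteq> 0} \<le> n" using Z(3) by linarith
    qed
    then show "continuous_map ?S Y (\<lambda>(s, \<mu>). k s \<mu>)"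
      by (rule continuous_map_eq) (auto simp: k_def)
    fix \<mu> assume \<mu>: "\<mu> \<in> ?V"
    have "push \<phi> (h 1) \<mu> x = k 0 \<mu> x" for x
    proof (cases "x \<in> Z")
      case True
      have "intg (\<lambda>y. if h 1 y = x then \<phi> y else 0) \<mu> = intg (\<phi>s x) \<mu>"
        using only True by (intro intg_cong[OF VY[OF \<mu>]]) auto
      then show ?thesis using True by (simp add: push_def kx w_def)
    next
      case False
      have "intg (\<lambda>y. if h 1 y = x then \<phi> y else 0) \<mu> = intg (\<lambda>y. 0) \<mu>"
      proof (rule intg_cong[OF VY[OF \<mu>]])
        fix y assume "y \<in> topspace X"
        then show "(if h 1 y = x then \<phi> y else 0) = 0"
          using pz[of y] \<phi>0[of y] False by (auto simp: order_less_le)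
      qed
      then show ?thesis using False by (simp add: push_def kx intg_def)
    qed
    moreover have "k 1 \<mu> x = dirac a x" for x using a by (auto simp: kx w_def dirac_def)
    ultimately show "k 0 \<mu> = push \<phi> (h 1) \<mu> \<and> k 1 \<mu> = dirac a" by auto
    fix s assume "s \<in> {0..1::real}" and kY: "k s \<mu> \<in> topspace Y"
    obtain x where "k s \<mu> x \<noteq> 0" using Y_nonzero[OF kY] by blast
    then have "x \<in> Z" by (auto simp: kx split: if_splits)
    then show "k s \<mu> \<in> meets \<Omega>" using \<open>k s \<mu> x \<noteq> 0\<close> kY \<Omega> by (auto simp: meets_def)
  qed
  have "homotopic_with ?P (subtopology Y ?V) Y (\<lambda>\<mu>. \<mu>) (\<lambda>\<mu>. dirac a)"
    using homotopic_with_trans[OF homotopic_with_trans[OF H1 H2] H3] .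
  then have "contracts \<phi> \<Omega>"
    unfolding contracts_def using \<phi>c \<phi>0 \<phi>1 \<phi>\<Omega> by (auto simp: support_set_def)
  then show ?thesis using \<phi>z by blast
qed

end

section \<open>The cubical grid\<close>

text \<open>A cell of the grid is coded by its centre \<open>c\<close>: it is a point in the directions where \<open>c\<close> is
  even and an interval of length two in those where \<open>c\<close> is odd.\<close>

definition gcell :: "(nat \<Rightarrow> int) \<Rightarrow> (nat \<Rightarrow> real) set" where
  "gcell c = {x. \<forall>i. if even (c i) then x i = of_int (c i) else \<bar>x i - of_int (c i)\<bar> \<le> 1}"

definition face :: "(nat \<Rightarrow> int) \<Rightarrow> (nat \<Rightarrow> int) \<Rightarrow> bool" where
  "face b c \<longleftrightarrow> (\<forall>i. if even (c i) then b i = c i else \<bar>b i - c i\<bar> \<le> 1)"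

text \<open>The directions in which the cell extends; their number is its dimension.\<close>

definition odds :: "(nat \<Rightarrow> int) \<Rightarrow> nat set" where
  "odds c = {i. odd (c i)}"

definition bd :: "(nat \<Rightarrow> int) \<Rightarrow> (nat \<Rightarrow> real) set" where
  "bd c = {x \<in> gcell c. \<exists>i\<in>odds c. \<bar>x i - of_int (c i)\<bar> = 1}"

text \<open>The cell with \<open>x\<close> in its relative interior, the usual carrier of a point in
  a complex.\<close>

definition carrier_cell :: "(nat \<Rightarrow> real) \<Rightarrow> nat \<Rightarrow> int" where
  "carrier_cell x i = (if x i = of_int (2 * \<lfloor>x i / 2\<rfloor>) then 2 * \<lfloor>x i / 2\<rfloor> else 2 * \<lfloor>x i / 2\<rfloor> + 1)"

lemma gcellD: "x \<in> gcell c \<Longrightarrow> even (c i) \<Longrightarrow> x i = of_int (c i)"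
  "x \<in> gcell c \<Longrightarrow> \<bar>x i - of_int (c i)\<bar> \<le> 1"
  unfolding gcell_def by (auto split: if_splits) (metis abs_zero diff_self zero_le_one)

lemma carrier_cell:
  "even (carrier_cell x i) \<Longrightarrow> x i = of_int (carrier_cell x i)"
  "\<bar>x i - of_int (carrier_cell x i)\<bar> < 1"
proof -
  have "of_int \<lfloor>x i / 2\<rfloor> \<le> x i / 2" "x i / 2 < of_int \<lfloor>x i / 2\<rfloor> + 1"
    by linarith+
  then have *: "of_int (2 * \<lfloor>x i / 2\<rfloor>) \<le> x i" "x i < of_int (2 * \<lfloor>x i / 2\<rfloor>) + 2"
    unfolding of_int_mult of_int_numeral by linarith+
  show "even (carrier_cell x i) \<Longrightarrow> x i = of_int (carrier_cell x i)"
    by (auto simp: carrier_cell_def split: if_splits)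
  show "\<bar>x i - of_int (carrier_cell x i)\<bar> < 1"
    using * by (auto simp: carrier_cell_def)
qed

lemma in_carrier_cell: "x \<in> gcell (carrier_cell x)"
  using carrier_cell[of x] by (auto simp: gcell_def intro: less_imp_le)

lemma int_eq_of_real_less: "\<bar>of_int a - of_int b :: real\<bar> < 1 \<Longrightarrow> a = b"
  by linarith

lemma carrier_cell_face:
  assumes "x \<in> gcell c"
  shows "face (carrier_cell x) c"
  unfolding face_def
proof
  fix i
  let ?b = "carrier_cell x i"
  show "if even (c i) then ?b = c i else \<bar>?b - c i\<bar> \<le> 1"
  proof (cases "even (c i)")
    case True
    then have "x i = of_int (c i)" using gcellD(1)[OF assms] by simp
    then have "\<bar>of_int (c i) - of_int ?b :: real\<bar> < 1" using carrier_cell(2)[of x i] by simp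
    then show ?thesis using int_eq_of_real_less True by auto
  next
    case False
    have "\<bar>of_int ?b - of_int (c i)\<bar> < (2 :: real)"
      using carrier_cell(2)[of x i] gcellD(2)[OF assms, of i] by linarith
    then have "\<bar>?b - c i\<bar> < 2" by linarith
    then show ?thesis using False by auto
  qed
qed

lemma face_cases: "face b c \<Longrightarrow> b i = c i \<or> (odd (c i) \<and> even (b i) \<and> \<bar>b i - c i\<bar> = 1)"
proof -
  assume f: "face b c"
  show ?thesis
  proof (cases "even (c i)")
    case True then show ?thesis using f by (auto simp: face_def)
  next
    case False
    then have "\<bar>b i - c i\<bar> \<le> 1" using f by (auto simp: face_def split: if_splits)
    then have "b i = c i - 1 \<or> b i = c i \<or> b i = c i + 1" by linarith
    then show ?thesis using False by auto
  qed
qed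

lemma face_gcell: "face b c \<Longrightarrow> gcell b \<subseteq> gcell c"
proof
  fix x assume f: "face b c" and x: "x \<in> gcell b"
  have "if even (c i) then x i = of_int (c i) else \<bar>x i - of_int (c i)\<bar> \<le> 1" for i
    using face_cases[OF f, of i]
  proof
    assume "b i = c i"
    then show ?thesis using gcellD(1)[OF x, of i] gcellD(2)[OF x, of i] by simp
  next
    assume *: "odd (c i) \<and> even (b i) \<and> \<bar>b i - c i\<bar> = 1"
    then have "x i = of_int (b i)" using gcellD(1)[OF x] by simp
    moreover have "\<bar>of_int (b i) - of_int (c i) :: real\<bar> = 1" using * by linarith
    ultimately show ?thesis using * by simp
  qed
  then show "x \<in> gcell c" by (simp add: gcell_def)
qed

lemma face_bd: "face b c \<Longrightarrow> b \<noteq> c \<Longrightarrow> gcell b \<subseteq> bd c"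
proof
  fix x assume f: "face b c" "b \<noteq> c" and x: "x \<in> gcell b"
  obtain i where "b i \<noteq> c i" using f(2) by auto
  then have *: "odd (c i) \<and> even (b i) \<and> \<bar>b i - c i\<bar> = 1" using face_cases[OF f(1), of i] by auto
  then have "x i = of_int (b i)" using gcellD(1)[OF x] by simp
  moreover have "\<bar>of_int (b i) - of_int (c i) :: real\<bar> = 1" using * by linarith
  ultimately show "x \<in> bd c" using * face_gcell[OF f(1)] x by (auto simp: bd_def odds_def intro!: bexI[of _ i])
qed

lemma bd_carrier: "x \<in> bd c \<Longrightarrow> carrier_cell x \<noteq> c"
proof
  assume x: "x \<in> bd c" and c: "carrier_cell x = c"
  obtain i where "\<bar>x i - of_int (c i)\<bar> = 1" using x by (auto simp: bd_def)
  then show False using carrier_cell(2)[of x i] c by simp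
qed

lemma not_bd_carrier:
  assumes "x \<in> gcell c" "x \<notin> bd c"
  shows "carrier_cell x = c"
proof (rule ccontr)
  assume "carrier_cell x \<noteq> c"
  then have "gcell (carrier_cell x) \<subseteq> bd c" using carrier_cell_face[OF assms(1)] by (rule face_bd[rotated])
  then show False using in_carrier_cell assms by blast
qed

text \<open>The carrier of a boundary point is a proper face containing it. Conditions on boundary
  values can therefore be imposed face by face.\<close>

lemma bd_eq: "bd c = (\<Union>b\<in>{b. face b c \<and> b \<noteq> c}. gcell b)"
proof (intro subset_antisym subsetI)
  fix x assume x: "x \<in> bd c"
  then have "face (carrier_cell x) c" using carrier_cell_face by (auto simp: bd_def)
  then show "x \<in> (\<Union>b\<in>{b. face b c \<and> b \<noteq> c}. gcell b)" using bd_carrier[OF x] in_carrier_cell by blast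
qed (use face_bd in blast)

lemma face_odds: "face b c \<Longrightarrow> b \<noteq> c \<Longrightarrow> odds b \<subset> odds c"
proof -
  assume f: "face b c" "b \<noteq> c"
  obtain i where "b i \<noteq> c i" using f(2) by auto
  then have "i \<in> odds c" "i \<notin> odds b" using face_cases[OF f(1), of i] by (auto simp: odds_def)
  moreover have "odds b \<subseteq> odds c" using face_cases[OF f(1)] by (force simp: odds_def)
  ultimately show ?thesis by blast
qed

lemma compact_gcell: "compact (gcell c)"
proof -
  \<comment> \<open>\<open>c i mod 2\<close> is the half-width of the cell in direction
    \<open>i\<close>, so both parities become intervals of one form.\<close>
  have "gcell c = {x. \<forall>i. of_int (c i) - of_int (c i mod 2) \<le> x i \<and> x i \<le> of_int (c i) + of_int (c i mod 2)}"
    unfolding gcell_def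
  proof (intro Collect_cong all_cong1)
    fix x :: "nat \<Rightarrow> real" and i
    show "(if even (c i) then x i = of_int (c i) else \<bar>x i - of_int (c i)\<bar> \<le> 1) =
      (of_int (c i) - of_int (c i mod 2) \<le> x i \<and> x i \<le> of_int (c i) + of_int (c i mod 2))"
      by (cases "even (c i)") (auto simp: odd_iff_mod_2_eq_one abs_le_iff)
  qed
  then show ?thesis by (simp only: compact_box)
qed

lemma closed_gcell: "closed (gcell c)"
  by (rule compact_imp_closed[OF compact_gcell])

lemma compact_bd:
  assumes "finite (odds c)"
  shows "compact (bd c)"
proof -
  have "bd c = gcell c \<inter> (\<Union>i\<in>odds c. {x. \<bar>x i - of_int (c i)\<bar> = 1})" by (auto simp: bd_def)
  moreover have "closed {x :: nat \<Rightarrow> real. \<bar>x i - of_int (c i)\<bar> = 1}" for i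
    by (intro closed_Collect_eq continuous_intros)
  ultimately show ?thesis
    using assms compact_gcell by (simp add: closed_UN compact_Int_closed)
qed

section \<open>Cells as cones, and extension of maps over them\<close>

definition cone_point :: "(nat \<Rightarrow> int) \<Rightarrow> real \<times> (nat \<Rightarrow> real) \<Rightarrow> nat \<Rightarrow> real" where
  "cone_point c = (\<lambda>(t, b) i. of_int (c i) + (1 - t) * (b i - of_int (c i)))"

lemma cone_point_in:
  assumes "t \<in> {0..1}" "b \<in> gcell c"
  shows "cone_point c (t, b) \<in> gcell c"
proof -
  have "\<bar>(1 - t) * (b i - of_int (c i))\<bar> \<le> 1" for i
    unfolding abs_mult using gcellD(2)[OF assms(2), of i] assms(1) by (intro mult_le_one) auto
  then show ?thesis using gcellD(1)[OF assms(2)] by (auto simp: gcell_def cone_point_def)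
qed

text \<open>Radial projection from the centre in the maximum norm; \<open>r\<close> is the distance
  of \<open>x\<close> from the centre in that norm.\<close>

lemma cone_point_surj:
  assumes fin: "finite (odds c)" "odds c \<noteq> {}" and x: "x \<in> gcell c"
  shows "\<exists>t\<in>{0..1}. \<exists>b\<in>bd c. cone_point c (t, b) = x"
proof -
  define r where "r = Max ((\<lambda>i. \<bar>x i - of_int (c i)\<bar>) ` odds c)"
  have "r \<in> (\<lambda>i. \<bar>x i - of_int (c i)\<bar>) ` odds c" unfolding r_def using fin by (intro Max_in) auto
  then obtain j where j: "j \<in> odds c" "r = \<bar>x j - of_int (c j)\<bar>" by auto
  have rle: "\<bar>x i - of_int (c i)\<bar> \<le> r" for i
  proof (cases "i \<in> odds c")
    case True then show ?thesis unfolding r_def using fin by (intro Max_ge) auto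
  next
    case False then show ?thesis using gcellD(1)[OF x, of i] j by (auto simp: odds_def)
  qed
  have r1: "r \<le> 1" using j gcellD(2)[OF x, of j] by simp
  show ?thesis
  proof (cases "r = 0")
    case True
    then have xc: "x i = of_int (c i)" for i using rle[of i] by simp
    \<comment> \<open>At the apex any boundary point serves with t = 1; the odd direction
      \<open>j\<close> provides one.\<close>
    let ?b = "\<lambda>i. of_int (c i) + (if i = j then 1 else 0) :: real"
    have "?b \<in> bd c" using j(1) by (auto simp: bd_def gcell_def odds_def intro!: bexI[of _ j])
    moreover have "cone_point c (1, ?b) = x" using xc by (auto simp: cone_point_def)
    ultimately show ?thesis by (intro bexI[of _ 1] bexI[of _ ?b]) auto
  next
    case False
    then have r0: "0 < r" using j by auto
    let ?b = "\<lambda>i. of_int (c i) + (x i - of_int (c i)) / r"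
    have "\<bar>(x i - of_int (c i)) / r\<bar> \<le> 1" for i using rle[of i] r0 by (simp add: field_simps)
    moreover have "\<bar>(x j - of_int (c j)) / r\<bar> = 1" using j r0 by simp
    ultimately have "?b \<in> bd c"
      using j(1) gcellD(1)[OF x] by (auto simp: bd_def gcell_def intro!: bexI[of _ j])
    moreover have "cone_point c (1 - r, ?b) = x" using r0 by (auto simp: cone_point_def)
    ultimately show ?thesis using r0 r1 by (intro bexI[of _ "1 - r"] bexI[of _ ?b]) auto
  qed
qed

lemma cone_point_inj:
  assumes "b \<in> bd c" "b' \<in> bd c" "t \<in> {0..1}" "t' \<in> {0..1}" and eq: "cone_point c (t, b) = cone_point c (t', b')"
  shows "t = t' \<and> (t = 1 \<or> b = b')"
proof -
  have e: "(1 - t) * (b i - of_int (c i)) = (1 - t') * (b' i - of_int (c i))" for i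
    using fun_cong[OF eq, of i] by (simp add: cone_point_def)
  have le: "1 - s \<le> 1 - s'" if "u \<in> bd c" "u' \<in> bd c" "s \<in> {0..1}" "s' \<in> {0..1}"
    "\<And>i. (1 - s) * (u i - of_int (c i)) = (1 - s') * (u' i - of_int (c i))" for s s' u u'
  proof -
    from that(1) obtain i where i: "\<bar>u i - of_int (c i)\<bar> = 1" by (auto simp: bd_def)
    have "1 - s = \<bar>(1 - s) * (u i - of_int (c i))\<bar>" using i that(3) by (simp add: abs_mult)
    also have "\<dots> = (1 - s') * \<bar>u' i - of_int (c i)\<bar>" using that(4,5) by (simp add: abs_mult)
    also have "\<dots> \<le> (1 - s') * 1"
      using that(2,4) gcellD(2)[of u' c i] by (intro mult_left_mono) (auto simp: bd_def)
    finally show ?thesis by simp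
  qed
  have "t = t'" using le[OF assms(1-4) e] le[OF assms(2,1,4,3) e[symmetric]] by simp
  moreover have "b = b'" if "t \<noteq> 1"
    using e that \<open>t = t'\<close> by (auto simp: fun_eq_iff)
  ultimately show ?thesis by blast
qed

text \<open>The cell is the quotient of the compact cylinder over its boundary that collapses time
  1, where \<open>K\<close> is constant. The image is stated exactly, so that a carrier containing
  the null-homotopy also contains the extension.\<close>

lemma cone_extend:
  assumes fin: "finite (odds c)" "odds c \<noteq> {}"
    and K: "continuous_map (prod_topology \<I> (top_of_set (bd c))) Y (\<lambda>(t, x). K t x)"
    and K1: "\<And>x x'. x \<in> bd c \<Longrightarrow> x' \<in> bd c \<Longrightarrow> K 1 x = K 1 x'"
  shows "\<exists>F. continuous_map (top_of_set (gcell c)) Y F \<and> (\<forall>x\<in>bd c. F x = K 0 x) \<and>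
     F ` gcell c = (\<lambda>(t, x). K t x) ` ({0..1} \<times> bd c)"
proof -
  let ?S = "prod_topology \<I> (top_of_set (bd c))"
  have bg: "bd c \<subseteq> gcell c" by (auto simp: bd_def)
  have im: "cone_point c ` ({0..1} \<times> bd c) = gcell c"
  proof
    show "cone_point c ` ({0..1} \<times> bd c) \<subseteq> gcell c"
    proof clarify
      fix t :: real and b assume "t \<in> {0..1}" "b \<in> bd c"
      then show "cone_point c (t, b) \<in> gcell c" using bg by (intro cone_point_in) auto
    qed
    show "gcell c \<subseteq> cone_point c ` ({0..1} \<times> bd c)"
    proof
      fix x assume "x \<in> gcell c"
      from cone_point_surj[OF fin this] obtain t b where "t \<in> {0..1}" "b \<in> bd c" "cone_point c (t, b) = x"
        by blast
      then show "x \<in> cone_point c ` ({0..1} \<times> bd c)" by (intro image_eqI[of _ _ "(t, b)"]) auto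
    qed
  qed
  have cont: "continuous_map ?S (top_of_set (gcell c)) (cone_point c)"
    unfolding prod_topology_subtopology_eu continuous_map_subtopology_eu
  proof
    show "continuous_on ({0..1} \<times> bd c) (cone_point c)"
      unfolding cone_point_def case_prod_unfold
      by (intro continuous_intros continuous_on_coordinatewise_then_product)
    show "cone_point c \<in> {0..1} \<times> bd c \<rightarrow> gcell c" using im by (simp add: image_subset_iff_funcset[symmetric])
  qed
  have q: "quotient_map ?S (top_of_set (gcell c)) (cone_point c)"
  proof (rule continuous_closed_imp_quotient_map[OF cont])
    show "closed_map ?S (top_of_set (gcell c)) (cone_point c)"
      by (intro continuous_imp_closed_map_gen[OF _ _ cont] Hausdorff_imp_kc_space)
        (auto simp: compact_space_subtopology compact_Times compact_bd fin Hausdorff_space_subtopology)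
  qed (use im in auto)
  obtain F where F: "continuous_map (top_of_set (gcell c)) Y F"
      "F ` topspace (top_of_set (gcell c)) = (\<lambda>(t, x). K t x) ` topspace ?S"
      "\<And>p. p \<in> topspace ?S \<Longrightarrow> F (cone_point c p) = (\<lambda>(t, x). K t x) p"
  proof (rule quotient_map_lift_exists[OF q K])
    fix p p' assume "p \<in> topspace ?S" "p' \<in> topspace ?S" "cone_point c p = cone_point c p'"
    then show "(case p of (t, x) \<Rightarrow> K t x) = (case p' of (t, x) \<Rightarrow> K t x)"
      using cone_point_inj[of "snd p" c "snd p'" "fst p" "fst p'"] K1[of "snd p" "snd p'"]
      by (cases p; cases p') auto
  qed (use that in auto)
  have "F x = K 0 x" if "x \<in> bd c" for x
  proof -
    have "cone_point c (0, x) = x" by (auto simp: cone_point_def)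
    then show ?thesis using F(3)[of "(0, x)"] that by simp
  qed
  then show ?thesis using F(1,2) by auto
qed

text \<open>Induction on the number of cells not yet covered. A missing cell of least dimension has
  all its proper faces in \<open>L\<close> and meets the covered part only in its boundary, so a
  filling within the carrier \<open>U c\<close> can be glued on.\<close>

lemma extend_cells:
  assumes "finite K" and fin: "\<And>c. c \<in> K \<Longrightarrow> finite (odds c)"
    and Kf: "\<And>b c. c \<in> K \<Longrightarrow> face b c \<Longrightarrow> b \<in> K"
    and fill: "\<And>c F. c \<in> K - L \<Longrightarrow> continuous_map (top_of_set (bd c)) Y F \<Longrightarrow>
        (\<And>b. face b c \<Longrightarrow> b \<noteq> c \<Longrightarrow> F ` gcell b \<subseteq> U b) \<Longrightarrow>
        \<exists>F'. continuous_map (top_of_set (gcell c)) Y F' \<and> (\<forall>x\<in>bd c. F' x = F x) \<and> F' ` gcell c \<subseteq> U c"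
    and L: "L \<subseteq> K" "\<And>b c. c \<in> L \<Longrightarrow> face b c \<Longrightarrow> b \<in> L"
    and F0: "continuous_map (top_of_set (\<Union>c\<in>L. gcell c)) Y F0" "\<And>c. c \<in> L \<Longrightarrow> F0 ` gcell c \<subseteq> U c"
  shows "\<exists>F. continuous_map (top_of_set (\<Union>c\<in>K. gcell c)) Y F \<and> (\<forall>c\<in>L. \<forall>x\<in>gcell c. F x = F0 x) \<and>
     (\<forall>c\<in>K. F ` gcell c \<subseteq> U c)"
  using L F0 fill
proof (induction "card (K - L)" arbitrary: L F0)
  case 0
  then have "K = L" using \<open>finite K\<close> by auto
  then show ?case using 0 by blast
next
  case (Suc k)
  have "K - L \<noteq> {}" using Suc.hyps(2) by (metis card.empty nat.distinct(1))
  then obtain c where c: "c \<in> K - L" and least: "\<And>b. b \<in> K - L \<Longrightarrow> card (odds c) \<le> card (odds b)"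
    using ex_has_least_nat[of "\<lambda>c. c \<in> K - L" _ "\<lambda>c. card (odds c)"] by blast
  have faces: "b \<in> L" if "face b c" "b \<noteq> c" for b
  proof (rule ccontr)
    assume "b \<notin> L"
    then have "card (odds c) \<le> card (odds b)" using Kf c that least by auto
    then show False using psubset_card_mono[OF fin face_odds[OF that]] c by simp
  qed
  let ?C = "\<lambda>L. \<Union>c\<in>L. gcell c"
  have bdL: "bd c \<subseteq> ?C L" using faces unfolding bd_eq by blast
  \<comment> \<open>A point of \<open>c\<close> off its boundary has carrier \<open>c\<close>. If it
    lay in a cell of \<open>L\<close>, then \<open>c\<close> would be a face of that cell and so
    belong to \<open>L\<close>.\<close>
  have meet: "?C L \<inter> gcell c \<subseteq> bd c"
  proof
    fix x assume "x \<in> ?C L \<inter> gcell c"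
    then obtain b where b: "b \<in> L" "x \<in> gcell b" "x \<in> gcell c" by auto
    show "x \<in> bd c"
    proof (rule ccontr)
      assume "x \<notin> bd c"
      then have "carrier_cell x = c" using not_bd_carrier b by blast
      then have "c \<in> L" using carrier_cell_face[OF b(2)] Suc.prems(2) b(1) by blast
      then show False using c by blast
    qed
  qed
  have F0bd: "continuous_map (top_of_set (bd c)) Y F0"
    using continuous_map_from_subtopology[OF Suc.prems(3), of "bd c"] bdL
    by (simp add: subtopology_subtopology Int_absorb1)
  have "\<exists>F'. continuous_map (top_of_set (gcell c)) Y F' \<and> (\<forall>x\<in>bd c. F' x = F0 x) \<and> F' ` gcell c \<subseteq> U c"
    by (rule Suc.prems(5)[OF c F0bd]) (rule Suc.prems(4), rule faces)
  then obtain F1 where F1: "continuous_map (top_of_set (gcell c)) Y F1" "\<And>x. x \<in> bd c \<Longrightarrow> F1 x = F0 x"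
    "F1 ` gcell c \<subseteq> U c"
    by blast
  define F2 where "F2 = (\<lambda>x. if x \<in> gcell c then F1 x else F0 x)"
  have F2L: "F2 x = F0 x" if "b \<in> L" "x \<in> gcell b" for b x
    using that meet F1(2) by (auto simp: F2_def)
  have LK: "insert c L \<subseteq> K" using Suc.prems(1) c by blast
  have clL: "closed (?C L)" using Suc.prems(1) \<open>finite K\<close> closed_gcell by (meson closed_UN finite_subset)
  have F2c: "continuous_map (top_of_set (?C (insert c L))) Y F2"
  proof (rule pasting_lemma_closed[of "{True, False}" _ "\<lambda>j. if j then gcell c else ?C L" _ "\<lambda>j. if j then F1 else F0"])
    show "closedin (top_of_set (?C (insert c L))) (if j then gcell c else ?C L)" for j
      using closed_gcell clL by (auto intro: closed_subset)
    show "continuous_map (subtopology (top_of_set (?C (insert c L))) (if j then gcell c else ?C L)) Y (if j then F1 else F0)" for j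
    proof -
      have "?C (insert c L) \<inter> gcell c = gcell c" "?C (insert c L) \<inter> ?C L = ?C L" by auto
      then show ?thesis using F1(1) Suc.prems(3) by (simp add: subtopology_subtopology)
    qed
    show "(if i then F1 else F0) x = (if j then F1 else F0) x"
      if "x \<in> topspace (top_of_set (?C (insert c L))) \<inter> (if i then gcell c else ?C L) \<inter> (if j then gcell c else ?C L)" for i j x
      using that meet F1(2) by (cases i; cases j) auto
    show "\<exists>j. j \<in> {True, False} \<and> x \<in> (if j then gcell c else ?C L) \<and> F2 x = (if j then F1 else F0) x"
      if "x \<in> topspace (top_of_set (?C (insert c L)))" for x
      using that by (cases "x \<in> gcell c") (auto simp: F2_def)
  qed auto
  have "\<exists>F. continuous_map (top_of_set (?C K)) Y F \<and> (\<forall>c'\<in>insert c L. \<forall>x\<in>gcell c'. F x = F2 x) \<and>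
      (\<forall>c\<in>K. F ` gcell c \<subseteq> U c)"
  proof (rule Suc.hyps(1)[OF _ LK _ F2c])
    show "k = card (K - insert c L)"
      using Suc.hyps(2) c \<open>finite K\<close> by (simp add: Diff_insert[of K c])
    show "b \<in> insert c L" if "a \<in> insert c L" "face b a" for a b
      using that faces Suc.prems(2) by (cases "b = a") auto
    show "F2 ` gcell b \<subseteq> U b" if b: "b \<in> insert c L" for b
    proof (cases "b = c")
      case True
      then show ?thesis using F1(3) by (auto simp: F2_def)
    next
      case False
      then have "b \<in> L" using b by simp
      then show ?thesis using F2L Suc.prems(4)[of b] by (simp add: image_subset_iff)
    qed
    show "\<exists>F'. continuous_map (top_of_set (gcell e)) Y F' \<and> (\<forall>x\<in>bd e. F' x = F x) \<and> F' ` gcell e \<subseteq> U e"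
      if "e \<in> K - insert c L" "continuous_map (top_of_set (bd e)) Y F"
        "\<And>b. face b e \<Longrightarrow> b \<noteq> e \<Longrightarrow> F ` gcell b \<subseteq> U b" for e F
      using that(1) by (intro Suc.prems(5) that(2,3)) auto
  qed
  then obtain F where F: "continuous_map (top_of_set (?C K)) Y F"
     "\<forall>c'\<in>insert c L. \<forall>x\<in>gcell c'. F x = F2 x" "\<forall>c\<in>K. F ` gcell c \<subseteq> U c"
    by blast
  then show ?case using F2L by (intro exI[of _ F]) auto
qed

text \<open>The positivity condition is that every odd direction of \<open>b\<close> is closer to its centre than every
  even direction is far from its midpoint; cells of equal dimension cannot satisfy it simultaneously.\<close>

definition wt :: "nat \<Rightarrow> (nat \<Rightarrow> int) \<Rightarrow> (nat \<Rightarrow> real) \<Rightarrow> real" where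
  "wt m b x = (\<Prod>i<m. max 0 (1 - \<bar>x i - of_int (b i)\<bar>)) *
     (\<Prod>i<m. \<Prod>j<m. if even (b i) \<and> odd (b j)
        then max 0 (1 - \<bar>x i - of_int (b i)\<bar> - \<bar>x j - of_int (b j)\<bar>) else 1)"

lemma continuous_on_wt: "continuous_on S (wt m b)"
proof -
  have "continuous_on S (\<lambda>x. if even (b i) \<and> odd (b j)
        then max 0 (1 - \<bar>x i - of_int (b i)\<bar> - \<bar>x j - of_int (b j)\<bar>) else 1)" for i j
    by (cases "even (b i) \<and> odd (b j)") (auto intro!: continuous_intros)
  then show ?thesis unfolding wt_def by (intro continuous_intros)
qed

lemma wt_nonneg: "0 \<le> wt m b x"
  unfolding wt_def by (intro mult_nonneg_nonneg prod_nonneg) auto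

lemma wt_nonzero:
  assumes "wt m b x \<noteq> 0"
  shows "i < m \<Longrightarrow> \<bar>x i - of_int (b i)\<bar> < 1"
    and "i < m \<Longrightarrow> j < m \<Longrightarrow> even (b i) \<Longrightarrow> odd (b j) \<Longrightarrow> \<bar>x i - of_int (b i)\<bar> + \<bar>x j - of_int (b j)\<bar> < 1"
proof -
  have 1: "\<forall>i<m. max 0 (1 - \<bar>x i - of_int (b i)\<bar>) \<noteq> 0"
    and 2: "\<forall>i<m. \<forall>j<m. (if even (b i) \<and> odd (b j)
        then max 0 (1 - \<bar>x i - of_int (b i)\<bar> - \<bar>x j - of_int (b j)\<bar>) else 1) \<noteq> 0"
    using assms unfolding wt_def by (simp_all add: prod_zero_iff Bex_def)
  show "\<bar>x i - of_int (b i)\<bar> < 1" if "i < m"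
    using 1[rule_format, OF that] by (auto simp: max_def split: if_splits)
  show "\<bar>x i - of_int (b i)\<bar> + \<bar>x j - of_int (b j)\<bar> < 1" if "i < m" "j < m" "even (b i)" "odd (b j)"
    using 2[rule_format, OF that(1,2)] that(3,4) by (auto simp: max_def split: if_splits)
qed

text \<open>In the even directions of its carrier a point has distance 0 from the centre, in the odd
  ones distance less than 1. Hence the total weight does not vanish and can be used to
  normalise.\<close>

lemma wt_carrier: "0 < wt m (carrier_cell x) x"
proof -
  have "0 < 1 - \<bar>x i - of_int (carrier_cell x i)\<bar>" for i using carrier_cell(2)[of x i] by simp
  moreover have "0 < 1 - \<bar>x i - of_int (carrier_cell x i)\<bar> - \<bar>x j - of_int (carrier_cell x j)\<bar>"
    if "even (carrier_cell x i)" for i j using carrier_cell(1)[OF that] carrier_cell(2)[of x j] by simp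
  ultimately show ?thesis
    unfolding wt_def by (intro mult_pos_pos prod_pos) (auto simp: less_max_iff_disj)
qed

text \<open>Where \<open>c\<close> is even, \<open>x i\<close> is an integer less than 1 away from
  \<open>b i\<close>, which forces equality. So the simplicial model at a point of \<open>c\<close>
  uses only faces of \<open>c\<close> and stays in a carrier attached to \<open>c\<close>.\<close>

lemma wt_face:
  assumes "wt m b x \<noteq> 0" "x \<in> gcell c" "\<And>i. m \<le> i \<Longrightarrow> b i = 0 \<and> c i = 0"
  shows "face b c"
  unfolding face_def
proof
  fix i
  show "if even (c i) then b i = c i else \<bar>b i - c i\<bar> \<le> 1"
  proof (cases "i < m")
    case True
    have b: "\<bar>x i - of_int (b i)\<bar> < 1" using wt_nonzero(1)[OF assms(1) True] .
    show ?thesis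
    proof (cases "even (c i)")
      case True
      then have "\<bar>of_int (c i) - of_int (b i) :: real\<bar> < 1" using b gcellD(1)[OF assms(2)] by simp
      then show ?thesis using int_eq_of_real_less True by auto
    next
      case False
      have "\<bar>of_int (b i) - of_int (c i)\<bar> < (2 :: real)" using b gcellD(2)[OF assms(2), of i] by linarith
      then have "\<bar>b i - c i\<bar> < 2" by linarith
      then show ?thesis using False by auto
    qed
  qed (use assms(3)[of i] in auto)
qed

text \<open>If the sets of odd directions differ, equal size gives a direction \<open>i\<close> odd
  only for \<open>b\<close> and a direction \<open>j\<close> odd only for \<open>c\<close>. The four
  distances from \<open>x\<close> in these directions sum to less than 2 by positivity, and to at
  least 2 because centres of different parity are at least 1 apart. So nonzero weights select at
  most one cell per dimension.\<close>

lemma wt_unique: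
  assumes b: "wt m b x \<noteq> 0" and c: "wt m c x \<noteq> 0" and z: "\<And>i. m \<le> i \<Longrightarrow> b i = 0 \<and> c i = 0"
    and card: "card (odds b) = card (odds c)"
  shows "b = c"
proof -
  have sub: "odds b \<subseteq> {..<m}" "odds c \<subseteq> {..<m}" using z by (force simp: odds_def not_less[symmetric])+
  then have fin: "finite (odds b)" "finite (odds c)" using finite_subset by blast+
  have far: "1 \<le> \<bar>y - of_int p\<bar> + \<bar>y - of_int q\<bar>" if "odd p \<noteq> odd q" for y :: real and p q :: int
  proof -
    have "p \<noteq> q" using that by auto
    then have "1 \<le> \<bar>p - q\<bar>" by linarith
    then have "1 \<le> \<bar>of_int p - of_int q :: real\<bar>" by linarith
    then show ?thesis by linarith
  qed
  have "odds b = odds c"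
  proof (rule ccontr)
    assume ne: "odds b \<noteq> odds c"
    obtain i where i: "i \<in> odds b" "i \<notin> odds c"
      using ne card card_subset_eq[OF fin(2)] by blast
    obtain j where j: "j \<in> odds c" "j \<notin> odds b"
      using ne card card_subset_eq[OF fin(1)] by (metis subsetI)
    have ij: "i < m" "j < m" using i j sub by auto
    have "\<bar>x j - of_int (b j)\<bar> + \<bar>x i - of_int (b i)\<bar> < 1"
      using wt_nonzero(2)[OF b ij(2,1)] i j by (auto simp: odds_def)
    moreover have "\<bar>x i - of_int (c i)\<bar> + \<bar>x j - of_int (c j)\<bar> < 1"
      using wt_nonzero(2)[OF c ij] i j by (auto simp: odds_def)
    moreover have "1 \<le> \<bar>x i - of_int (b i)\<bar> + \<bar>x i - of_int (c i)\<bar>"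
      "1 \<le> \<bar>x j - of_int (b j)\<bar> + \<bar>x j - of_int (c j)\<bar>"
      using i j by (auto intro!: far simp: odds_def)
    ultimately show False by linarith
  qed
  then have par: "even (b i) \<longleftrightarrow> even (c i)" for i by (auto simp: odds_def set_eq_iff)
  show "b = c"
  proof
    fix i
    show "b i = c i"
    proof (cases "i < m")
      case True
      have "\<bar>of_int (b i) - of_int (c i) :: real\<bar> < 2"
        using wt_nonzero(1)[OF b True] wt_nonzero(1)[OF c True] by linarith
      then have "\<bar>b i - c i\<bar> < 2" by linarith
      then have "b i = c i - 1 \<or> b i = c i \<or> b i = c i + 1" by linarith
      then show ?thesis using par[of i] by auto
    qed (use z in auto)
  qed
qed

section \<open>Carriers adapted to a family of measures\<close>

locale nice_barycenters = barycenters +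
  assumes Hausdorff: "Hausdorff_space X"
    and contractible_at: "\<And>z. z \<in> topspace X \<Longrightarrow> locally_contractible_at X z"
begin

definition mass :: "'a set \<Rightarrow> ('a \<Rightarrow> real) \<Rightarrow> real" where
  "mass A \<mu> = (\<Sum>x | x \<in> A \<and> \<mu> x \<noteq> 0. \<mu> x)"

lemma mass_split:
  assumes "\<mu> \<in> topspace Y"
  shows "mass A \<mu> = 1 - mass (- A) \<mu>"
proof -
  have "(\<Sum>x | \<mu> x \<noteq> 0. \<mu> x) = mass A \<mu> + mass (- A) \<mu>"
    unfolding mass_def using Y_D(2)[OF assms]
    by (subst sum.union_disjoint[symmetric]) (auto intro!: sum.cong)
  then show ?thesis using Y_D(5)[OF assms] by simp
qed

text \<open>The mass of a set is in general not continuous in the measure; the integral of a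
  continuous \<phi> is, and it bounds the mass from below.\<close>

lemma intg_le_mass:
  assumes \<mu>: "\<mu> \<in> topspace Y" and \<phi>: "\<And>x. x \<in> topspace X \<Longrightarrow> 0 \<le> \<phi> x \<and> \<phi> x \<le> 1"
  shows "intg \<phi> \<mu> \<le> mass (support_set \<phi>) \<mu>"
proof -
  have "intg \<phi> \<mu> = (\<Sum>x | x \<in> support_set \<phi> \<and> \<mu> x \<noteq> 0. \<mu> x * \<phi> x)"
    unfolding intg_def using Y_D(2,3)[OF \<mu>] \<phi>
    by (intro sum.mono_neutral_right) (auto simp: support_set_def order_less_le)
  also have "\<dots> \<le> mass (support_set \<phi>) \<mu>"
    unfolding mass_def using Y_D(1)[OF \<mu>] \<phi>
    by (intro sum_mono mult_left_le) (auto simp: support_set_def)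
  finally show ?thesis .
qed

text \<open>One level of carriers. Mass outside of some \<open>N q\<close> sits at points of weight less than \<open>\<epsilon>\<close>, of which there
  are at most \<open>n\<close>; the remaining points span the new, smaller carrier.\<close>

lemma carrier_step:
  fixes f :: "'c :: metric_space \<Rightarrow> 'a \<Rightarrow> real"
  assumes S: "compact S" and f: "continuous_map (top_of_set S) Y f"
    and N: "finite (N ` S)" "\<And>q. q \<in> S \<Longrightarrow> openin X (N q)" and r: "0 < r"
    and \<epsilon>: "0 < \<epsilon>" "real n * \<epsilon> \<le> 1"
    and m: "\<And>q q'. q \<in> S \<Longrightarrow> q' \<in> S \<Longrightarrow> dist q q' < r \<Longrightarrow> 1 - \<epsilon> < mass (N q) (f q')"
  shows "\<exists>r' \<phi> \<Omega>. 0 < r' \<and> r' \<le> r \<and> finite (\<phi> ` S) \<and> (\<forall>q\<in>S. contracts (\<phi> q) (\<Omega> q)) \<and>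
     (\<forall>q\<in>S. \<forall>q'\<in>S. dist q q' < r' \<longrightarrow> \<Omega> q \<subseteq> N q' \<and> 1 - real n * \<epsilon> < mass (support_set (\<phi> q)) (f q'))"
proof -
  have fY: "f q \<in> topspace Y" if "q \<in> S" for q
    using continuous_map_image_subset_topspace[OF f] that by auto
  have local: "\<exists>\<phi> \<Omega> \<delta>. contracts \<phi> \<Omega> \<and> 0 < \<delta> \<and> (\<forall>q\<in>S. dist p q < r \<longrightarrow> \<Omega> \<subseteq> N q) \<and>
      (\<forall>q\<in>S. dist p q < \<delta> \<longrightarrow> 1 - real n * \<epsilon> < intg \<phi> (f q))" if p: "p \<in> S" for p
  proof -
    \<comment> \<open>The intersection is open because \<open>N\<close> takes only finitely many
      values on \<open>S\<close>. It places \<Omega> inside \<open>N q\<close> for all nearby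
      \<open>q\<close>, not just for \<open>p\<close>.\<close>
    define \<Omega> where "\<Omega> = \<Inter> (N ` {q \<in> S. dist p q < r})"
    have ne: "{q \<in> S. dist p q < r} \<noteq> {}" using p r by auto
    have \<Omega>op: "openin X \<Omega>"
      unfolding \<Omega>_def using ne N by (intro openin_Inter) (auto intro: finite_subset[OF _ N(1)])
    have fp: "f p \<in> topspace Y" by (rule fY[OF p])
    let ?B = "{x. x \<in> - \<Omega> \<and> f p x \<noteq> 0}" and ?Z = "{x. x \<in> \<Omega> \<and> f p x \<noteq> 0}"
    have finB: "finite ?B" "finite ?Z" using Y_D(2)[OF fp] by (auto elim: rev_finite_subset)
    have small: "f p x < \<epsilon>" if x: "x \<in> ?B" for x
    proof -
      from x obtain q where q: "q \<in> S" "dist p q < r" "x \<notin> N q" by (auto simp: \<Omega>_def)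
      have "f p x \<le> mass (- N q) (f p)"
        unfolding mass_def using x q Y_D(1,2)[OF fp]
        by (intro member_le_sum) (auto elim: rev_finite_subset)
      also have "\<dots> < \<epsilon>" using m[of q p] q p mass_split[OF fp, of "N q"] by (simp add: dist_commute)
      finally show ?thesis .
    qed
    have cardle: "card A \<le> n" if "A \<subseteq> {x. f p x \<noteq> 0}" for A
      using card_mono[OF Y_D(2)[OF fp] that] Y_D(4)[OF fp] by simp
    have "mass (- \<Omega>) (f p) < real n * \<epsilon>"
    proof (cases "?B = {}")
      case True
      then show ?thesis unfolding mass_def using \<epsilon> n1 by (simp only: sum.empty) simp
    next
      case False
      have "mass (- \<Omega>) (f p) < real (card ?B) * \<epsilon>"
        unfolding mass_def using False finB small by (intro sum_bounded_above_strict) (auto simp: card_gt_0_iff)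
      also have "\<dots> \<le> real n * \<epsilon>" using cardle[of ?B] \<epsilon> by (intro mult_right_mono) auto
      finally show ?thesis .
    qed
    then have mZ: "1 - real n * \<epsilon> < mass \<Omega> (f p)" using mass_split[OF fp, of \<Omega>] by simp
    have "?Z \<noteq> {}"
    proof
      assume "?Z = {}"
      then have "mass \<Omega> (f p) = 0" unfolding mass_def by (simp only: sum.empty)
      then show False using mZ \<epsilon> by simp
    qed
    then obtain \<phi> where \<phi>: "contracts \<phi> \<Omega>" "\<And>z. z \<in> ?Z \<Longrightarrow> \<phi> z = 1"
      using ex_contracts[OF finB(2) _ cardle \<Omega>op _ Hausdorff contractible_at] Y_D(3)[OF fp] by auto
    have \<phi>c: "continuous_map X euclideanreal \<phi>" and \<phi>01: "\<And>x. x \<in> topspace X \<Longrightarrow> 0 \<le> \<phi> x \<and> \<phi> x \<le> 1"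
      using \<phi>(1) by (auto simp: contracts_def)
    \<comment> \<open>\<phi> is 1 at the charged points of \<Omega>, so its integral inherits the
      bound on the mass and, being continuous, keeps it near \<open>p\<close>.\<close>
    have "mass \<Omega> (f p) = (\<Sum>x\<in>?Z. f p x * \<phi> x)" unfolding mass_def using \<phi>(2) by (intro sum.cong) auto
    also have "\<dots> \<le> intg \<phi> (f p)"
      unfolding intg_def using Y_D(1-3)[OF fp] \<phi>01 by (intro sum_mono2) auto
    finally have ip: "1 - real n * \<epsilon> < intg \<phi> (f p)" using mZ by simp
    have "continuous_map (top_of_set S) euclideanreal (\<lambda>q. intg \<phi> (f q))"
      using continuous_map_compose[OF f continuous_map_intg[OF \<phi>c]] by (simp add: o_def)
    then have "openin (top_of_set S) {q \<in> topspace (top_of_set S). intg \<phi> (f q) \<in> {1 - real n * \<epsilon><..}}"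
      by (rule openin_continuous_map_preimage) simp
    then obtain \<delta> where "0 < \<delta>" "\<And>q. q \<in> S \<Longrightarrow> dist q p < \<delta> \<Longrightarrow> 1 - real n * \<epsilon> < intg \<phi> (f q)"
      unfolding openin_euclidean_subtopology_iff using p ip by auto
    then show ?thesis
      using \<phi>(1) by (intro exI[of _ \<phi>] exI[of _ \<Omega>] exI[of _ \<delta>]) (auto simp: \<Omega>_def dist_commute)
  qed
  have "\<forall>p\<in>S. \<exists>u. contracts (fst u) (fst (snd u)) \<and> 0 < snd (snd u) \<and>
      (\<forall>q\<in>S. dist p q < r \<longrightarrow> fst (snd u) \<subseteq> N q) \<and>
      (\<forall>q\<in>S. dist p q < snd (snd u) \<longrightarrow> 1 - real n * \<epsilon> < intg (fst u) (f q))"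
  proof
    fix p assume "p \<in> S"
    from local[OF this] obtain \<phi> \<Omega> \<delta> where "contracts \<phi> \<Omega>" "0 < \<delta>" "\<forall>q\<in>S. dist p q < r \<longrightarrow> \<Omega> \<subseteq> N q"
      "\<forall>q\<in>S. dist p q < \<delta> \<longrightarrow> 1 - real n * \<epsilon> < intg \<phi> (f q)" by blast
    then show "\<exists>u. contracts (fst u) (fst (snd u)) \<and> 0 < snd (snd u) \<and>
      (\<forall>q\<in>S. dist p q < r \<longrightarrow> fst (snd u) \<subseteq> N q) \<and>
      (\<forall>q\<in>S. dist p q < snd (snd u) \<longrightarrow> 1 - real n * \<epsilon> < intg (fst u) (f q))"
      by (intro exI[of _ "(\<phi>, \<Omega>, \<delta>)"]) simp
  qed
  from bchoice[OF this] obtain u where u: "\<forall>p\<in>S. contracts (fst (u p)) (fst (snd (u p))) \<and> 0 < snd (snd (u p)) \<and>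
      (\<forall>q\<in>S. dist p q < r \<longrightarrow> fst (snd (u p)) \<subseteq> N q) \<and>
      (\<forall>q\<in>S. dist p q < snd (snd (u p)) \<longrightarrow> 1 - real n * \<epsilon> < intg (fst (u p)) (f q))" ..
  define \<phi> where "\<phi> = (\<lambda>p. fst (u p))"
  define \<Omega> where "\<Omega> = (\<lambda>p. fst (snd (u p)))"
  define \<delta> where "\<delta> = (\<lambda>p. snd (snd (u p)))"
  have loc: "\<And>p. p \<in> S \<Longrightarrow> contracts (\<phi> p) (\<Omega> p)" "\<And>p. p \<in> S \<Longrightarrow> 0 < \<delta> p"
    "\<And>p q. p \<in> S \<Longrightarrow> q \<in> S \<Longrightarrow> dist p q < r \<Longrightarrow> \<Omega> p \<subseteq> N q"
    "\<And>p q. p \<in> S \<Longrightarrow> q \<in> S \<Longrightarrow> dist p q < \<delta> p \<Longrightarrow> 1 - real n * \<epsilon> < intg (\<phi> p) (f q)"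
    using u unfolding \<phi>_def \<Omega>_def \<delta>_def by blast+
  \<comment> \<open>Halving leaves room for two steps, from a chosen centre to \<open>q\<close> and
    on to \<open>q'\<close>. The centres will come from a finite subcover, which keeps the new
    family finite-valued, as the next level requires.\<close>
  define \<rho> where "\<rho> = (\<lambda>p. min (\<delta> p / 2) (r / 2))"
  have \<rho>0: "0 < \<rho> p" if "p \<in> S" for p using loc(2)[OF that] r by (simp add: \<rho>_def)
  have "S \<subseteq> (\<Union>p\<in>S. ball p (\<rho> p))" using \<rho>0 by auto
  then obtain D where D: "D \<subseteq> S" "finite D" "S \<subseteq> (\<Union>p\<in>D. ball p (\<rho> p))"
    using compactE_image[OF S, of S "\<lambda>p. ball p (\<rho> p)"] by auto
  then have "\<forall>q\<in>S. \<exists>p. p \<in> D \<and> dist p q < \<rho> p"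
    by (auto simp: subset_eq)
  from bchoice[OF this] obtain p where p: "\<And>q. q \<in> S \<Longrightarrow> p q \<in> D \<and> dist (p q) q < \<rho> (p q)" by blast
  define r' where "r' = Min (insert r (\<rho> ` D))"
  have r': "0 < r'" "r' \<le> r" "\<And>x. x \<in> D \<Longrightarrow> r' \<le> \<rho> x"
    using D \<rho>0 r by (auto simp: r'_def)
  have near: "dist (p q) q' < r \<and> dist (p q) q' < \<delta> (p q)" if "q \<in> S" "dist q q' < r'" for q q'
  proof -
    have "dist (p q) q' < \<rho> (p q) + \<rho> (p q)"
      using dist_triangle[of "p q" q' q] p[OF that(1)] r'(3) that(2) by force
    then show ?thesis by (auto simp: \<rho>_def min_def split: if_splits)
  qed
  have pS: "p q \<in> S" if "q \<in> S" for q using p[OF that] D(1) by blast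
  show ?thesis
  proof (intro exI conjI ballI impI)
    show "0 < r'" "r' \<le> r" by (rule r')+
    show "finite ((\<lambda>q. \<phi> (p q)) ` S)"
      by (rule finite_subset[OF _ finite_imageI[OF D(2), of \<phi>]]) (use p in auto)
    show "contracts (\<phi> (p q)) (\<Omega> (p q))" if "q \<in> S" for q using loc(1) pS that by blast
    fix q q' assume q: "q \<in> S" "q' \<in> S" "dist q q' < r'"
    show "\<Omega> (p q) \<subseteq> N q'" using loc(3)[OF pS[OF q(1)] q(2)] near[OF q(1,3)] by blast
    have "1 - real n * \<epsilon> < intg (\<phi> (p q)) (f q')" using loc(4)[OF pS[OF q(1)] q(2)] near[OF q(1,3)] by blast
    also have "\<dots> \<le> mass (support_set (\<phi> (p q))) (f q')"
      using loc(1)[OF pS[OF q(1)]] by (intro intg_le_mass fY[OF q(2)]) (auto simp: contracts_def)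
    finally show "1 - real n * \<epsilon> < mass (support_set (\<phi> (p q))) (f q')" .
  qed
qed

text \<open>Built from the outside inwards: one step inside \<open>N\<close> gives the top level,
  and the induction continues inside its positivity sets. Each level multiplies the tolerated loss
  by \<open>n\<close>. Inclusions are demanded between nearby parameters because a cell and its
  faces have different centres.\<close>

lemma carrier_tower:
  fixes f :: "'c :: metric_space \<Rightarrow> 'a \<Rightarrow> real"
  assumes S: "compact S" and f: "continuous_map (top_of_set S) Y f"
  shows "finite (N ` S) \<Longrightarrow> (\<And>q. q \<in> S \<Longrightarrow> openin X (N q)) \<Longrightarrow> 0 < r \<Longrightarrow> 0 < \<epsilon> \<Longrightarrow> real n ^ L * \<epsilon> \<le> 1 \<Longrightarrow>
    (\<And>q q'. q \<in> S \<Longrightarrow> q' \<in> S \<Longrightarrow> dist q q' < r \<Longrightarrow> 1 - \<epsilon> < mass (N q) (f q')) \<Longrightarrow>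
    \<exists>r' \<phi> \<Omega>. 0 < r' \<and> (\<forall>j<L. \<forall>q\<in>S. contracts (\<phi> j q) (\<Omega> j q)) \<and>
     (\<forall>q\<in>S. \<forall>q'\<in>S. dist q q' < r' \<longrightarrow>
        (\<forall>j. Suc j < L \<longrightarrow> \<Omega> j q \<subseteq> support_set (\<phi> (Suc j) q')) \<and> (\<forall>j. Suc j = L \<longrightarrow> \<Omega> j q \<subseteq> N q') \<and>
        1 - real n ^ L * \<epsilon> < mass (if L = 0 then N q else support_set (\<phi> 0 q)) (f q'))"
proof (induction L arbitrary: N r \<epsilon>)
  case 0
  then show ?case by (intro exI[of _ r]) auto
next
  case (Suc L)
  have n1': "1 \<le> real n ^ k" for k using n1 by simp
  have "real n * \<epsilon> \<le> real n ^ Suc L * \<epsilon>" using n1'[of L] Suc.prems(4) n1 by simp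
  then have "real n * \<epsilon> \<le> 1" using Suc.prems(5) by linarith
  from carrier_step[OF S f Suc.prems(1,2,3,4) this Suc.prems(6)] obtain r1 \<phi>1 \<Omega>1 where
    1: "0 < r1" "finite (\<phi>1 ` S)" "\<And>q. q \<in> S \<Longrightarrow> contracts (\<phi>1 q) (\<Omega>1 q)"
     "\<And>q q'. q \<in> S \<Longrightarrow> q' \<in> S \<Longrightarrow> dist q q' < r1 \<Longrightarrow> \<Omega>1 q \<subseteq> N q' \<and> 1 - real n * \<epsilon> < mass (support_set (\<phi>1 q)) (f q')"
    by blast
  have op: "openin X (support_set (\<phi>1 q))" if "q \<in> S" for q
  proof -
    have "continuous_map X euclideanreal (\<phi>1 q)" using 1(3)[OF that] by (simp add: contracts_def)
    from openin_continuous_map_preimage[OF this, of "{0<..}"]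
    show ?thesis by (simp add: support_set_def)
  qed
  have "\<exists>r' \<phi> \<Omega>. 0 < r' \<and> (\<forall>j<L. \<forall>q\<in>S. contracts (\<phi> j q) (\<Omega> j q)) \<and>
     (\<forall>q\<in>S. \<forall>q'\<in>S. dist q q' < r' \<longrightarrow>
        (\<forall>j. Suc j < L \<longrightarrow> \<Omega> j q \<subseteq> support_set (\<phi> (Suc j) q')) \<and>
        (\<forall>j. Suc j = L \<longrightarrow> \<Omega> j q \<subseteq> support_set (\<phi>1 q')) \<and>
        1 - real n ^ L * (real n * \<epsilon>) < mass (if L = 0 then support_set (\<phi>1 q) else support_set (\<phi> 0 q)) (f q'))"
  proof (rule Suc.IH[where r = r1])
    have "(\<lambda>q. support_set (\<phi>1 q)) ` S = support_set ` (\<phi>1 ` S)" by auto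
    then show "finite ((\<lambda>q. support_set (\<phi>1 q)) ` S)" using 1(2) by simp
    show "0 < real n * \<epsilon>" using Suc.prems(4) n1 by simp
    show "real n ^ L * (real n * \<epsilon>) \<le> 1" using Suc.prems(5) by (simp add: mult_ac)
  qed (use op 1 in auto)
  then obtain r2 \<phi> \<Omega> where 20: "0 < r2" "\<forall>j<L. \<forall>q\<in>S. contracts (\<phi> j q) (\<Omega> j q)"
    "\<forall>q\<in>S. \<forall>q'\<in>S. dist q q' < r2 \<longrightarrow>
        (\<forall>j. Suc j < L \<longrightarrow> \<Omega> j q \<subseteq> support_set (\<phi> (Suc j) q')) \<and>
        (\<forall>j. Suc j = L \<longrightarrow> \<Omega> j q \<subseteq> support_set (\<phi>1 q')) \<and>
        1 - real n ^ L * (real n * \<epsilon>) < mass (if L = 0 then support_set (\<phi>1 q) else support_set (\<phi> 0 q)) (f q')"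
    by (elim exE conjE) (rule that)
  note 2 = 20(1) 20(2)[rule_format] bspec[OF bspec[OF 20(3)], THEN mp]
  define \<phi>' where "\<phi>' = (\<lambda>j. if j < L then \<phi> j else \<phi>1)"
  define \<Omega>' where "\<Omega>' = (\<lambda>j. if j < L then \<Omega> j else \<Omega>1)"
  show ?case
  proof (intro exI[of _ "min r1 r2"] exI[of _ \<phi>'] exI[of _ \<Omega>'] conjI ballI allI impI)
    show "0 < min r1 r2" using 1(1) 2(1) by simp
    show "contracts (\<phi>' j q) (\<Omega>' j q)" if "q \<in> S" for j q
      using 1(3) 2(2) that by (simp add: \<phi>'_def \<Omega>'_def)
    fix q q' assume q: "q \<in> S" "q' \<in> S" "dist q q' < min r1 r2"
    have q2: "dist q q' < r2" "dist q q' < r1" using q(3) by auto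
    show "\<Omega>' j q \<subseteq> support_set (\<phi>' (Suc j) q')" if "Suc j < Suc L" for j
      using 2(3)[OF q(1,2) q2(1)] that by (cases "Suc j = L") (auto simp: \<phi>'_def \<Omega>'_def)
    show "\<Omega>' j q \<subseteq> N q'" if "Suc j = Suc L" for j
      using 1(4)[OF q(1,2) q2(2)] that by (simp add: \<Omega>'_def)
    show "1 - real n ^ Suc L * \<epsilon> < mass (if Suc L = 0 then N q else support_set (\<phi>' 0 q)) (f q')"
      using 2(3)[OF q(1,2) q2(1)] by (cases "L = 0") (simp_all add: \<phi>'_def mult_ac)
  qed
qed

text \<open>The tower starts from all of \<open>X\<close>, which carries the full mass 1, with
  tolerance \<open>1 / real n ^ L\<close>. After \<open>L\<close> levels the lower bound has dropped
  to 0 but is still strict, so \<open>f q'\<close> charges level 0.\<close>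

lemma ex_carriers:
  fixes f :: "'c :: metric_space \<Rightarrow> 'a \<Rightarrow> real" and L :: nat
  assumes S: "compact S" and f: "continuous_map (top_of_set S) Y f" and L: "0 < L"
  shows "\<exists>r \<phi> \<Omega>. 0 < r \<and> (\<forall>j<L. \<forall>q\<in>S. contracts (\<phi> j q) (\<Omega> j q)) \<and>
     (\<forall>q\<in>S. \<forall>q'\<in>S. dist q q' < r \<longrightarrow> f q' \<in> meets (support_set (\<phi> 0 q)) \<and>
        (\<forall>j j'. j < j' \<and> j' < L \<longrightarrow> \<Omega> j q \<subseteq> support_set (\<phi> j' q')))"
proof -
  have fY: "f q \<in> topspace Y" if "q \<in> S" for q
    using continuous_map_image_subset_topspace[OF f] that by auto
  have pn: "0 < real n ^ L" using n1 by simp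
  have ts: "mass (topspace X) (f q) = 1" if "q \<in> S" for q
  proof -
    have "{x. x \<in> topspace X \<and> f q x \<noteq> 0} = {x. f q x \<noteq> 0}" using Y_D(3)[OF fY[OF that]] by auto
    then show ?thesis unfolding mass_def using Y_D(5)[OF fY[OF that]] by simp
  qed
  have "\<exists>r' \<phi> \<Omega>. 0 < r' \<and> (\<forall>j<L. \<forall>q\<in>S. contracts (\<phi> j q) (\<Omega> j q)) \<and>
     (\<forall>q\<in>S. \<forall>q'\<in>S. dist q q' < r' \<longrightarrow>
        (\<forall>j. Suc j < L \<longrightarrow> \<Omega> j q \<subseteq> support_set (\<phi> (Suc j) q')) \<and> (\<forall>j. Suc j = L \<longrightarrow> \<Omega> j q \<subseteq> topspace X) \<and>
        1 - real n ^ L * (1 / real n ^ L) < mass (if L = 0 then topspace X else support_set (\<phi> 0 q)) (f q'))"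
  proof (rule carrier_tower[OF S f, of "\<lambda>_. topspace X" 1])
    show "finite ((\<lambda>_. topspace X) ` S)" by (rule finite_subset[of _ "{topspace X}"]) auto
  qed (use pn ts in auto)
  then obtain r \<phi> \<Omega> where r0: "0 < r" "\<forall>j<L. \<forall>q\<in>S. contracts (\<phi> j q) (\<Omega> j q)"
    "\<forall>q\<in>S. \<forall>q'\<in>S. dist q q' < r \<longrightarrow>
        (\<forall>j. Suc j < L \<longrightarrow> \<Omega> j q \<subseteq> support_set (\<phi> (Suc j) q')) \<and> (\<forall>j. Suc j = L \<longrightarrow> \<Omega> j q \<subseteq> topspace X) \<and>
        1 - real n ^ L * (1 / real n ^ L) < mass (if L = 0 then topspace X else support_set (\<phi> 0 q)) (f q')"
    by (elim exE conjE) (rule that)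
  note r3 = bspec[OF bspec[OF r0(3)], THEN mp]
  have r: "0 < r" "\<And>j q. j < L \<Longrightarrow> q \<in> S \<Longrightarrow> contracts (\<phi> j q) (\<Omega> j q)"
     "\<And>q q' j. q \<in> S \<Longrightarrow> q' \<in> S \<Longrightarrow> dist q q' < r \<Longrightarrow> Suc j < L \<Longrightarrow> \<Omega> j q \<subseteq> support_set (\<phi> (Suc j) q')"
     "\<And>q q'. q \<in> S \<Longrightarrow> q' \<in> S \<Longrightarrow> dist q q' < r \<Longrightarrow> 0 < mass (support_set (\<phi> 0 q)) (f q')"
    subgoal by (rule r0)
    subgoal using r0(2) by simp
    subgoal using r3 by simp
    subgoal for q q' using r3[of q q'] pn L by simp
    done
  \<comment> \<open>After the first inclusion the chain stays at the parameter \<open>q'\<close>.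
    Nearness is not transitive, so it must be used only once.\<close>
  have up: "\<Omega> j q \<subseteq> support_set (\<phi> (Suc (j + k)) q')"
    if q: "q \<in> S" "q' \<in> S" "dist q q' < r" and jk: "Suc (j + k) < L" for j k q q'
    using jk
  proof (induction k)
    case 0 then show ?case using r(3) q by simp
  next
    case (Suc k)
    have "\<Omega> j q \<subseteq> support_set (\<phi> (Suc (j + k)) q')" using Suc by simp
    also have "\<dots> \<subseteq> \<Omega> (Suc (j + k)) q'" using r(2)[of "Suc (j + k)" q'] Suc.prems q by (simp add: contracts_def)
    also have "\<dots> \<subseteq> support_set (\<phi> (Suc (j + Suc k)) q')"
      using r(3)[of q' q' "Suc (j + k)"] q r(1) Suc.prems by simp
    finally show ?case .
  qed
  have "f q' \<in> meets (support_set (\<phi> 0 q))" if q: "q \<in> S" "q' \<in> S" "dist q q' < r" for q q'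
  proof -
    have "{x. x \<in> support_set (\<phi> 0 q) \<and> f q' x \<noteq> 0} \<noteq> {}"
      using r(4)[OF q] unfolding mass_def by (metis less_irrefl sum.empty)
    then show ?thesis using fY[OF q(2)] by (auto simp: meets_def)
  qed
  moreover have "\<Omega> j q \<subseteq> support_set (\<phi> j' q')"
    if "q \<in> S" "q' \<in> S" "dist q q' < r" "j < j'" "j' < L" for j j' q q'
    using up[OF that(1-3), of j "j' - Suc j"] that(4,5) by simp
  ultimately show ?thesis using r(1,2) by blast
qed

text \<open>Composed with \<open>F\<close>, the contraction of the carrier is a null-homotopy of the
  boundary values. Coning it off fills the cell, at the price of passing from the positivity set of
  \<phi> to \<Omega>.\<close>

lemma contracts_fill:
  assumes c: "finite (odds c)" "odds c \<noteq> {}" and \<phi>: "contracts \<phi> \<Omega>"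
    and F: "continuous_map (top_of_set (bd c)) Y F" "F ` bd c \<subseteq> meets (support_set \<phi>)"
  shows "\<exists>F'. continuous_map (top_of_set (gcell c)) Y F' \<and> (\<forall>x\<in>bd c. F' x = F x) \<and> F' ` gcell c \<subseteq> meets \<Omega>"
proof -
  let ?V = "meets (support_set \<phi>)"
  obtain a where "homotopic_with (\<lambda>f. f ` ?V \<subseteq> meets \<Omega>) (subtopology Y ?V) Y (\<lambda>\<mu>. \<mu>) (\<lambda>_. a)"
    using \<phi> unfolding contracts_def by (elim conjE exE)
  then obtain H where H: "continuous_map (prod_topology \<I> (subtopology Y ?V)) Y H"
    "\<forall>\<mu>. H (0, \<mu>) = \<mu>" "\<forall>\<mu>. H (1, \<mu>) = a" "\<forall>t\<in>{0..1}. (\<lambda>\<mu>. H (t, \<mu>)) ` ?V \<subseteq> meets \<Omega>"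
    unfolding homotopic_with_def by (elim conjE exE) (rule that)
  have "continuous_map (top_of_set (bd c)) (subtopology Y ?V) F"
    using F by (simp add: continuous_map_in_subtopology image_subset_iff_funcset)
  from continuous_map_compose[OF continuous_map_snd[of \<I>] this]
  have "continuous_map (prod_topology \<I> (top_of_set (bd c))) (prod_topology \<I> (subtopology Y ?V)) (\<lambda>q. (fst q, F (snd q)))"
    by (simp only: continuous_map_paired continuous_map_fst o_def simp_thms)
  from continuous_map_compose[OF this H(1)]
  have K: "continuous_map (prod_topology \<I> (top_of_set (bd c))) Y (\<lambda>(t, x). H (t, F x))"
    by (simp only: o_def case_prod_unfold)
  have "H (1, F x) = H (1, F x')" for x x' using H(3) by simp
  from cone_extend[OF c K this] obtain F' where F': "continuous_map (top_of_set (gcell c)) Y F'"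
     "\<forall>x\<in>bd c. F' x = H (0, F x)" "F' ` gcell c = (\<lambda>(t, x). H (t, F x)) ` ({0..1} \<times> bd c)"
    by (elim exE conjE) (rule that)
  have "(\<lambda>(t, x). H (t, F x)) ` ({0..1} \<times> bd c) \<subseteq> meets \<Omega>"
  proof clarify
    fix t x assume "t \<in> {0..1 :: real}" "x \<in> bd c"
    then show "H (t, F x) \<in> meets \<Omega>" using H(4) F(2) by (simp add: image_subset_iff)
  qed
  then show ?thesis
    using F'(1,2) H(2) unfolding F'(3)[symmetric] by (intro exI[of _ F'] conjI) simp_all
qed

end

section \<open>Null-homotopies on the boundary of a cube\<close>

text \<open>Centre of the cube of side 2 with a corner at the origin; the boundary of this cube is
  the model of the sphere.\<close>

definition ones :: "nat \<Rightarrow> nat \<Rightarrow> int" where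
  "ones m i = (if i < m then 1 else 0)"

text \<open>The grid on the boundary of the cube of side 2N; division by \<open>N\<close> gives a
  grid of mesh 2/N on \<open>bd (ones m)\<close>.\<close>

definition boundary_cells :: "nat \<Rightarrow> nat \<Rightarrow> (nat \<Rightarrow> int) set" where
  "boundary_cells m N = {c. (\<forall>i\<ge>m. c i = 0) \<and> (\<forall>i<m. 0 \<le> c i \<and> c i \<le> 2 * int N) \<and>
     (\<exists>i<m. c i = 0 \<or> c i = 2 * int N)}"

lemma odds_ones: "odds (ones m) = {..<m}"
  by (auto simp: odds_def ones_def)

lemma gcell_ones: "x \<in> gcell (ones m) \<longleftrightarrow> (\<forall>i\<ge>m. x i = 0) \<and> (\<forall>i<m. 0 \<le> x i \<and> x i \<le> 2)"
proof -
  have "x \<in> gcell (ones m) \<longleftrightarrow> (\<forall>i. if i < m then \<bar>x i - 1\<bar> \<le> 1 else x i = 0)"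
    by (auto simp: gcell_def ones_def)
  also have "\<dots> \<longleftrightarrow> (\<forall>i\<ge>m. x i = 0) \<and> (\<forall>i<m. 0 \<le> x i \<and> x i \<le> 2)"
    by (auto simp: abs_le_iff not_less)
  finally show ?thesis .
qed

lemma bd_ones: "x \<in> bd (ones m) \<longleftrightarrow> x \<in> gcell (ones m) \<and> (\<exists>i<m. x i = 0 \<or> x i = 2)"
proof -
  have "\<bar>x i - of_int (ones m i)\<bar> = 1 \<longleftrightarrow> x i = 0 \<or> x i = 2" if "i < m" for i
    using that by (auto simp: ones_def abs_if split: if_splits)
  then show ?thesis by (auto simp: bd_def odds_ones)
qed

lemma finite_boundary_cells: "finite (boundary_cells m N)"
proof (rule finite_subset)
  show "boundary_cells m N \<subseteq> {c. \<forall>i. (i \<in> {..<m} \<longrightarrow> c i \<in> {0..2 * int N}) \<and> (i \<notin> {..<m} \<longrightarrow> c i = 0)}"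
    by (auto simp: boundary_cells_def)
qed (rule finite_set_of_finite_funs, auto)

text \<open>A face agrees with its cell in the even directions of the cell, and the extreme values 0
  and 2N are even; so a face lies in the same side of the cube.\<close>

lemma boundary_cells_face:
  assumes c: "c \<in> boundary_cells m N" and f: "face b c"
  shows "b \<in> boundary_cells m N"
proof -
  have even: "b i = c i" if "even (c i)" for i using face_cases[OF f, of i] that by auto
  have "0 \<le> b i \<and> b i \<le> 2 * int N" if "i < m" for i
  proof (cases "even (c i)")
    case True then show ?thesis using even c that by (auto simp: boundary_cells_def)
  next
    case False
    then have "0 \<noteq> c i" "c i \<noteq> 2 * int N" by auto
    then have "0 < c i" "c i < 2 * int N" using c that unfolding boundary_cells_def by (auto simp: order_less_le)
    then show ?thesis using face_cases[OF f, of i] by auto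
  qed
  moreover have "\<forall>i\<ge>m. b i = 0" using even c by (auto simp: boundary_cells_def)
  moreover have "\<exists>i<m. b i = 0 \<or> b i = 2 * int N"
  proof -
    obtain i where i: "i < m" "c i = 0 \<or> c i = 2 * int N" using c by (auto simp: boundary_cells_def)
    then have "even (c i)" by auto
    then show ?thesis using even i by auto
  qed
  ultimately show ?thesis by (simp add: boundary_cells_def)
qed

lemma boundary_cells_odds:
  assumes c: "c \<in> boundary_cells m N"
  shows "odds c \<subseteq> {..<m}" "finite (odds c)" "card (odds c) < m"
proof -
  show 1: "odds c \<subseteq> {..<m}"
  proof
    fix i assume "i \<in> odds c"
    then have "c i \<noteq> 0" by (auto simp: odds_def)
    then show "i \<in> {..<m}" using c by (auto simp: boundary_cells_def not_le[symmetric])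
  qed
  then show "finite (odds c)" using finite_subset by blast
  obtain i where "i < m" "c i = 0 \<or> c i = 2 * int N" using c by (auto simp: boundary_cells_def)
  then have "i \<in> {..<m} - odds c" by (auto simp: odds_def)
  then have "odds c \<subset> {..<m}" using 1 by blast
  from psubset_card_mono[OF _ this] show "card (odds c) < m" by simp
qed

lemma boundary_cells_scale:
  assumes c: "c \<in> boundary_cells m N" and N: "1 \<le> N" and x: "x \<in> gcell c"
  shows "(\<lambda>i. x i / real N) \<in> bd (ones m)"
proof -
  have "0 \<le> x i \<and> x i \<le> 2 * real N" if "i < m" for i
  proof (cases "even (c i)")
    case True
    then have "x i = of_int (c i)" using gcellD(1)[OF x] by simp
    moreover have "0 \<le> c i" "c i \<le> 2 * int N" using c that by (auto simp: boundary_cells_def)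
    ultimately show ?thesis by linarith
  next
    case False
    then have "0 \<noteq> c i" "c i \<noteq> 2 * int N" by auto
    then have "1 \<le> c i" "c i + 1 \<le> 2 * int N" using c that unfolding boundary_cells_def by (auto simp: order_less_le)
    then show ?thesis using gcellD(2)[OF x, of i] by linarith
  qed
  moreover have "x i = 0" if "m \<le> i" for i
  proof -
    have "c i = 0" using c that by (auto simp: boundary_cells_def)
    then show ?thesis using gcellD(1)[OF x, of i] by simp
  qed
  moreover have "\<exists>i<m. x i = 0 \<or> x i = 2 * real N"
  proof -
    obtain i where i: "i < m" "c i = 0 \<or> c i = 2 * int N" using c by (auto simp: boundary_cells_def)
    then have "even (c i)" by auto
    then have "x i = of_int (c i)" using gcellD(1)[OF x] by simp
    then show ?thesis using i by (intro exI[of _ i]) auto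
  qed
  ultimately show ?thesis
    using N by (auto simp: bd_ones gcell_ones divide_le_eq)
qed

lemma boundary_cells_cover:
  assumes y: "y \<in> bd (ones m)"
  shows "carrier_cell (\<lambda>i. real N * y i) \<in> boundary_cells m N"
proof -
  define x where "x = (\<lambda>i. real N * y i)"
  have x: "0 \<le> x i \<and> x i \<le> 2 * real N" if "i < m" for i
  proof -
    have "0 \<le> y i" "y i \<le> 2" using y that by (auto simp: bd_ones gcell_ones)
    then show ?thesis using mult_left_mono[of "y i" 2 "real N"] by (simp add: x_def)
  qed
  have near: "p = carrier_cell x i" if "x i = of_int p" for i p
    using carrier_cell(2)[of x i] that by (intro int_eq_of_real_less) simp
  have "0 \<le> carrier_cell x i \<and> carrier_cell x i \<le> 2 * int N" if "i < m" for i
    using x[OF that] carrier_cell(2)[of x i] by linarith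
  moreover have "carrier_cell x i = 0" if "m \<le> i" for i
    using near[of i 0] y that by (simp add: x_def bd_ones gcell_ones)
  moreover have "\<exists>i<m. carrier_cell x i = 0 \<or> carrier_cell x i = 2 * int N"
  proof -
    obtain i where i: "i < m" "y i = 0 \<or> y i = 2" using y by (auto simp: bd_ones)
    then have "x i = of_int 0 \<or> x i = of_int (2 * int N)" by (auto simp: x_def)
    then show ?thesis using near[of i] i(1) by metis
  qed
  ultimately show ?thesis by (simp add: boundary_cells_def x_def)
qed

text \<open>The metric on functions truncates coordinate distances at 1 and weights them by the
  powers of 1/2, which sum to 2.\<close>

lemma dist_fun_le:
  fixes x y :: "nat \<Rightarrow> real"
  assumes "\<And>i. \<bar>x i - y i\<bar> \<le> \<delta>"
  shows "dist x y \<le> 2 * \<delta>"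
proof -
  have s: "summable (\<lambda>n. (1 / 2 :: real) ^ n)" by (simp add: summable_geometric_iff)
  have le: "(1 / 2) ^ n * min (dist (x (from_nat n)) (y (from_nat n))) 1 \<le> (1 / 2) ^ n * \<delta>" for n
    using assms[of "from_nat n"] by (intro mult_left_mono) (auto simp: dist_real_def min_def)
  have "dist x y \<le> suminf (\<lambda>n. (1 / 2) ^ n * \<delta>)"
    unfolding dist_fun_def
  proof (rule suminf_le[OF le])
    show "summable (\<lambda>n. (1 / 2) ^ n * min (dist (x (from_nat n)) (y (from_nat n))) 1)"
      by (rule summable_comparison_test'[OF s, of 0]) (auto simp: abs_mult mult_left_le)
    show "summable (\<lambda>n. (1 / 2) ^ n * \<delta>)" using s by (rule summable_mult2)
  qed
  also have "\<dots> = 2 * \<delta>" using suminf_mult2[OF s, of \<delta>] by (simp add: suminf_geometric)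
  finally show ?thesis .
qed

lemma center_in_gcell: "(\<lambda>i. of_int (c i)) \<in> gcell c"
  by (simp add: gcell_def)

text \<open>Coordinate \<open>m\<close> vanishes on the boundary of the m-cube and will serve as
  time: updating it turns a cell into the prism over it for k = 1, and into an end of that prism for
  k = 0 and k = 2.\<close>

lemma gcell_upd:
  "x \<in> gcell c \<Longrightarrow> x(m := y) \<in> gcell (c(m := k)) \<longleftrightarrow> (if even k then y = of_int k else \<bar>y - of_int k\<bar> \<le> 1)"
  unfolding gcell_def by (auto split: if_splits)

lemma face_upd: "face b c \<Longrightarrow> face (b(m := k)) (c(m := k))"
  by (auto simp: face_def)

lemma continuous_on_fun_upd:
  fixes g :: "'b :: topological_space \<Rightarrow> nat \<Rightarrow> real"
  assumes "\<And>i. i \<noteq> m \<Longrightarrow> continuous_on S (\<lambda>x. g x i)" "continuous_on S h"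
  shows "continuous_on S (\<lambda>x. (g x)(m := h x))"
proof (rule continuous_on_coordinatewise_then_product)
  fix i show "continuous_on S (\<lambda>x. ((g x)(m := h x)) i)"
    using assms by (cases "i = m") auto
qed

context nice_barycenters
begin

text \<open>The simplicial model of \<open>f\<close>: at \<open>x\<close> the weights \<^const>\<open>wt\<close> select a flag of cells containing \<open>x\<close>,
  hence at most \<open>m\<close> of the chosen points \<open>a c\<close> are used.\<close>

lemma continuous_map_flag:
  assumes m: "m \<le> n" and K: "finite K" "\<And>c. c \<in> K \<Longrightarrow> card (odds c) < m \<and> (\<forall>i\<ge>m. c i = 0)"
      "\<And>b c. c \<in> K \<Longrightarrow> face b c \<Longrightarrow> b \<in> K"
    and p: "\<And>c. c \<in> K \<Longrightarrow> continuous_map S X (p c)"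
    and x: "continuous_map S (top_of_set (\<Union>c\<in>K. gcell c)) x"
  shows "continuous_map S Y (\<lambda>s y. \<Sum>c | c \<in> K \<and> p c s = y. wt m c (x s) / (\<Sum>b\<in>K. wt m b (x s)))"
proof -
  let ?D = "\<lambda>s. \<Sum>b\<in>K. wt m b (x s)"
  have D: "0 < ?D s" if "s \<in> topspace S" for s
  proof -
    have "x s \<in> (\<Union>c\<in>K. gcell c)" using continuous_map_image_subset_topspace[OF x] that by auto
    then obtain c where "c \<in> K" "x s \<in> gcell c" by blast
    then have "carrier_cell (x s) \<in> K" using carrier_cell_face K(3) by blast
    then show ?thesis using K(1) wt_carrier wt_nonneg by (intro sum_pos2[of _ "carrier_cell (x s)"]) auto
  qed
  have w: "continuous_map S euclideanreal (\<lambda>s. wt m b (x s))" for b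
    using continuous_map_compose[OF x, of euclideanreal "wt m b"] by (simp add: continuous_on_wt o_def)
  show ?thesis
  proof (rule continuous_map_labelled[OF K(1) p])
    show "continuous_map S euclideanreal (\<lambda>s. wt m c (x s) / ?D s)" for c
      using D K(1) by (intro continuous_intros w) (auto simp: order_less_le)
    show "0 \<le> wt m c (x s) / ?D s" if "s \<in> topspace S" for c s
      using D[OF that] wt_nonneg by simp
    fix s assume s: "s \<in> topspace S"
    show "(\<Sum>c\<in>K. wt m c (x s) / ?D s) = 1"
      using D[OF s] by (simp add: sum_divide_distrib[symmetric])
    have "card {c \<in> K. wt m c (x s) / ?D s \<noteq> 0} \<le> card {..<m}"
    proof (rule card_inj_on_le)
      show "inj_on (\<lambda>c. card (odds c)) {c \<in> K. wt m c (x s) / ?D s \<noteq> 0}"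
      proof (rule inj_onI)
        fix b c assume b: "b \<in> {c \<in> K. wt m c (x s) / ?D s \<noteq> 0}" and c: "c \<in> {c \<in> K. wt m c (x s) / ?D s \<noteq> 0}"
          and e: "card (odds b) = card (odds c)"
        show "b = c" by (rule wt_unique[of m b "x s" c]) (use b c e K(2) in auto)
      qed
    qed (use K(2) in auto)
    then show "card {c \<in> K. wt m c (x s) / ?D s \<noteq> 0} \<le> n" using m by simp
  qed
qed

text \<open>The homotopy from \<open>f\<close> to its model \<open>g\<close> is itself obtained by
  extension over cells: the prism over the grid is again made of grid cells, with coordinate
  \<open>m\<close> running from 0 to 2 and the two maps prescribed on its ends.\<close>

lemma cube_boundary_null_homotopic:
  assumes m: "1 \<le> m" "m \<le> n" and pc: "path_connected_space X" and x0: "x0 \<in> topspace X"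
    and f: "continuous_map (top_of_set (bd (ones m))) Y f"
  shows "homotopic_with (\<lambda>_. True) (top_of_set (bd (ones m))) Y f (\<lambda>_. dirac x0)"
proof -
  let ?S = "bd (ones m)"
  have Sc: "compact ?S" by (rule compact_bd) (simp add: odds_ones)
  \<comment> \<open>Level 0 is for \<open>f\<close> and the points \<open>a c\<close>, level 1 for
    the ends of the prism, and levels 2 to m + 1 for the prisms over cells of dimension 0 to m -
    1.\<close>
  obtain r \<phi> \<Omega> where r: "0 < r" and con: "\<And>j q. j < m + 2 \<Longrightarrow> q \<in> ?S \<Longrightarrow> contracts (\<phi> j q) (\<Omega> j q)"
    and fm: "\<And>q q'. q \<in> ?S \<Longrightarrow> q' \<in> ?S \<Longrightarrow> dist q q' < r \<Longrightarrow> f q' \<in> meets (support_set (\<phi> 0 q))"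
    and up: "\<And>q q' j j'. q \<in> ?S \<Longrightarrow> q' \<in> ?S \<Longrightarrow> dist q q' < r \<Longrightarrow> j < j' \<Longrightarrow> j' < m + 2 \<Longrightarrow>
        \<Omega> j q \<subseteq> support_set (\<phi> j' q')"
  proof -
    have "0 < m + 2" by simp
    from ex_carriers[OF Sc f this] obtain r \<phi> \<Omega> where *: "0 < r" "\<forall>j<m + 2. \<forall>q\<in>?S. contracts (\<phi> j q) (\<Omega> j q)"
      "\<forall>q\<in>?S. \<forall>q'\<in>?S. dist q q' < r \<longrightarrow> f q' \<in> meets (support_set (\<phi> 0 q)) \<and>
        (\<forall>j j'. j < j' \<and> j' < m + 2 \<longrightarrow> \<Omega> j q \<subseteq> support_set (\<phi> j' q'))" by (elim exE conjE) (rule that)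
    show thesis
      by (rule that[OF *(1), of \<phi> \<Omega>]) (use *(2,3) in simp_all)
  qed
  have down: "support_set (\<phi> j q) \<subseteq> \<Omega> j q" if "j < m + 2" "q \<in> ?S" for j q
    using con[OF that] by (simp add: contracts_def)
  \<comment> \<open>After scaling, a point of a cell differs from the centre by at most 1/N in each
    coordinate. The factor 2 is the one from \<open>dist_fun_le\<close>.\<close>
  obtain N where N: "2 / r < real N" using reals_Archimedean2 by blast
  moreover have "0 < 2 / r" using r by simp
  ultimately have N0: "0 < real N" by linarith
  then have N1: "1 \<le> N" by simp
  have Nr: "2 * (1 / real N) < r" using N N0 r by (simp add: field_simps)
  define K where "K = boundary_cells m N"
  define sc where "sc = (\<lambda>x :: nat \<Rightarrow> real. \<lambda>i. x i / real N)"
  define q where "q = (\<lambda>c :: nat \<Rightarrow> int. sc (\<lambda>i. of_int (c i)))"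
  define P where "P = (\<Union>c\<in>K. gcell c)"
  have Kfin: "finite K" by (simp add: K_def finite_boundary_cells)
  have Kface: "b \<in> K" if "c \<in> K" "face b c" for b c
    using boundary_cells_face that by (simp add: K_def)
  have Kodd: "odds c \<subseteq> {..<m}" "finite (odds c)" "card (odds c) < m" if "c \<in> K" for c
    using boundary_cells_odds that by (simp_all add: K_def)
  have Kz: "c i = 0" if "c \<in> K" "m \<le> i" for c i using that by (simp add: K_def boundary_cells_def)
  have scS: "sc x \<in> ?S" if "c \<in> K" "x \<in> gcell c" for c x
    using boundary_cells_scale[OF _ N1 that(2)] that(1) by (simp add: K_def sc_def)
  have qS: "q c \<in> ?S" if "c \<in> K" for c
    unfolding q_def by (rule scS[OF that center_in_gcell])
  have dsc: "dist (q c) (sc x) < r" if "c \<in> K" "x \<in> gcell c" for c x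
  proof -
    have "\<bar>q c i - sc x i\<bar> \<le> 1 / real N" for i
    proof -
      have "\<bar>q c i - sc x i\<bar> = \<bar>x i - of_int (c i)\<bar> / real N"
        using N0 by (simp add: q_def sc_def diff_divide_distrib[symmetric] abs_minus_commute)
      also have "\<dots> \<le> 1 / real N" using gcellD(2)[OF that(2), of i] N0 by (intro divide_right_mono) auto
      finally show ?thesis .
    qed
    then have "dist (q c) (sc x) \<le> 2 * (1 / real N)" by (rule dist_fun_le)
    then show ?thesis using Nr by linarith
  qed
  have dq: "dist (q b) (q c) < r" if "c \<in> K" "face b c" for b c
  proof -
    have "(\<lambda>i. of_int (b i)) \<in> gcell c" using face_gcell[OF that(2)] center_in_gcell by blast
    from dsc[OF that(1) this] show ?thesis by (simp add: q_def dist_commute)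
  qed
  define a where "a = (\<lambda>c. SOME x. x \<in> support_set (\<phi> 0 (q c)))"
  have a: "a c \<in> support_set (\<phi> 0 (q c))" if "c \<in> K" for c
  proof -
    have "f (q c) \<in> meets (support_set (\<phi> 0 (q c)))" using fm[OF qS[OF that] qS[OF that]] r by simp
    then have "\<exists>x. x \<in> support_set (\<phi> 0 (q c))" by (auto simp: meets_def)
    then show ?thesis unfolding a_def by (rule someI_ex)
  qed
  have aX: "a c \<in> topspace X" if "c \<in> K" for c using a[OF that] by (simp add: support_set_def)
  define w where "w = (\<lambda>c x. wt m c x / (\<Sum>b\<in>K. wt m b x))"
  define g where "g = (\<lambda>x y. \<Sum>c | c \<in> K \<and> a c = y. w c x)"
  have flag: "continuous_map S Y (\<lambda>s y. \<Sum>c | c \<in> K \<and> p c s = y. w c (x s))"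
    if "\<And>c. c \<in> K \<Longrightarrow> continuous_map S X (p c)" "continuous_map S (top_of_set P) x" for p x and S :: "'s topology"
    unfolding w_def using continuous_map_flag[OF m(2) Kfin _ Kface that(1)] that(2) Kodd Kz
    unfolding P_def by simp
  have gc: "continuous_map (top_of_set P) Y g"
    unfolding g_def by (rule flag[of "top_of_set P" "\<lambda>c x. a c" "\<lambda>x. x"]) (use aX in auto)
  \<comment> \<open>A point charged by \<open>g x\<close> is some \<open>a b\<close> with
    \<open>b\<close> a face of \<open>c\<close>; it lies in level 0 at \<open>b\<close>, hence in
    level 1 at \<open>c\<close>.\<close>
  have gm: "g x \<in> meets (\<Omega> 1 (q c))" if c: "c \<in> K" "x \<in> gcell c" for c x
  proof -
    have gY: "g x \<in> topspace Y"
      using continuous_map_image_subset_topspace[OF gc] c by (auto simp: P_def)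
    obtain y where y: "g x y \<noteq> 0" using Y_nonzero[OF gY] by blast
    then obtain b where b: "b \<in> K" "a b = y" "w b x \<noteq> 0"
      unfolding g_def by (metis (mono_tags, lifting) mem_Collect_eq sum.neutral)
    then have "wt m b x \<noteq> 0" by (auto simp: w_def)
    then have fb: "face b c" using wt_face[of m b x c] c Kz b(1) by blast
    have "y \<in> \<Omega> 0 (q b)" using a[OF b(1)] b(2) down[of 0 "q b"] qS[OF b(1)] by auto
    then have "y \<in> support_set (\<phi> 1 (q c))"
      using up[OF qS[OF b(1)] qS[OF c(1)] dq[OF c(1) fb], of 0 1] by auto
    then have "y \<in> \<Omega> 1 (q c)" using down[of 1 "q c"] qS[OF c(1)] by auto
    then show ?thesis using y gY by (auto simp: meets_def)
  qed
  have f'm: "f (sc x) \<in> meets (\<Omega> 1 (q c))" if c: "c \<in> K" "x \<in> gcell c" for c x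
  proof -
    have "support_set (\<phi> 0 (q c)) \<subseteq> \<Omega> 1 (q c)"
      using down[of 0 "q c"] up[of "q c" "q c" 0 1] down[of 1 "q c"] qS[OF c(1)] r by (auto simp: subset_eq)
    then show ?thesis using fm[OF qS[OF c(1)] scS[OF c] dsc[OF c]] meets_mono by blast
  qed
  have "continuous_map (top_of_set P) (top_of_set ?S) sc"
    using scS N0 by (auto simp: P_def sc_def intro!: continuous_intros continuous_on_coordinatewise_then_product)
  from continuous_map_compose[OF this f]
  have f'c: "continuous_map (top_of_set P) Y (\<lambda>x. f (sc x))" by (simp add: o_def)

  define K2 where "K2 = {c. c(m := 0) \<in> K \<and> c m \<in> {0, 1, 2}}"
  define L2 where "L2 = {c \<in> K2. c m \<noteq> 1}"
  \<comment> \<open>The level grows with the dimension of the base, so every proper face of a prism,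
    be it a smaller prism or a cell of an end, has a strictly lower level.\<close>
  define \<rho> where "\<rho> = (\<lambda>c :: nat \<Rightarrow> int. if c m = 1 then card (odds (c(m := 0))) + 2 else 1)"
  define U where "U = (\<lambda>c. meets (\<Omega> (\<rho> c) (q (c(m := 0)))))"
  \<comment> \<open>On the ends \<open>x m\<close> is 0 or 2, so the threshold 1 separates them and
    the agreement needed for pasting is vacuous.\<close>
  define F0 where "F0 = (\<lambda>x :: nat \<Rightarrow> real. if x m \<le> 1 then f (sc (x(m := 0))) else g (x(m := 0)))"
  have base: "x(m := 0) \<in> gcell (c(m := 0))" if "x \<in> gcell c" for x c
    using gcell_upd[OF that, of m 0 0] by simp
  have baseP: "x(m := 0) \<in> P" if "x \<in> gcell c" "c \<in> K2" for x c
    using base[OF that(1)] that(2) by (auto simp: P_def K2_def)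
  have K2fin: "finite K2"
  proof (rule finite_subset)
    show "K2 \<subseteq> (\<lambda>(c, k). c(m := k)) ` (K \<times> {0, 1, 2})"
    proof
      fix c assume "c \<in> K2"
      moreover have "c = (c(m := 0))(m := c m)" by auto
      ultimately show "c \<in> (\<lambda>(c, k). c(m := k)) ` (K \<times> {0, 1, 2})"
        unfolding K2_def by (intro image_eqI[of _ _ "(c(m := 0), c m)"]) auto
    qed
  qed (use Kfin in auto)
  have odds_up: "odds c = (if odd (c m) then insert m (odds (c(m := 0))) else odds (c(m := 0)))" for c
    by (auto simp: odds_def split: if_splits)
  have K2odd: "finite (odds c)" if "c \<in> K2" for c
    using odds_up[of c] Kodd(2)[of "c(m := 0)"] that by (auto simp: K2_def)
  have K2face: "b \<in> K2" if "c \<in> K2" "face b c" for b c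
  proof -
    have "b(m := 0) \<in> K" using Kface[OF _ face_upd[OF that(2)]] that(1) by (auto simp: K2_def)
    moreover have "b m \<in> {0, 1, 2}" using face_cases[OF that(2), of m] that(1) by (auto simp: K2_def abs_if split: if_splits)
    ultimately show ?thesis by (simp add: K2_def)
  qed
  have L2face: "b \<in> L2" if "c \<in> L2" "face b c" for b c
  proof -
    have "b m = c m" using face_cases[OF that(2), of m] that(1) by (auto simp: L2_def K2_def)
    then show ?thesis using K2face[OF _ that(2)] that(1) by (simp add: L2_def)
  qed
  have L2m: "x m = 0 \<and> c m = 0 \<or> x m = 2 \<and> c m = 2" if "c \<in> L2" "x \<in> gcell c" for c x
    using gcellD(1)[OF that(2), of m] that(1) by (auto simp: L2_def K2_def)
  have \<rho>less: "\<rho> b < \<rho> c" if "c \<in> K2" "c m = 1" "face b c" "b \<noteq> c" for b c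
  proof (cases "b m = 1")
    case True
    have "b(m := 0) \<noteq> c(m := 0)"
    proof
      assume "b(m := 0) = c(m := 0)"
      then have "b(m := 1) = c(m := 1)" by (metis fun_upd_upd)
      then show False using True that(2,4) by (metis fun_upd_triv)
    qed
    then have "odds (b(m := 0)) \<subset> odds (c(m := 0))" using face_odds face_upd[OF that(3)] by blast
    then have "card (odds (b(m := 0))) < card (odds (c(m := 0)))"
      using Kodd(2)[of "c(m := 0)"] that(1) by (intro psubset_card_mono) (auto simp: K2_def)
    then show ?thesis using True that(2) by (simp add: \<rho>_def)
  qed (use that(2) in \<open>simp add: \<rho>_def\<close>)
  have \<rho>le: "\<rho> c < m + 2" if "c \<in> K2" for c
    using Kodd(3)[of "c(m := 0)"] that m(1) by (auto simp: \<rho>_def K2_def)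
  have F0c: "continuous_map (top_of_set (\<Union>c\<in>L2. gcell c)) Y F0"
  proof -
    let ?Q = "\<Union>c\<in>L2. gcell c"
    have z: "continuous_map (top_of_set ?Q) (top_of_set P) (\<lambda>x. x(m := 0))"
    proof -
      have "continuous_on ?Q (\<lambda>x. x(m := 0))"
        by (rule continuous_on_fun_upd) (intro continuous_intros)+
      then show ?thesis using baseP by (auto simp: L2_def)
    qed
    show ?thesis
      unfolding F0_def
    proof (rule continuous_map_cases_le)
      show "continuous_map (subtopology (top_of_set ?Q) {x \<in> topspace (top_of_set ?Q). x m \<le> 1}) Y (\<lambda>x. f (sc (x(m := 0))))"
        using continuous_map_from_subtopology[OF continuous_map_compose[OF z f'c]] by (simp add: o_def)
      show "continuous_map (subtopology (top_of_set ?Q) {x \<in> topspace (top_of_set ?Q). 1 \<le> x m}) Y (\<lambda>x. g (x(m := 0)))"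
        using continuous_map_from_subtopology[OF continuous_map_compose[OF z gc]] by (simp add: o_def)
      show "f (sc (x(m := 0))) = g (x(m := 0))" if "x \<in> topspace (top_of_set ?Q)" "x m = 1" for x
        using L2m that by force
    qed (auto intro: continuous_intros)
  qed
  have F0U: "F0 ` gcell c \<subseteq> U c" if c: "c \<in> L2" for c
  proof clarify
    fix x assume x: "x \<in> gcell c"
    have cK: "c(m := 0) \<in> K" and \<rho>1: "\<rho> c = 1" using c by (auto simp: L2_def K2_def \<rho>_def)
    show "F0 x \<in> U c"
      using gm[OF cK base[OF x]] f'm[OF cK base[OF x]] by (simp add: U_def \<rho>1 F0_def)
  qed
  have "\<exists>F. continuous_map (top_of_set (\<Union>c\<in>K2. gcell c)) Y F \<and> (\<forall>c\<in>L2. \<forall>x\<in>gcell c. F x = F0 x) \<and>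
     (\<forall>c\<in>K2. F ` gcell c \<subseteq> U c)"
  proof (rule extend_cells[OF K2fin K2odd K2face _ _ L2face F0c F0U])
    show "L2 \<subseteq> K2" by (auto simp: L2_def)
    fix c F assume c: "c \<in> K2 - L2" and F: "continuous_map (top_of_set (bd c)) Y F"
      and FU: "\<And>b. face b c \<Longrightarrow> b \<noteq> c \<Longrightarrow> F ` gcell b \<subseteq> U b"
    have c2: "c \<in> K2" "c m = 1" "c(m := 0) \<in> K" using c by (auto simp: L2_def K2_def)
    have "F ` bd c \<subseteq> meets (support_set (\<phi> (\<rho> c) (q (c(m := 0)))))"
    proof clarify
      fix x assume "x \<in> bd c"
      then obtain b where b: "face b c" "b \<noteq> c" "x \<in> gcell b" unfolding bd_eq by blast
      have bK: "b(m := 0) \<in> K" using K2face[OF c2(1) b(1)] by (simp add: K2_def)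
      have "F x \<in> U b" using FU[OF b(1,2)] b(3) by blast
      moreover have "\<Omega> (\<rho> b) (q (b(m := 0))) \<subseteq> support_set (\<phi> (\<rho> c) (q (c(m := 0))))"
        by (rule up[OF qS[OF bK] qS[OF c2(3)] dq[OF c2(3) face_upd[OF b(1)]] \<rho>less[OF c2(1,2) b(1,2)] \<rho>le[OF c2(1)]])
      ultimately show "F x \<in> meets (support_set (\<phi> (\<rho> c) (q (c(m := 0)))))"
        using meets_mono unfolding U_def by blast
    qed
    moreover have "odds c \<noteq> {}" using c2(2) by (auto simp: odds_def intro!: exI[of _ m])
    ultimately show "\<exists>F'. continuous_map (top_of_set (gcell c)) Y F' \<and> (\<forall>x\<in>bd c. F' x = F x) \<and> F' ` gcell c \<subseteq> U c"
      unfolding U_def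
      by (intro contracts_fill[OF K2odd[OF c2(1)] _ con[OF \<rho>le[OF c2(1)] qS[OF c2(3)]] F])
  qed
  then obtain F where F: "continuous_map (top_of_set (\<Union>c\<in>K2. gcell c)) Y F" "\<And>c x. c \<in> L2 \<Longrightarrow> x \<in> gcell c \<Longrightarrow> F x = F0 x"
    by blast
  have lift: "c(m := k) \<in> K2" "x(m := y) \<in> gcell (c(m := k))"
    if "c \<in> K" "x \<in> gcell c" "k \<in> {0, 1, 2}" "if even k then y = of_int k else \<bar>y - of_int k\<bar> \<le> 1" for c x k y
  proof -
    have "c(m := 0) = c" using Kz[OF that(1), of m] by auto
    then show "c(m := k) \<in> K2" using that(1,3) by (simp add: K2_def)
    show "x(m := y) \<in> gcell (c(m := k))" using gcell_upd[OF that(2)] that(4) by simp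
  qed
  have Pm: "x(m := 0) = x" if "x \<in> P" for x
  proof -
    from that obtain c where "c \<in> K" "x \<in> gcell c" by (auto simp: P_def)
    then have "x m = 0" using Kz[of c m] gcellD(1)[of x c m] by simp
    then show ?thesis by auto
  qed
  have H1: "homotopic_with (\<lambda>_. True) (top_of_set P) Y (\<lambda>x. f (sc x)) g"
  proof (subst homotopic_with)
    have up2: "x(m := 2 * t) \<in> (\<Union>c\<in>K2. gcell c)" if xP: "x \<in> P" and t: "t \<in> {0..1}" for x t
    proof -
      obtain c where c: "c \<in> K" "x \<in> gcell c" using xP by (auto simp: P_def)
      have "\<bar>2 * t - of_int 1\<bar> \<le> 1" using t by (auto simp: abs_le_iff)
      then show ?thesis using lift[OF c, of 1 "2 * t"] by auto
    qed
    have "continuous_map (prod_topology \<I> (top_of_set P)) (top_of_set (\<Union>c\<in>K2. gcell c)) (\<lambda>(t, x). x(m := 2 * t))"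
    proof -
      have "continuous_on ({0..1} \<times> P) (\<lambda>z. (snd z)(m := 2 * fst z))"
        by (rule continuous_on_fun_upd) (intro continuous_intros)+
      then show ?thesis using up2 by (auto simp: case_prod_unfold)
    qed
    from continuous_map_compose[OF this F(1)]
    have Hc: "continuous_map (prod_topology \<I> (top_of_set P)) Y (\<lambda>(t, x). F (x(m := 2 * t)))"
      by (simp add: o_def case_prod_unfold)
    have ends: "F (x(m := 0)) = f (sc x) \<and> F (x(m := 2)) = g x" if "x \<in> P" for x
    proof -
      from that obtain c where c: "c \<in> K" "x \<in> gcell c" by (auto simp: P_def)
      have "F (x(m := 0)) = F0 (x(m := 0))"
        using lift[OF c, of 0 0] by (intro F(2)[of "c(m := 0)"]) (auto simp: L2_def)
      moreover have "F (x(m := 2)) = F0 (x(m := 2))"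
        using lift[OF c, of 2 2] by (intro F(2)[of "c(m := 2)"]) (auto simp: L2_def)
      moreover have "x m = 0" using Pm[OF that] by (metis fun_upd_same)
      ultimately show ?thesis using Pm[OF that] by (simp add: F0_def)
    qed
    show "\<exists>h. continuous_map (prod_topology \<I> (top_of_set P)) Y h \<and>
       (\<forall>x\<in>topspace (top_of_set P). h (0, x) = f (sc x)) \<and> (\<forall>x\<in>topspace (top_of_set P). h (1, x) = g x) \<and> (\<forall>t\<in>{0..1}. True)"
      using Hc ends by (intro exI[of _ "\<lambda>(t, x). F (x(m := 2 * t))"]) simp
  qed simp
  have "\<forall>c\<in>K. \<exists>\<gamma>. pathin X \<gamma> \<and> \<gamma> 0 = a c \<and> \<gamma> 1 = x0"
    using pc aX x0 unfolding path_connected_space_def by blast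
  from bchoice[OF this] obtain \<gamma> where \<gamma>: "\<forall>c\<in>K. pathin X (\<gamma> c) \<and> \<gamma> c 0 = a c \<and> \<gamma> c 1 = x0" ..
  have H2: "homotopic_with (\<lambda>_. True) (top_of_set P) Y g (\<lambda>_. dirac x0)"
  proof (subst homotopic_with)
    define k where "k = (\<lambda>s y. \<Sum>c | c \<in> K \<and> \<gamma> c (fst s) = y. w c (snd s))"
    have kc: "continuous_map (prod_topology \<I> (top_of_set P)) Y k"
      unfolding k_def
    proof (rule flag)
      show "continuous_map (prod_topology \<I> (top_of_set P)) X (\<lambda>s. \<gamma> c (fst s))" if "c \<in> K" for c
        using continuous_map_compose[OF continuous_map_fst[of \<I> "top_of_set P"], of X "\<gamma> c"] \<gamma> that
        by (simp add: pathin_def o_def)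
      show "continuous_map (prod_topology \<I> (top_of_set P)) (top_of_set P) (\<lambda>s. snd s)"
        by (rule continuous_map_snd)
    qed
    have k0: "k (0, x) = g x" for x
      unfolding k_def g_def using \<gamma> by (intro ext sum.cong) auto
    have k1: "k (1, x) = dirac x0" if "x \<in> P" for x
    proof -
      have kY: "k (1, x) \<in> topspace Y" using continuous_map_image_subset_topspace[OF kc] that by auto
      have z: "k (1, x) y = 0" if "y \<noteq> x0" for y
        unfolding k_def using \<gamma> that by (intro sum.neutral) auto
      have "(\<Sum>y | k (1, x) y \<noteq> 0. k (1, x) y) = (\<Sum>y\<in>{x0}. k (1, x) y)"
        using z by (intro sum.mono_neutral_left) auto
      then have "k (1, x) x0 = 1" using Y_D(5)[OF kY] by simp
      then show ?thesis using z by (auto simp: dirac_def)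
    qed
    show "\<exists>h. continuous_map (prod_topology \<I> (top_of_set P)) Y h \<and>
       (\<forall>x\<in>topspace (top_of_set P). h (0, x) = g x) \<and> (\<forall>x\<in>topspace (top_of_set P). h (1, x) = dirac x0) \<and> (\<forall>t\<in>{0..1}. True)"
      using kc k0 k1 by (intro exI[of _ k]) simp
  qed simp
  have "homotopic_with (\<lambda>_. True) (top_of_set P) Y (\<lambda>x. f (sc x)) (\<lambda>_. dirac x0)"
    by (rule homotopic_with_trans[OF H1 H2])
  moreover have "continuous_map (top_of_set ?S) (top_of_set P) (\<lambda>y i. real N * y i)"
  proof -
    have "(\<lambda>i. real N * y i) \<in> P" if "y \<in> ?S" for y
      using boundary_cells_cover[OF that] in_carrier_cell unfolding P_def K_def by blast
    then show ?thesis
      by (auto intro!: continuous_intros continuous_on_coordinatewise_then_product)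
  qed
  ultimately have "homotopic_with (\<lambda>_. True) (top_of_set ?S) Y ((\<lambda>x. f (sc x)) \<circ> (\<lambda>y i. real N * y i))
      ((\<lambda>_. dirac x0) \<circ> (\<lambda>y i. real N * y i))"
    by (rule homotopic_with_compose_continuous_map_right) simp
  moreover have "sc (\<lambda>i. real N * y i) = y" for y using N0 by (simp add: sc_def)
  ultimately show ?thesis by (simp add: o_def)
qed

end

section \<open>From the cube to the sphere\<close>

primrec sup_norm :: "nat \<Rightarrow> (nat \<Rightarrow> real) \<Rightarrow> real" where
  "sup_norm 0 x = 0"
| "sup_norm (Suc m) x = max (sup_norm m x) \<bar>x m\<bar>"

lemma continuous_on_sup_norm: "continuous_on S (sup_norm m)"
proof (induction m)
  case 0
  have "sup_norm 0 = (\<lambda>x. 0)" by auto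
  then show ?case by simp
next
  case (Suc m)
  have "continuous_on S (\<lambda>x. max (sup_norm m x) \<bar>x m\<bar>)"
    by (intro continuous_intros Suc)
  moreover have "sup_norm (Suc m) = (\<lambda>x. max (sup_norm m x) \<bar>x m\<bar>)" by auto
  ultimately show ?case by simp
qed

lemma sup_norm_ge: "i < m \<Longrightarrow> \<bar>x i\<bar> \<le> sup_norm m x"
  by (induction m) (auto simp: less_Suc_eq le_max_iff_disj)

lemma sup_norm_nonneg: "0 \<le> sup_norm m x"
  by (induction m) (auto simp: le_max_iff_disj)

lemma sup_norm_attained: "0 < sup_norm m x \<Longrightarrow> \<exists>i<m. \<bar>x i\<bar> = sup_norm m x"
  by (induction m) (auto simp: max_def less_Suc_eq split: if_splits)

lemma nsphere_eq: "nsphere k = top_of_set (boundary_sphere (Suc k))"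
proof -
  have "boundary_sphere (Suc k) = {x. (\<Sum>i\<le>k. (x i)\<^sup>2) = 1 \<and> (\<forall>i>k. x i = 0)}"
    by (auto simp: boundary_sphere_def topspace_Euclidean_space lessThan_Suc_atMost Suc_le_eq)
  then show ?thesis by (simp add: nsphere euclidean_product_topology)
qed

text \<open>Radial projection from the centre (1, ..., 1) of the cube; \<open>sphere_to_cube\<close>
  projects back, using the maximum norm.\<close>

definition cube_to_sphere :: "nat \<Rightarrow> (nat \<Rightarrow> real) \<Rightarrow> nat \<Rightarrow> real" where
  "cube_to_sphere m y i = (if i < m then (y i - 1) / rad m (\<lambda>i. y i - 1) else 0)"

definition sphere_to_cube :: "nat \<Rightarrow> (nat \<Rightarrow> real) \<Rightarrow> nat \<Rightarrow> real" where
  "sphere_to_cube m x i = (if i < m then 1 + x i / sup_norm m x else 0)"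

lemma rad_cong: "(\<And>i. i < m \<Longrightarrow> x i = y i) \<Longrightarrow> rad m x = rad m y"
  by (simp add: rad_def)

lemma continuous_map_cube_to_sphere:
  "continuous_map (top_of_set (bd (ones m))) (top_of_set (boundary_sphere m)) (cube_to_sphere m)"
proof -
  have pos: "0 < rad m (\<lambda>i. y i - 1)" if y: "y \<in> bd (ones m)" for y
  proof -
    obtain i where "i < m" "y i = 0 \<or> y i = 2" using y by (auto simp: bd_ones)
    then show ?thesis using abs_coord_le_rad[of i m "\<lambda>i. y i - 1"] by auto
  qed
  have "rad m (cube_to_sphere m y) = 1" if "y \<in> bd (ones m)" for y
  proof -
    have "rad m (cube_to_sphere m y) = rad m (\<lambda>i. inverse (rad m (\<lambda>i. y i - 1)) * (y i - 1))"
      by (rule rad_cong) (simp add: cube_to_sphere_def field_simps)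
    then show ?thesis using pos[OF that] by (simp add: rad_scale)
  qed
  moreover have "continuous_on (bd (ones m)) (cube_to_sphere m)"
  proof (rule continuous_on_coordinatewise_then_product)
    fix i
    have "continuous_on (bd (ones m)) (\<lambda>y. (y i - 1) / rad m (\<lambda>i. y i - 1))"
      unfolding rad_def
      by (intro continuous_intros) (use pos in \<open>auto simp: rad_def less_le\<close>)
    then show "continuous_on (bd (ones m)) (\<lambda>y. cube_to_sphere m y i)"
      unfolding cube_to_sphere_def by (cases "i < m") auto
  qed
  ultimately show ?thesis
    by (auto simp: boundary_sphere_eq cdisc_def cube_to_sphere_def)
qed

lemma sup_norm_pos:
  assumes "x \<in> boundary_sphere m"
  shows "0 < sup_norm m x"
proof (rule ccontr)
  assume "\<not> 0 < sup_norm m x"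
  then have "x i = 0" if "i < m" for i using sup_norm_ge[OF that, of x] sup_norm_nonneg[of m x] by simp
  then have "rad m x = 0" by (simp add: rad_def)
  then show False using assms by (simp add: boundary_sphere_eq)
qed

lemma continuous_map_sphere_to_cube:
  "continuous_map (top_of_set (boundary_sphere m)) (top_of_set (bd (ones m))) (sphere_to_cube m)"
proof -
  have "sphere_to_cube m x \<in> bd (ones m)" if x: "x \<in> boundary_sphere m" for x
  proof -
    note p = sup_norm_pos[OF x]
    have le: "\<bar>x i / sup_norm m x\<bar> \<le> 1" if "i < m" for i
      using sup_norm_ge[OF that, of x] p by simp
    have "0 \<le> 1 + x i / sup_norm m x \<and> 1 + x i / sup_norm m x \<le> 2" if "i < m" for i
      using le[OF that] by linarith
    moreover obtain j where j: "j < m" "\<bar>x j\<bar> = sup_norm m x" using sup_norm_attained[OF p] by blast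
    then have "x j = sup_norm m x \<or> x j = - sup_norm m x" by linarith
    then have "x j / sup_norm m x = 1 \<or> x j / sup_norm m x = - 1" using p by (elim disjE) simp_all
    ultimately show ?thesis
      using j(1) by (auto simp: bd_ones gcell_ones sphere_to_cube_def intro!: exI[of _ j])
  qed
  moreover have "continuous_on (boundary_sphere m) (sphere_to_cube m)"
  proof (rule continuous_on_coordinatewise_then_product)
    fix i
    have "continuous_on (boundary_sphere m) (\<lambda>x. 1 + x i / sup_norm m x)"
      by (intro continuous_intros continuous_on_sup_norm) (use sup_norm_pos in force)
    then show "continuous_on (boundary_sphere m) (\<lambda>x. sphere_to_cube m x i)"
      unfolding sphere_to_cube_def by (cases "i < m") auto
  qed
  ultimately show ?thesis by auto
qed

lemma cube_to_sphere_to_cube: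
  assumes x: "x \<in> boundary_sphere m"
  shows "cube_to_sphere m (sphere_to_cube m x) = x"
proof
  fix i
  have "rad m (\<lambda>i. sphere_to_cube m x i - 1) = rad m (\<lambda>i. inverse (sup_norm m x) * x i)"
    by (rule rad_cong) (simp add: sphere_to_cube_def field_simps)
  also have "\<dots> = inverse (sup_norm m x)"
    using x sup_norm_pos[OF x] by (simp add: rad_scale boundary_sphere_eq)
  finally show "cube_to_sphere m (sphere_to_cube m x) i = x i"
    using sup_norm_pos[OF x] x by (simp add: cube_to_sphere_def sphere_to_cube_def boundary_sphere_eq cdisc_def)
qed

text \<open>A free null-homotopy amounts to an extension \<open>F\<close> of the map to the solid
  cube. Contracting the cube along straight lines to the image of the base point gives a homotopy
  that keeps the base point at \<open>y\<close>, wherever the free homotopy ended.\<close>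

lemma (in nice_barycenters) based_null_homotopic:
  assumes k: "k < n" and pc: "path_connected_space X" and y: "y \<in> topspace Y"
    and f: "continuous_map (nsphere k) Y f" "f nsphere_base = y"
  shows "homotopic_with (\<lambda>h. h nsphere_base = y) (nsphere k) Y f (\<lambda>_. y)"
proof -
  let ?m = "Suc k"
  let ?S = "bd (ones ?m)" and ?B = "boundary_sphere ?m"
  have base: "nsphere_base \<in> ?B"
    using in_topspace_nsphere[of k] by (simp add: nsphere_eq nsphere_base_def)
  obtain x0 where x0: "x0 \<in> topspace X" using Y_nonzero[OF y] by blast
  have fn: "continuous_map (top_of_set ?S) Y (f \<circ> cube_to_sphere ?m)"
    using continuous_map_compose[OF continuous_map_cube_to_sphere f(1)[unfolded nsphere_eq]] .
  obtain H where H: "continuous_map (prod_topology \<I> (top_of_set ?S)) Y H"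
    "\<forall>x. H (0, x) = (f \<circ> cube_to_sphere ?m) x" "\<forall>x. H (1, x) = dirac x0"
    using cube_boundary_null_homotopic[OF _ _ pc x0 fn] k unfolding homotopic_with_def by auto
  have K: "continuous_map (prod_topology \<I> (top_of_set ?S)) Y (\<lambda>(t, x). H (t, x))" using H(1) by simp
  have K1: "H (1, x) = H (1, x')" for x x' using H(3) by simp
  have "finite (odds (ones ?m))" "odds (ones ?m) \<noteq> {}" by (auto simp: odds_ones)
  from cone_extend[OF this K K1] obtain F where F: "continuous_map (top_of_set (gcell (ones ?m))) Y F"
    "\<forall>x\<in>?S. F x = H (0, x)" by (elim exE conjE) (rule that)
  let ?s = "sphere_to_cube ?m"
  have sS: "?s x \<in> ?S" if "x \<in> ?B" for x
    using continuous_map_image_subset_topspace[OF continuous_map_sphere_to_cube] that by auto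
  have Fs: "F (?s x) = f x" if "x \<in> ?B" for x
    using F(2) sS[OF that] H(2) cube_to_sphere_to_cube[OF that] by simp
  have sc: "continuous_on ?B (\<lambda>x. ?s x i)" for i
    using continuous_map_sphere_to_cube by (auto intro: continuous_on_product_then_coordinatewise)
  have "continuous_map (prod_topology \<I> (nsphere k)) (top_of_set (gcell (ones ?m)))
     (\<lambda>(t, x) i. (1 - t) * ?s x i + t * ?s nsphere_base i)"
    unfolding nsphere_eq prod_topology_subtopology_eu continuous_map_subtopology_eu
  proof
    have "continuous_on ({0..1 :: real} \<times> ?B) (\<lambda>z. ?s (snd z) i)" for i
      by (rule continuous_on_compose2[OF sc]) (auto intro: continuous_intros)
    then show "continuous_on ({0..1} \<times> ?B) (\<lambda>(t, x) i. (1 - t) * ?s x i + t * ?s nsphere_base i)"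
      unfolding case_prod_unfold by (intro continuous_on_coordinatewise_then_product continuous_intros)
    show "(\<lambda>(t, x) i. (1 - t) * ?s x i + t * ?s nsphere_base i) \<in> {0..1} \<times> ?B \<rightarrow> gcell (ones ?m)"
    proof clarify
      fix t :: real and x assume t: "t \<in> {0..1}" and x: "x \<in> ?B"
      have "0 \<le> ?s x i \<and> ?s x i \<le> 2 \<and> 0 \<le> ?s nsphere_base i \<and> ?s nsphere_base i \<le> 2" if "i < ?m" for i
        using sS[OF x] sS[OF base] that by (auto simp: bd_ones gcell_ones)
      moreover have "(1 - t) * u + t * v \<le> 2" if "u \<le> 2" "v \<le> 2" for u v
        using convex_bound_le[OF that, of "1 - t" t] t by auto
      ultimately show "(\<lambda>i. (1 - t) * ?s x i + t * ?s nsphere_base i) \<in> gcell (ones ?m)"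
        using t by (auto simp: gcell_ones sphere_to_cube_def[of _ _ "_ :: nat"])
    qed
  qed
  from continuous_map_compose[OF this F(1)]
  have "continuous_map (prod_topology \<I> (nsphere k)) Y
     (\<lambda>(t, x). F (\<lambda>i. (1 - t) * ?s x i + t * ?s nsphere_base i))"
    by (simp add: o_def case_prod_unfold)
  moreover have "(1 - t) * u + t * u = u" for t u :: real by (simp add: algebra_simps)
  ultimately show ?thesis
    using Fs Fs[OF base] f(2)
    by (subst homotopic_with)
      (auto simp: nsphere_eq base intro!: exI[of _ "\<lambda>(t, x). F (\<lambda>i. (1 - t) * ?s x i + t * ?s nsphere_base i)"])
qed

theorem theorem3p3:
  fixes X :: "'a topology"
    and E :: "'a set set" and d :: "'a set \<Rightarrow> nat" and \<Phi> :: "'a set \<Rightarrow> (nat \<Rightarrow> real) \<Rightarrow> 'a"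
    and n :: nat
  assumes "CW_complex X E d \<Phi>"
    and "connected_space X" and "topspace X \<noteq> {}"
    and "n \<ge> 1"
  shows "n_connected_space (n - 1) (barycenter_space n X)"
proof -
  interpret CW X E d \<Phi> by unfold_locales (rule assms(1))
  interpret nice_barycenters n X
    using assms(4) Haus locally_contractible by unfold_locales
  have pc: "path_connected_space X" by (rule path_connected[OF assms(2)])
  obtain x where "x \<in> topspace X" using assms(3) by blast
  then have "dirac x \<in> topspace Y"
    using assms(4) by (auto simp: topspace_Y finite_prob_measures_def dirac_def)
  then have "topspace Y \<noteq> {}" by blast
  moreover have "is_singleton (homotopy_set k Y y)" if k: "k \<le> n - 1" and y: "y \<in> topspace Y" for k y
  proof -
    let ?R = "{(f, g). homotopic_with (\<lambda>h. h nsphere_base = y) (nsphere k) Y f g}"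
    have c: "(\<lambda>_. y) \<in> based_maps k Y y" using y by (simp add: based_maps_def)
    have eq: "?R `` {f} = ?R `` {\<lambda>_. y}" if "f \<in> based_maps k Y y" for f
    proof -
      \<comment> \<open>As \<open>n\<close> is positive, truncated subtraction does no harm; the
        k-sphere then bounds a cube of dimension k + 1 \<le> n, as the flag argument
        requires.\<close>
      have "k < n" using k assms(4) by linarith
      then have "homotopic_with (\<lambda>h. h nsphere_base = y) (nsphere k) Y f (\<lambda>_. y)"
        using based_null_homotopic[OF _ pc y] that by (simp add: based_maps_def)
      then show ?thesis by (auto intro: homotopic_with_trans homotopic_with_symD)
    qed
    have "(\<Union>f\<in>based_maps k Y y. {?R `` {f}}) = (\<Union>f\<in>based_maps k Y y. {?R `` {\<lambda>_. y}})"
      by (rule SUP_cong) (simp_all only: eq)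
    also have "\<dots> = {?R `` {\<lambda>_. y}}"
      using c by (subst UN_constant) (metis empty_iff)
    finally have "homotopy_set k Y y = {?R `` {\<lambda>_. y}}"
      unfolding homotopy_set_def quotient_def .
    then show ?thesis by (simp add: is_singleton_def)
  qed
  ultimately show ?thesis unfolding n_connected_space_def by blast
qed

end
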